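(* Let $(E,\langle\cdot,\cdot\rangle,\Theta)$ be an irreducible Courant algebroid over a manifold $M$ and let $\mathcal N$ be a skew-symmetric vector bundle endomorphism of $E$. Then the torsion $T_\Theta\mathcal N$ is given by an element of $\mathcal A^3$, i.e. $(u,v,w)\mapsto\langle(T_\Theta\mathcal N)(u,v),w\rangle$ is a skew-symmetric covariant $3$-tensor on $E$, if and only if $\mathcal N$ is proportional to a generalized almost cps structure.
   Context: Vector bundles are smooth, real, of finite rank over a manifold $M$; $\Gamma E$ denotes sections. Let $(E,\langle\cdot,\cdot\rangle)$ be a vector bundle with a fiberwise non-degenerate symmetric bilinear form. Its minimal symplectic realization is the graded manifold $\widetilde E=j^!(T^*[2]E[1])$, where $j:E[1]\to E[1]\oplus E^*[1]$, $u\mapsto(u,\frac12\langle u,\cdot\rangle)$, and $j^!$ denotes pull-back by $j$. $\mathcal A=\bigoplus_k\mathcal A^k$ is the graded algebra of functions on $\widetilde E$ with its canonical Poisson bracket $\{\cdot,\cdot\}$ of degree $-2$; $\mathcal A^0=C^\infty(M)$, $\mathcal A^1=\Gamma E$, and $\{u,v\}=\langle u,v\rangle$ for sections $u,v$. (In local coordinates $(q^i,\tau^a,p_i)$ of degrees $0,1,2$ attached to a local basis $(e_a)$ with $g_{ab}=\langle e_a,e_b\rangle$ constant, the non-vanishing brackets are $\{q^i,p_j\}=\delta^i_j$, $\{\tau^a,\tau^b\}=g^{ab}$.) Skew-symmetric covariant $3$-tensors on $E$ are identified with elements of $\mathcal A^3$ that are locally cubic in the $\tau^a$ with coefficients in $C^\infty(M)$.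 A Courant algebroid structure on $(E,\langle\cdot,\cdot\rangle)$ is an element $\Theta\in\mathcal A^3$ with $\{\Theta,\Theta\}=0$; its anchor is $\rho(u)f=\{\{u,\Theta\},f\}$, its (Dorfman) bracket is $[u,v]=\{\{u,\Theta\},v\}$. With $\partial:C^\infty(M)\to\Gamma E$ defined by $\langle u,\partial f\rangle=\rho(u)\cdot f$, these satisfy $[u,v]+[v,u]=\partial\langle u,v\rangle$ and $\langle[u,v],w\rangle+\langle v,[u,w]\rangle=\langle u,\partial\langle v,w\rangle\rangle$. An endomorphism $\mathcal N$ of $E$ is skew-symmetric if $\langle\mathcal Nu,v\rangle+\langle u,\mathcal Nv\rangle=0$ for all $u,v$. Its torsion is $(T_\Theta\mathcal N)(u,v)=[\mathcal Nu,\mathcal Nv]-\mathcal N([\mathcal Nu,v]+[u,\mathcal Nv]-\mathcal N[u,v])$. A generalized almost cps structure is a skew-symmetric endomorphism with square $-\mathrm{Id}_E$, $\mathrm{Id}_E$ or $0$. "Proportional to" means equal to a real constant multiple of (so $\mathcal N$ is proportional to a generalized almost cps structure iff $\mathcal N^2=\lambda\,\mathrm{Id}_E$ for some $\lambda\in\mathbb R$). The Courant algebroid $E$ is irreducible if every symmetric vector bundle endomorphism $\phi$ of $E$ (i.e. $\langle\phi u,v\rangle=\langle u,\phi v\rangle$) such that $[u,\phi v]=\phi[u,v]$ and $[\phi u,v]=\phi[u,v]$ for all sections $u,v$ is proportional to $\mathrm{Id}_E$. *)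

theory Defs
  imports "HOL-Analysis.Analysis" "HOL-Library.Multiset"
begin

section \<open>Smooth functions on open subsets of Euclidean n-space\<close>

text \<open>\<open>\<real>\<^sup>n\<close> is the carrier of the library's \<^const>\<open>Euclidean_space\<close> \<open>n\<close>, i.e. the functions
  \<open>nat \<Rightarrow> real\<close> vanishing from index \<open>n\<close> on; \<open>n = 0\<close> is allowed.\<close>

definition partial :: "nat \<Rightarrow> ((nat \<Rightarrow> real) \<Rightarrow> real) \<Rightarrow> (nat \<Rightarrow> real) \<Rightarrow> real" where
  "partial i F y = deriv (\<lambda>t. F (y(i := t))) (y i)"

fun Ck_on :: "nat \<Rightarrow> (nat \<Rightarrow> real) set \<Rightarrow> nat \<Rightarrow> ((nat \<Rightarrow> real) \<Rightarrow> real) \<Rightarrow> bool" where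
  "Ck_on n V 0 F \<longleftrightarrow> continuous_on V F"
| "Ck_on n V (Suc k) F \<longleftrightarrow> continuous_on V F \<and>
     (\<forall>i<n. (\<forall>y\<in>V. (\<lambda>t. F (y(i := t))) differentiable (at (y i))) \<and> Ck_on n V k (partial i F))"

definition Cinf_on :: "nat \<Rightarrow> (nat \<Rightarrow> real) set \<Rightarrow> ((nat \<Rightarrow> real) \<Rightarrow> real) \<Rightarrow> bool" where
  "Cinf_on n V F \<longleftrightarrow> (\<forall>k. Ck_on n V k F)"

section \<open>Smooth manifolds\<close>

text \<open>The underlying topological space of \<open>M\<close> is a Hausdorff second countable type \<open>'m\<close>.
  A chart is a domain together with a coordinate map \<open>q\<close>, the \<open>i\<close>-th coordinate of \<open>x\<close>
  being \<open>q x i\<close>.\<close>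

type_synonym 'm chart = "'m set \<times> ('m \<Rightarrow> nat \<Rightarrow> real)"

definition smooth_atlas ::
    "nat \<Rightarrow> ('m::{t2_space,second_countable_topology}) chart set \<Rightarrow> bool" where
  "smooth_atlas n \<A> \<longleftrightarrow>
     (\<Union>(U, q)\<in>\<A>. U) = UNIV \<and>
     (\<forall>(U, q)\<in>\<A>. open U \<and>
        (\<exists>V. openin (Euclidean_space n) V \<and>
             homeomorphic_map (top_of_set U) (subtopology (Euclidean_space n) V) q)) \<and>
     (\<forall>(U, q)\<in>\<A>. \<forall>(U', q')\<in>\<A>. \<forall>i<n.
        Cinf_on n (q ` (U \<inter> U')) (\<lambda>y. q' (inv_into U q y) i))"

definition smooth_fun_on :: "nat \<Rightarrow> 'm chart set \<Rightarrow> 'm set \<Rightarrow> ('m \<Rightarrow> real) \<Rightarrow> bool" where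
  "smooth_fun_on n \<A> W f \<longleftrightarrow>
     (\<forall>(U, q)\<in>\<A>. Cinf_on n (q ` (U \<inter> W)) (\<lambda>y. f (inv_into U q y)))"

fun chart_deriv :: "'m chart \<Rightarrow> nat \<Rightarrow> ('m \<Rightarrow> real) \<Rightarrow> 'm \<Rightarrow> real" where
  "chart_deriv (U, q) i f x = partial i (\<lambda>y. f (inv_into U q y)) (q x)"

section \<open>Vector bundles with a non-degenerate symmetric bilinear form\<close>

text \<open>The fibres are subspaces of one real vector space \<open>'v\<close>, which carries no topology; the
  smooth structure of the bundle is given by local frames with smooth transition matrices.
  A local frame \<open>(U, r, e)\<close> consists of the \<open>r\<close> local sections \<open>e a\<close>, \<open>a < r\<close>, over \<open>U\<close>.\<close>

type_synonym ('m, 'v) local_frame = "'m set \<times> nat \<times> (nat \<Rightarrow> 'm \<Rightarrow> 'v)"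

record ('m, 'v) metric_bundle =
  mdim :: nat
  atlas :: "'m chart set"
  fibre :: "'m \<Rightarrow> 'v set"
  frames :: "('m, 'v) local_frame set"
  form :: "'m \<Rightarrow> 'v \<Rightarrow> 'v \<Rightarrow> real"

definition is_fibre_basis ::
    "('m, 'v::real_vector) metric_bundle \<Rightarrow> nat \<Rightarrow> (nat \<Rightarrow> 'm \<Rightarrow> 'v) \<Rightarrow> 'm \<Rightarrow> bool" where
  "is_fibre_basis B r e x \<longleftrightarrow>
     inj_on (\<lambda>a. e a x) {..<r} \<and> independent ((\<lambda>a. e a x) ` {..<r}) \<and>
     span ((\<lambda>a. e a x) ` {..<r}) = fibre B x"

definition coeff :: "nat \<Rightarrow> (nat \<Rightarrow> 'm \<Rightarrow> 'v::real_vector) \<Rightarrow> nat \<Rightarrow> 'm \<Rightarrow> 'v \<Rightarrow> real" where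
  "coeff r e a x v = representation ((\<lambda>b. e b x) ` {..<r}) v (e a x)"

abbreviation smooth_on :: "('m, 'v) metric_bundle \<Rightarrow> 'm set \<Rightarrow> ('m \<Rightarrow> real) \<Rightarrow> bool" where
  "smooth_on B \<equiv> smooth_fun_on (mdim B) (atlas B)"

definition smooth_section_on ::
    "('m, 'v::real_vector) metric_bundle \<Rightarrow> 'm set \<Rightarrow> ('m \<Rightarrow> 'v) \<Rightarrow> bool" where
  "smooth_section_on B W s \<longleftrightarrow>
     (\<forall>x\<in>W. s x \<in> fibre B x) \<and>
     (\<forall>(U, r, e)\<in>frames B. \<forall>a<r. smooth_on B (U \<inter> W) (\<lambda>x. coeff r e a x (s x)))"

definition sections :: "('m, 'v::real_vector) metric_bundle \<Rightarrow> ('m \<Rightarrow> 'v) set" where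
  "sections B = {s. smooth_section_on B UNIV s}"

definition vector_bundle ::
    "('m::{t2_space,second_countable_topology}, 'v::real_vector) metric_bundle \<Rightarrow> bool" where
  "vector_bundle B \<longleftrightarrow>
     smooth_atlas (mdim B) (atlas B) \<and>
     (\<Union>(U, r, e)\<in>frames B. U) = UNIV \<and>
     (\<forall>(U, r, e)\<in>frames B. open U \<and> (\<forall>x\<in>U. is_fibre_basis B r e x) \<and>
        (\<forall>a<r. smooth_section_on B U (e a)))"

definition metric_vector_bundle ::
    "('m::{t2_space,second_countable_topology}, 'v::real_vector) metric_bundle \<Rightarrow> bool" where
  "metric_vector_bundle B \<longleftrightarrow>
     vector_bundle B \<and>
     (\<forall>x. \<forall>u\<in>fibre B x. \<forall>v\<in>fibre B x. form B x u v = form B x v u) \<and>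
     (\<forall>x. \<forall>u\<in>fibre B x. \<forall>v\<in>fibre B x. \<forall>w\<in>fibre B x.
        form B x (u + v) w = form B x u w + form B x v w) \<and>
     (\<forall>x c. \<forall>u\<in>fibre B x. \<forall>w\<in>fibre B x. form B x (c *\<^sub>R u) w = c * form B x u w) \<and>
     (\<forall>x. \<forall>u\<in>fibre B x. (\<forall>v\<in>fibre B x. form B x u v = 0) \<longrightarrow> u = 0) \<and>
     (\<forall>(U, r, e)\<in>frames B. \<forall>a<r. \<forall>b<r. smooth_on B U (\<lambda>x. form B x (e a x) (e b x)))"

section \<open>Functions on the minimal symplectic realization in local coordinates\<close>

text \<open>Adapted coordinates on the part of the minimal symplectic realization over an open set
  \<open>ac_dom\<close>: coordinates \<open>q\<^sup>i\<close> from a chart of \<open>M\<close> and a smooth frame \<open>e\<^sub>a\<close> of \<open>E\<close> over \<open>ac_dom\<close>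
  whose Gram matrix is constant. They induce coordinates \<open>q\<^sup>i\<close>, \<open>\<tau>\<^sup>a\<close>, \<open>p\<^sub>i\<close> of degrees 0, 1, 2.\<close>

record ('m, 'v) adapted_chart =
  ac_dom :: "'m set"
  ac_chart :: "'m chart"
  ac_rank :: nat
  ac_frame :: "nat \<Rightarrow> 'm \<Rightarrow> 'v"
  ac_gram :: "nat \<Rightarrow> nat \<Rightarrow> real"

definition adapted_charts ::
    "('m::{t2_space,second_countable_topology}, 'v::real_vector) metric_bundle \<Rightarrow>
     ('m, 'v) adapted_chart set" where
  "adapted_charts B = {\<kappa>.
     open (ac_dom \<kappa>) \<and> ac_chart \<kappa> \<in> atlas B \<and> ac_dom \<kappa> \<subseteq> fst (ac_chart \<kappa>) \<and>
     (\<forall>x\<in>ac_dom \<kappa>. is_fibre_basis B (ac_rank \<kappa>) (ac_frame \<kappa>) x) \<and>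
     (\<forall>a<ac_rank \<kappa>. smooth_section_on B (ac_dom \<kappa>) (ac_frame \<kappa> a)) \<and>
     (\<forall>x\<in>ac_dom \<kappa>. \<forall>a<ac_rank \<kappa>. \<forall>b<ac_rank \<kappa>.
        form B x (ac_frame \<kappa> a x) (ac_frame \<kappa> b x) = ac_gram \<kappa> a b)}"

text \<open>A local function \<open>F\<close> is given by its coefficients: \<open>F m S x\<close> is the coefficient at \<open>x\<close> of the
  monomial \<open>\<Prod>\<^sub>i\<^sub>\<in>\<^sub>m p\<^sub>i \<cdot> \<tau>\<^sup>S\<close>, where \<open>\<tau>\<^sup>S\<close> is the product of the \<open>\<tau>\<^sup>a\<close>, \<open>a \<in> S\<close>, in increasing order
  of \<open>a\<close>. The \<open>p\<^sub>i\<close> are even and the \<open>\<tau>\<^sup>a\<close> odd.\<close>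

type_synonym 'm lfun = "nat multiset \<Rightarrow> nat set \<Rightarrow> 'm \<Rightarrow> real"

definition monomials :: "nat \<Rightarrow> nat \<Rightarrow> nat \<Rightarrow> (nat multiset \<times> nat set) set" where
  "monomials n r k = {(m, S). set_mset m \<subseteq> {..<n} \<and> S \<subseteq> {..<r} \<and> 2 * size m + card S = k}"

definition shuffle_sign :: "nat set \<Rightarrow> nat set \<Rightarrow> real" where
  "shuffle_sign S T = (-1) ^ card {(s, t). s \<in> S \<and> t \<in> T \<and> t < s}"

definition lmult :: "'m lfun \<Rightarrow> 'm lfun \<Rightarrow> 'm lfun" where
  "lmult F G m S x =
     (\<Sum>m1\<in>{m1. m1 \<subseteq># m}. \<Sum>S1\<in>Pow S.
        shuffle_sign S1 (S - S1) * F m1 S1 x * G (m - m1) (S - S1) x)"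

definition lone :: "'m lfun" where
  "lone m S x = (if m = {#} \<and> S = {} then 1 else 0)"

definition ltau :: "nat \<Rightarrow> 'm lfun" where
  "ltau a m S x = (if m = {#} \<and> S = {a} then 1 else 0)"

definition lp :: "nat \<Rightarrow> 'm lfun" where
  "lp i m S x = (if m = {#i#} \<and> S = {} then 1 else 0)"

definition d_q :: "('m, 'v) adapted_chart \<Rightarrow> nat \<Rightarrow> 'm lfun \<Rightarrow> 'm lfun" where
  "d_q \<kappa> i F m S x = chart_deriv (ac_chart \<kappa>) i (F m S) x"

definition d_p :: "nat \<Rightarrow> 'm lfun \<Rightarrow> 'm lfun" where
  "d_p i F m S x = real (Suc (count m i)) * F (add_mset i m) S x"

definition d_tau_left :: "nat \<Rightarrow> 'm lfun \<Rightarrow> 'm lfun" where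
  "d_tau_left a F m S x =
     (if a \<in> S then 0 else (-1) ^ card {s\<in>S. s < a} * F m (insert a S) x)"

definition d_tau_right :: "nat \<Rightarrow> 'm lfun \<Rightarrow> 'm lfun" where
  "d_tau_right a F m S x =
     (if a \<in> S then 0 else (-1) ^ card {s\<in>S. a < s} * F m (insert a S) x)"

definition inv_gram :: "('m, 'v) adapted_chart \<Rightarrow> nat \<Rightarrow> nat \<Rightarrow> real" where
  "inv_gram \<kappa> = (THE h.
     (\<forall>a b. \<not> (a < ac_rank \<kappa> \<and> b < ac_rank \<kappa>) \<longrightarrow> h a b = 0) \<and>
     (\<forall>a<ac_rank \<kappa>. \<forall>c<ac_rank \<kappa>.
        (\<Sum>b<ac_rank \<kappa>. h a b * ac_gram \<kappa> b c) = (if a = c then 1 else 0)))"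

text \<open>The Poisson bracket, the graded biderivation with non-vanishing brackets
  \<open>{q\<^sup>i, p\<^sub>j} = \<delta>\<^sup>i\<^sub>j\<close> and \<open>{\<tau>\<^sup>a, \<tau>\<^sup>b} = g\<^sup>a\<^sup>b\<close> of generators; \<open>n\<close> is the dimension of \<open>M\<close>.\<close>

definition poisson :: "nat \<Rightarrow> ('m, 'v) adapted_chart \<Rightarrow> 'm lfun \<Rightarrow> 'm lfun \<Rightarrow> 'm lfun" where
  "poisson n \<kappa> F G m S x =
     (\<Sum>i<n. lmult (d_q \<kappa> i F) (d_p i G) m S x - lmult (d_p i F) (d_q \<kappa> i G) m S x) +
     (\<Sum>a<ac_rank \<kappa>. \<Sum>b<ac_rank \<kappa>.
        inv_gram \<kappa> a b * lmult (d_tau_right a F) (d_tau_left b G) m S x)"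

section \<open>Change of adapted coordinates\<close>

text \<open>The coordinates of \<open>\<kappa>'\<close> as functions in the coordinates of \<open>\<kappa>\<close>. Those of \<open>E[1]\<close> change by
  \<open>\<tau>'\<^sup>c = \<Sum>\<^sub>a T\<^sup>c\<^sub>a \<tau>\<^sup>a\<close>, where \<open>e\<^sub>a = \<Sum>\<^sub>c T\<^sup>c\<^sub>a e'\<^sub>c\<close>. On \<open>T\<^sup>*[2]E[1]\<close>, with momenta \<open>p\<^sub>i\<close>, \<open>\<theta>\<^sub>a\<close>, the invariance
  of the canonical form \<open>\<Sum>\<^sub>i p\<^sub>i dq\<^sup>i + \<Sum>\<^sub>a \<theta>\<^sub>a d\<tau>\<^sup>a\<close> gives
  \<open>p'\<^sub>j = \<Sum>\<^sub>i (\<partial>q\<^sup>i/\<partial>q'\<^sup>j) p\<^sub>i + \<Sum>\<^sub>a \<theta>\<^sub>a \<cdot> \<partial>\<tau>\<^sup>a/\<partial>q'\<^sup>j\<close>, and pulling back by \<open>j\<close> puts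
  \<open>\<theta>\<^sub>a = 1/2 \<Sum>\<^sub>b g\<^sub>a\<^sub>b \<tau>\<^sup>b\<close>.\<close>

definition new_tau :: "('m, 'v::real_vector) adapted_chart \<Rightarrow> ('m, 'v) adapted_chart \<Rightarrow> nat \<Rightarrow> 'm lfun"
  where
  "new_tau \<kappa> \<kappa>' c m S x =
     (\<Sum>a<ac_rank \<kappa>. coeff (ac_rank \<kappa>') (ac_frame \<kappa>') c x (ac_frame \<kappa> a x) * ltau a m S x)"

definition theta :: "('m, 'v) adapted_chart \<Rightarrow> nat \<Rightarrow> 'm lfun" where
  "theta \<kappa> a m S x = (\<Sum>b<ac_rank \<kappa>. 1/2 * ac_gram \<kappa> a b * ltau b m S x)"

definition d_old_tau ::
    "('m, 'v::real_vector) adapted_chart \<Rightarrow> ('m, 'v) adapted_chart \<Rightarrow> nat \<Rightarrow> nat \<Rightarrow> 'm lfun" where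
  "d_old_tau \<kappa> \<kappa>' j a m S x =
     (\<Sum>c<ac_rank \<kappa>'.
        chart_deriv (ac_chart \<kappa>') j
          (\<lambda>z. coeff (ac_rank \<kappa>) (ac_frame \<kappa>) a z (ac_frame \<kappa>' c z)) x *
        new_tau \<kappa> \<kappa>' c m S x)"

definition new_p ::
    "nat \<Rightarrow> ('m, 'v::real_vector) adapted_chart \<Rightarrow> ('m, 'v) adapted_chart \<Rightarrow> nat \<Rightarrow> 'm lfun" where
  "new_p n \<kappa> \<kappa>' j m S x =
     (\<Sum>i<n. chart_deriv (ac_chart \<kappa>') j (\<lambda>z. snd (ac_chart \<kappa>) z i) x * lp i m S x) +
     (\<Sum>a<ac_rank \<kappa>. lmult (theta \<kappa> a) (d_old_tau \<kappa> \<kappa>' j a) m S x)"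

definition new_monomial ::
    "nat \<Rightarrow> ('m, 'v::real_vector) adapted_chart \<Rightarrow> ('m, 'v) adapted_chart \<Rightarrow>
     nat multiset \<Rightarrow> nat set \<Rightarrow> 'm lfun" where
  "new_monomial n \<kappa> \<kappa>' m S =
     foldr lmult (map (new_p n \<kappa> \<kappa>') (sorted_list_of_multiset m) @
                  map (new_tau \<kappa> \<kappa>') (sorted_list_of_set S)) lone"

definition substitute ::
    "nat \<Rightarrow> nat \<Rightarrow> ('m, 'v::real_vector) adapted_chart \<Rightarrow> ('m, 'v) adapted_chart \<Rightarrow>
     'm lfun \<Rightarrow> 'm lfun" where
  "substitute n k \<kappa> \<kappa>' F m S x =
     (\<Sum>(m', S')\<in>monomials n (ac_rank \<kappa>') k. F m' S' x * new_monomial n \<kappa> \<kappa>' m' S' m S x)"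

section \<open>The graded Poisson algebra of functions\<close>

text \<open>A global function is the family of its local expressions in all adapted charts. Values outside
  the domains are irrelevant, so equality of functions is \<open>gfun_eq\<close>.\<close>

type_synonym ('m, 'v) gfun = "('m, 'v) adapted_chart \<Rightarrow> 'm lfun"

definition functions_of_degree ::
    "('m::{t2_space,second_countable_topology}, 'v::real_vector) metric_bundle \<Rightarrow> nat \<Rightarrow>
     ('m, 'v) gfun set" where
  "functions_of_degree B k = {F.
     (\<forall>\<kappa>\<in>adapted_charts B. \<forall>m S.
        smooth_on B (ac_dom \<kappa>) (F \<kappa> m S) \<and>
        ((m, S) \<notin> monomials (mdim B) (ac_rank \<kappa>) k \<longrightarrow> (\<forall>x\<in>ac_dom \<kappa>. F \<kappa> m S x = 0))) \<and>
     (\<forall>\<kappa>\<in>adapted_charts B. \<forall>\<kappa>'\<in>adapted_charts B. \<forall>x\<in>ac_dom \<kappa> \<inter> ac_dom \<kappa>'. \<forall>m S.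
        F \<kappa> m S x = substitute (mdim B) k \<kappa> \<kappa>' (F \<kappa>') m S x)}"

definition gfun_eq ::
    "('m::{t2_space,second_countable_topology}, 'v::real_vector) metric_bundle \<Rightarrow>
     ('m, 'v) gfun \<Rightarrow> ('m, 'v) gfun \<Rightarrow> bool" where
  "gfun_eq B F G \<longleftrightarrow> (\<forall>\<kappa>\<in>adapted_charts B. \<forall>x\<in>ac_dom \<kappa>. \<forall>m S. F \<kappa> m S x = G \<kappa> m S x)"

definition gbracket ::
    "('m, 'v) metric_bundle \<Rightarrow> ('m, 'v) gfun \<Rightarrow> ('m, 'v) gfun \<Rightarrow> ('m, 'v) gfun" where
  "gbracket B F G \<kappa> = poisson (mdim B) \<kappa> (F \<kappa>) (G \<kappa>)"

text \<open>A section \<open>u\<close> is the degree 1 function \<open>\<langle>u, \<cdot>\<rangle> = \<Sum>\<^sub>a \<langle>u, e\<^sub>a\<rangle> \<tau>\<^sup>a\<close>.\<close>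

definition section_fun :: "('m, 'v) metric_bundle \<Rightarrow> ('m \<Rightarrow> 'v) \<Rightarrow> ('m, 'v) gfun" where
  "section_fun B u \<kappa> m S x = (\<Sum>a<ac_rank \<kappa>. form B x (u x) (ac_frame \<kappa> a x) * ltau a m S x)"

section \<open>Courant algebroids\<close>

definition courant_structure ::
    "('m::{t2_space,second_countable_topology}, 'v::real_vector) metric_bundle \<Rightarrow>
     ('m, 'v) gfun \<Rightarrow> bool" where
  "courant_structure B \<Theta> \<longleftrightarrow>
     \<Theta> \<in> functions_of_degree B 3 \<and> gfun_eq B (gbracket B \<Theta> \<Theta>) (\<lambda>\<kappa> m S x. 0)"

definition dorfman ::
    "('m::{t2_space,second_countable_topology}, 'v::real_vector) metric_bundle \<Rightarrow>
     ('m, 'v) gfun \<Rightarrow> ('m \<Rightarrow> 'v) \<Rightarrow> ('m \<Rightarrow> 'v) \<Rightarrow> 'm \<Rightarrow> 'v" where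
  "dorfman B \<Theta> u v = (THE s. s \<in> sections B \<and>
     gfun_eq B (section_fun B s)
       (gbracket B (gbracket B (section_fun B u) \<Theta>) (section_fun B v)))"

definition bundle_endo ::
    "('m, 'v::real_vector) metric_bundle \<Rightarrow> ('m \<Rightarrow> 'v \<Rightarrow> 'v) \<Rightarrow> bool" where
  "bundle_endo B N \<longleftrightarrow>
     (\<forall>x. \<forall>u\<in>fibre B x. N x u \<in> fibre B x) \<and>
     (\<forall>x. \<forall>u\<in>fibre B x. \<forall>v\<in>fibre B x. N x (u + v) = N x u + N x v) \<and>
     (\<forall>x c. \<forall>u\<in>fibre B x. N x (c *\<^sub>R u) = c *\<^sub>R N x u) \<and>
     (\<forall>(U, r, e)\<in>frames B. \<forall>a<r. smooth_section_on B U (\<lambda>x. N x (e a x)))"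

definition skew_endo ::
    "('m, 'v::real_vector) metric_bundle \<Rightarrow> ('m \<Rightarrow> 'v \<Rightarrow> 'v) \<Rightarrow> bool" where
  "skew_endo B N \<longleftrightarrow> bundle_endo B N \<and>
     (\<forall>x. \<forall>u\<in>fibre B x. \<forall>v\<in>fibre B x. form B x (N x u) v + form B x u (N x v) = 0)"

definition sym_endo ::
    "('m, 'v::real_vector) metric_bundle \<Rightarrow> ('m \<Rightarrow> 'v \<Rightarrow> 'v) \<Rightarrow> bool" where
  "sym_endo B N \<longleftrightarrow> bundle_endo B N \<and>
     (\<forall>x. \<forall>u\<in>fibre B x. \<forall>v\<in>fibre B x. form B x (N x u) v = form B x u (N x v))"

definition apply_endo :: "('m \<Rightarrow> 'v \<Rightarrow> 'v) \<Rightarrow> ('m \<Rightarrow> 'v) \<Rightarrow> 'm \<Rightarrow> 'v" where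
  "apply_endo N u x = N x (u x)"

text \<open>Two endomorphisms are compared on the fibres only.\<close>

definition proportional ::
    "('m, 'v::real_vector) metric_bundle \<Rightarrow> ('m \<Rightarrow> 'v \<Rightarrow> 'v) \<Rightarrow> ('m \<Rightarrow> 'v \<Rightarrow> 'v) \<Rightarrow> bool" where
  "proportional B N J \<longleftrightarrow> (\<exists>c::real. \<forall>x. \<forall>u\<in>fibre B x. N x u = c *\<^sub>R J x u)"

definition irreducible_courant ::
    "('m::{t2_space,second_countable_topology}, 'v::real_vector) metric_bundle \<Rightarrow>
     ('m, 'v) gfun \<Rightarrow> bool" where
  "irreducible_courant B \<Theta> \<longleftrightarrow>
     (\<forall>\<phi>. sym_endo B \<phi> \<and>
        (\<forall>u\<in>sections B. \<forall>v\<in>sections B.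
           dorfman B \<Theta> u (apply_endo \<phi> v) = apply_endo \<phi> (dorfman B \<Theta> u v) \<and>
           dorfman B \<Theta> (apply_endo \<phi> u) v = apply_endo \<phi> (dorfman B \<Theta> u v))
        \<longrightarrow> proportional B \<phi> (\<lambda>x v. v))"

definition torsion ::
    "('m::{t2_space,second_countable_topology}, 'v::real_vector) metric_bundle \<Rightarrow>
     ('m, 'v) gfun \<Rightarrow> ('m \<Rightarrow> 'v \<Rightarrow> 'v) \<Rightarrow> ('m \<Rightarrow> 'v) \<Rightarrow> ('m \<Rightarrow> 'v) \<Rightarrow> 'm \<Rightarrow> 'v" where
  "torsion B \<Theta> N u v x =
     dorfman B \<Theta> (apply_endo N u) (apply_endo N v) x -
     N x (dorfman B \<Theta> (apply_endo N u) v x + dorfman B \<Theta> u (apply_endo N v) x -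
          N x (dorfman B \<Theta> u v x))"

definition gen_almost_cps ::
    "('m, 'v::real_vector) metric_bundle \<Rightarrow> ('m \<Rightarrow> 'v \<Rightarrow> 'v) \<Rightarrow> bool" where
  "gen_almost_cps B J \<longleftrightarrow> skew_endo B J \<and>
     ((\<forall>x. \<forall>u\<in>fibre B x. J x (J x u) = - u) \<or>
      (\<forall>x. \<forall>u\<in>fibre B x. J x (J x u) = u) \<or>
      (\<forall>x. \<forall>u\<in>fibre B x. J x (J x u) = 0))"

text \<open>Smooth skew-symmetric covariant 3-tensors; linearity in the other arguments follows from
  skew-symmetry.\<close>

definition skew_3_tensor ::
    "('m, 'v::real_vector) metric_bundle \<Rightarrow> ('m \<Rightarrow> 'v \<Rightarrow> 'v \<Rightarrow> 'v \<Rightarrow> real) \<Rightarrow> bool" where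
  "skew_3_tensor B t \<longleftrightarrow>
     (\<forall>x. \<forall>u\<in>fibre B x. \<forall>v\<in>fibre B x. \<forall>w\<in>fibre B x.
        t x v u w = - t x u v w \<and> t x u w v = - t x u v w \<and>
        (\<forall>u'\<in>fibre B x. t x (u + u') v w = t x u v w + t x u' v w) \<and>
        (\<forall>c. t x (c *\<^sub>R u) v w = c * t x u v w)) \<and>
     (\<forall>(U, r, e)\<in>frames B. \<forall>a<r. \<forall>b<r. \<forall>c<r.
        smooth_on B U (\<lambda>x. t x (e a x) (e b x) (e c x)))"

definition is_skew_3_tensor ::
    "('m, 'v::real_vector) metric_bundle \<Rightarrow>
     (('m \<Rightarrow> 'v) \<Rightarrow> ('m \<Rightarrow> 'v) \<Rightarrow> ('m \<Rightarrow> 'v) \<Rightarrow> 'm \<Rightarrow> real) \<Rightarrow> bool" where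
  "is_skew_3_tensor B F \<longleftrightarrow>
     (\<exists>t. skew_3_tensor B t \<and>
        (\<forall>u\<in>sections B. \<forall>v\<in>sections B. \<forall>w\<in>sections B. \<forall>x. F u v w x = t x (u x) (v x) (w x)))"

end

theory Submission
  imports Defs "HOL-Computational_Algebra.Polynomial"
begin

text \<open>
  Write \<open>[u, v]\<close> for the Dorfman bracket, \<open>\<rho>\<close> for the anchor, and put
  \<open>F(u, v, w) = \<langle>(T\<^sub>\<Theta> N)(u, v), w\<rangle>\<close>. Two identities carry the theorem:
  \<open>\<langle>[u, v] + [v, u], w\<rangle> = \<rho>(w) \<langle>u, v\<rangle>\<close> (\<open>dorfman_sym\<close>) and
  \<open>\<langle>[u, v], w\<rangle> + \<langle>v, [u, w]\<rangle> = \<rho>(u) \<langle>v, w\<rangle>\<close> (\<open>dorfman_metric\<close>). Since \<open>N\<close> is skew-symmetric, they give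
    \<^item> \<open>F(u, v, w) + F(u, w, v) = \<langle>N\<^sup>2 [u, w] - [u, N\<^sup>2 w], v\<rangle>\<close> (\<open>torsion_skew_23\<close>),
    \<^item> \<open>F(u, v, w) + F(v, u, w) = \<rho>(w) \<langle>N u, N v\<rangle> + \<rho>(N\<^sup>2 w) \<langle>u, v\<rangle>\<close> (\<open>torsion_skew_12\<close>).

  If \<open>F\<close> is a skew-symmetric tensor, both right-hand sides vanish. The first says that \<open>N\<^sup>2\<close> commutes
  with \<open>[u, \<cdot>]\<close>, and together with the second it also commutes with \<open>[\<cdot>, v]\<close>; as \<open>N\<^sup>2\<close> is symmetric,
  irreducibility gives \<open>N\<^sup>2 = c Id\<close> (\<open>torsion_tensor_imp_square\<close>), and dividing \<open>N\<close> by \<open>\<surd>\<bar>c\<bar>\<close> if \<open>c \<noteq> 0\<close>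
  yields an almost cps structure. Conversely, if \<open>N\<^sup>2 = c Id\<close>, both right-hand sides vanish by
  bilinearity over the reals, so \<open>F\<close> is skew-symmetric on sections. Its value at a point depends on the last
  section only through the value there, hence by skew-symmetry this holds for all three arguments, and
  \<open>F\<close> is a tensor (\<open>square_imp_torsion_tensor\<close>).

  It remains to see that the bracket exists, that is, that the local functions
  \<open>{{u, \<Theta>}, v}\<close> are the expressions of one smooth section (\<open>dorfman_ex1\<close>). In an adapted chart with
  frame \<open>e\<^sub>c\<close> and \<open>v\<^sub>c = \<langle>v, e\<^sub>c\<rangle>\<close>,
    \<open>\<langle>[u, v], w\<rangle> = \<Sum>\<^sub>c (\<rho>(u) v\<^sub>c) w\<^sup>c - \<Sum>\<^sub>c (\<rho>(v) u\<^sub>c) w\<^sup>c + \<Sum>\<^sub>c (\<rho>(w) u\<^sub>c) v\<^sup>c + C(u, v, w)\<close>,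
  where \<open>\<rho>\<close> is given by the coefficients of \<open>p\<^sub>i \<tau>\<^sup>a\<close> in \<open>\<Theta>\<close> and \<open>C\<close> by those of \<open>\<tau>\<^sup>a \<tau>\<^sup>b \<tau>\<^sup>c\<close>
  (\<open>bracket_dorfman_form\<close>); the two identities above are read off from this formula. A second chart changes
  the flat connection in the derivative terms by a form \<open>\<beta>\<close> with values in skew-symmetric endomorphisms, and
  the transformation law of the momenta \<open>p\<^sub>i\<close> changes \<open>C\<close> by the same terms in \<open>\<beta>\<close>, so that the sum is
  unchanged (\<open>dorfman_form_change\<close>). Global sections with prescribed values come from bump functions,
  and adapted charts around every point from the Gram-Schmidt process.
\<close>

section \<open>Differential calculus on open subsets of Euclidean n-space\<close>

lemma openin_Euclidean_space_iff:
  "openin (Euclidean_space n) V \<longleftrightarrow> (\<exists>T. open T \<and> V = T \<inter> {y. \<forall>i\<ge>n. y i = 0})"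
  by (simp add: Euclidean_space_def openin_subtopology euclidean_product_topology)

lemma Euclidean_space_open_zero:
  assumes "openin (Euclidean_space n) V" "y \<in> V" "i \<ge> n"
  shows "y i = 0"
  using assms by (auto simp: openin_Euclidean_space_iff)

lemma Euclidean_space_open_box:
  assumes V: "openin (Euclidean_space n) V" and y: "y \<in> V"
  obtains d where "d > 0"
    "\<And>z. (\<And>j. j < n \<Longrightarrow> \<bar>z j - y j\<bar> < d) \<Longrightarrow> (\<And>j. j \<ge> n \<Longrightarrow> z j = 0) \<Longrightarrow> z \<in> V"
proof -
  obtain T where T: "open T" "V = T \<inter> {y. \<forall>i\<ge>n. y i = 0}"
    using V by (auto simp: openin_Euclidean_space_iff)
  have "openin (product_topology (\<lambda>i::nat. euclidean) UNIV) T"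
    using T by (simp add: euclidean_product_topology)
  then obtain X where X: "y \<in> (\<Pi>\<^sub>E i\<in>UNIV. X i)" "\<And>i. openin euclidean (X i)"
      "(\<Pi>\<^sub>E i\<in>UNIV. X i) \<subseteq> T"
    using y T product_topology_open_contains_basis[of "\<lambda>i. euclidean" UNIV T y] by blast
  have "\<exists>e>0. \<forall>t. \<bar>t - y j\<bar> < e \<longrightarrow> t \<in> X j" for j
  proof -
    have "open (X j)" "y j \<in> X j" using X by auto
    then show ?thesis by (metis open_dist dist_real_def)
  qed
  then obtain e where e: "\<And>j. e j > 0" "\<And>j t. \<bar>t - y j\<bar> < e j \<Longrightarrow> t \<in> X j"
    by metis
  define d where "d = Min (insert 1 (e ` {..<n}))"
  have d: "d > 0" "\<And>j. j < n \<Longrightarrow> d \<le> e j"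
    by (auto simp: d_def e)
  have "z \<in> V" if z: "\<And>j. j < n \<Longrightarrow> \<bar>z j - y j\<bar> < d" "\<And>j. j \<ge> n \<Longrightarrow> z j = 0" for z
  proof -
    have "z j \<in> X j" for j
    proof (cases "j < n")
      case True
      then show ?thesis using z(1)[OF True] d(2)[OF True] e(2) by fastforce
    next
      case False
      then have "z j = y j" using z(2)[of j] y T(2) by auto
      then show ?thesis using e by simp
    qed
    then show ?thesis using X(3) z(2) T(2) by (auto simp: PiE_def)
  qed
  with d(1) show thesis using that by blast
qed

lemma eventually_update_in:
  assumes V: "openin (Euclidean_space n) V" and y: "y \<in> V" and i: "i < n"
  shows "\<forall>\<^sub>F t in nhds (y i). y(i := t) \<in> V"
proof -
  obtain d where d: "d > 0"
    "\<And>z. (\<And>j. j < n \<Longrightarrow> \<bar>z j - y j\<bar> < d) \<Longrightarrow> (\<And>j. j \<ge> n \<Longrightarrow> z j = 0) \<Longrightarrow> z \<in> V"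
    using Euclidean_space_open_box[OF V y] by metis
  have "\<forall>\<^sub>F t in nhds (y i). dist t (y i) < d"
    using d(1) eventually_nhds_metric by blast
  then show ?thesis
  proof eventually_elim
    case (elim t)
    show ?case
      by (rule d(2)) (use elim d(1) i Euclidean_space_open_zero[OF V y] in \<open>auto simp: dist_real_def\<close>)
  qed
qed

lemma partial_eqI:
  "((\<lambda>t. F (y(i := t))) has_real_derivative D) (at (y i)) \<Longrightarrow> partial i F y = D"
  by (simp add: partial_def DERIV_imp_deriv)

lemma DERIV_partial:
  assumes "Ck_on n V (Suc k) F" "y \<in> V" "i < n"
  shows "((\<lambda>t. F (y(i := t))) has_real_derivative partial i F y) (at (y i))"
  using assms by (simp add: partial_def DERIV_deriv_iff_real_differentiable)

lemma DERIV_update_cong: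
  assumes "openin (Euclidean_space n) V" "y \<in> V" "i < n" "\<And>z. z \<in> V \<Longrightarrow> F z = G z"
  shows "((\<lambda>t. F (y(i := t))) has_real_derivative D) (at (y i)) \<longleftrightarrow>
         ((\<lambda>t. G (y(i := t))) has_real_derivative D) (at (y i))"
  by (rule DERIV_cong_ev) (use eventually_update_in[OF assms(1-3)] in \<open>auto elim: eventually_mono simp: assms(4)\<close>)

lemma partial_cong:
  assumes "openin (Euclidean_space n) V" "y \<in> V" "i < n" "\<And>z. z \<in> V \<Longrightarrow> F z = G z"
  shows "partial i F y = partial i G y"
  unfolding partial_def deriv_def using DERIV_update_cong[of n V y i F G, OF assms] by simp

lemma Ck_on_cong:
  assumes "openin (Euclidean_space n) V" "\<And>z. z \<in> V \<Longrightarrow> F z = G z"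
  shows "Ck_on n V k F \<longleftrightarrow> Ck_on n V k G"
  using assms(2)
proof (induction k arbitrary: F G)
  case 0
  then show ?case by (simp cong: continuous_on_cong)
next
  case (Suc k)
  have c: "continuous_on V F \<longleftrightarrow> continuous_on V G"
    using Suc.prems by (simp cong: continuous_on_cong)
  have d: "(\<lambda>t. F (y(i := t))) differentiable (at (y i)) \<longleftrightarrow>
      (\<lambda>t. G (y(i := t))) differentiable (at (y i))" if "i < n" "y \<in> V" for i y
    unfolding real_differentiable_def using DERIV_update_cong[of n V y i F G, OF assms(1) that(2,1) Suc.prems]
    by auto
  have p: "Ck_on n V k (partial i F) \<longleftrightarrow> Ck_on n V k (partial i G)" if "i < n" for i
    by (rule Suc.IH) (rule partial_cong[OF assms(1) _ that Suc.prems])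
  show ?case using c d p by auto
qed

text \<open>The partial derivatives may be given by any functions that agree with them on \<open>V\<close>; this is how
  all closure properties are proved, by induction on the order of differentiability.\<close>

lemma Ck_on_SucI:
  assumes "openin (Euclidean_space n) V" "continuous_on V F"
    "\<And>i y. i < n \<Longrightarrow> y \<in> V \<Longrightarrow> ((\<lambda>t. F (y(i := t))) has_real_derivative G i y) (at (y i))"
    "\<And>i. i < n \<Longrightarrow> Ck_on n V k (G i)"
  shows "Ck_on n V (Suc k) F"
proof -
  have "Ck_on n V k (partial i F)" if "i < n" for i
  proof -
    have "partial i F y = G i y" if "y \<in> V" for y
      using partial_eqI assms(3) \<open>i < n\<close> that by blast
    then show ?thesis using Ck_on_cong[OF assms(1)] assms(4) that by blast
  qed
  then show ?thesis using assms(2,3) real_differentiable_def by auto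
qed

lemma Ck_on_continuous: "Ck_on n V k F \<Longrightarrow> continuous_on V F"
  by (cases k) auto

lemma Ck_on_Suc_imp: "Ck_on n V (Suc k) F \<Longrightarrow> Ck_on n V k F"
  by (induction k arbitrary: F) auto

lemma Ck_on_const: "openin (Euclidean_space n) V \<Longrightarrow> Ck_on n V k (\<lambda>y. c)"
proof (induction k arbitrary: c)
  case (Suc k)
  show ?case
    by (rule Ck_on_SucI[where G = "\<lambda>i y. 0"]) (auto intro: Suc)
qed simp

lemma Ck_on_coord: "openin (Euclidean_space n) V \<Longrightarrow> Ck_on n V k (\<lambda>y. y j)"
proof (cases k)
  case 0
  then show ?thesis using continuous_on_subset[OF continuous_on_product_coordinates] by auto
next
  case (Suc l)
  assume V: "openin (Euclidean_space n) V"
  show ?thesis unfolding Suc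
  proof (rule Ck_on_SucI[OF V, where G = "\<lambda>i y. if i = j then 1 else 0"])
    show "Ck_on n V l (\<lambda>y. if i = j then 1 else 0)" for i
      using Ck_on_const[OF V] by simp
  qed (auto intro: continuous_on_subset[OF continuous_on_product_coordinates])
qed

lemma Ck_on_add:
  assumes "openin (Euclidean_space n) V" "Ck_on n V k F" "Ck_on n V k G"
  shows "Ck_on n V k (\<lambda>y. F y + G y)"
  using assms(2,3)
proof (induction k arbitrary: F G)
  case 0
  then show ?case by (simp add: continuous_on_add)
next
  case (Suc k)
  show ?case
  proof (rule Ck_on_SucI[OF assms(1), where G = "\<lambda>i y. partial i F y + partial i G y"])
    show "continuous_on V (\<lambda>y. F y + G y)"
      using Suc.prems Ck_on_continuous by (blast intro: continuous_on_add)
    show "((\<lambda>t. F (y(i := t)) + G (y(i := t))) has_real_derivative partial i F y + partial i G y) (at (y i))"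
      if "i < n" "y \<in> V" for i y
      using that Suc.prems by (intro DERIV_add DERIV_partial)
  qed (use Suc in auto)
qed

lemma Ck_on_mult:
  assumes "openin (Euclidean_space n) V" "Ck_on n V k F" "Ck_on n V k G"
  shows "Ck_on n V k (\<lambda>y. F y * G y)"
  using assms(2,3)
proof (induction k arbitrary: F G)
  case 0
  then show ?case by (simp add: continuous_on_mult)
next
  case (Suc k)
  show ?case
  proof (rule Ck_on_SucI[OF assms(1), where G = "\<lambda>i y. partial i F y * G y + partial i G y * F y"])
    show "continuous_on V (\<lambda>y. F y * G y)"
      using Suc.prems Ck_on_continuous by (blast intro: continuous_on_mult)
    show "((\<lambda>t. F (y(i := t)) * G (y(i := t))) has_real_derivative
        partial i F y * G y + partial i G y * F y) (at (y i))"
      if "i < n" "y \<in> V" for i y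
      using DERIV_mult[OF DERIV_partial[OF Suc.prems(1) that(2,1)] DERIV_partial[OF Suc.prems(2) that(2,1)]]
      by (simp add: fun_upd_def)
    show "Ck_on n V k (\<lambda>y. partial i F y * G y + partial i G y * F y)" if "i < n" for i
      using Suc.prems that Ck_on_Suc_imp[OF Suc.prems(1)] Ck_on_Suc_imp[OF Suc.prems(2)]
      by (intro Ck_on_add[OF assms(1)] Suc.IH) auto
  qed
qed

text \<open>Composition with a function of one variable, given together with all its derivatives.\<close>

lemma Ck_on_compose_real:
  assumes V: "openin (Euclidean_space n) V" and "Ck_on n V k h"
    and \<phi>: "\<And>j t. t \<in> S \<Longrightarrow> (\<phi> j has_real_derivative \<phi> (Suc j) t) (at t)"
    and S: "\<And>y. y \<in> V \<Longrightarrow> h y \<in> S"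
  shows "Ck_on n V k (\<lambda>y. \<phi> j (h y))"
  using assms(2)
proof (induction k arbitrary: j)
  case 0
  have "continuous_on S (\<phi> j)"
    using \<phi> DERIV_isCont by (blast intro: continuous_at_imp_continuous_on)
  then show ?case using 0 S by (auto intro: continuous_on_compose2)
next
  case (Suc k)
  have c: "continuous_on S (\<phi> j)"
    using \<phi> DERIV_isCont by (blast intro: continuous_at_imp_continuous_on)
  show ?case
  proof (rule Ck_on_SucI[OF V, where G = "\<lambda>i y. \<phi> (Suc j) (h y) * partial i h y"])
    show "continuous_on V (\<lambda>y. \<phi> j (h y))"
      using c Suc.prems S by (auto intro: continuous_on_compose2)
    show "((\<lambda>t. \<phi> j (h (y(i := t)))) has_real_derivative \<phi> (Suc j) (h y) * partial i h y) (at (y i))"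
      if "i < n" "y \<in> V" for i y
      using DERIV_chain2[OF _ DERIV_partial[OF Suc.prems that(2,1)], of "\<phi> j"] \<phi>[OF S[OF that(2)]]
      by (simp add: fun_upd_def)
    show "Ck_on n V k (\<lambda>y. \<phi> (Suc j) (h y) * partial i h y)" if "i < n" for i
      using Suc.prems that Ck_on_Suc_imp[OF Suc.prems] by (intro Ck_on_mult[OF V] Suc.IH) auto
  qed
qed

text \<open>The chain rule along a curve. The increment of \<open>F\<close> is telescoped over the coordinates, and
  the mean value theorem is applied in each coordinate separately.\<close>

lemma DERIV_along_curve:
  assumes V: "openin (Euclidean_space n) V" and F: "Ck_on n V (Suc 0) F"
    and \<gamma>: "\<forall>\<^sub>F t in nhds t0. \<gamma> t \<in> V"
    and c: "\<And>j. j < n \<Longrightarrow> ((\<lambda>t. \<gamma> t j) has_real_derivative c j) (at t0)"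
  shows "((\<lambda>t. F (\<gamma> t)) has_real_derivative (\<Sum>j<n. partial j F (\<gamma> t0) * c j)) (at t0)"
proof -
  define y where "y = \<gamma> t0"
  have y: "y \<in> V" using \<gamma> eventually_nhds_x_imp_x y_def by blast
  \<comment> \<open>the point with its first \<open>j\<close> coordinates moved along the curve\<close>
  define p where "p j t = (\<lambda>i. if i < j then \<gamma> t i else y i)" for j t
  have p0: "p 0 t = y" for t by (simp add: p_def)
  have pn: "p n t = \<gamma> t" if "\<gamma> t \<in> V" for t
    using Euclidean_space_open_zero[OF V that] Euclidean_space_open_zero[OF V y]
    by (force simp: p_def)
  have slope: "((\<lambda>t. (F (p (Suc j) t) - F (p j t)) / (t - t0)) \<longlongrightarrow> partial j F y * c j) (at t0)"
    if j: "j < n" for j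
  proof -
    \<comment> \<open>the difference quotient in the \<open>j\<close>-th coordinate, continuous at \<open>t0\<close> even where it is \<open>0/0\<close>\<close>
    define g where "g t = (if \<gamma> t j = y j then partial j F y
      else (F (p (Suc j) t) - F (p j t)) / (\<gamma> t j - y j))" for t
    have g: "F (p (Suc j) t) - F (p j t) = g t * (\<gamma> t j - y j)" for t
    proof (cases "\<gamma> t j = y j")
      case True
      then have "p (Suc j) t = p j t" by (auto simp: p_def fun_eq_iff less_Suc_eq)
      then show ?thesis using True by simp
    qed (simp add: g_def)
    have "(g \<longlongrightarrow> partial j F y) (at t0)"
    proof (rule tendstoI)
      fix e :: real assume e: "e > 0"
      have "continuous_on V (partial j F)" using F j by simp
      then obtain T where T: "open T" "V \<inter> partial j F -` ball (partial j F y) e = V \<inter> T"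
        using continuous_on_open_invariant[of V "partial j F"]
        by (metis Int_commute open_ball)
      define W where "W = V \<inter> T"
      have W: "openin (Euclidean_space n) W"
        using V T(1) by (auto simp: openin_Euclidean_space_iff W_def Int_ac)
      have yW: "y \<in> W" using y T(2) e unfolding W_def by force
      obtain d where d: "d > 0" "\<And>z. (\<And>j. j < n \<Longrightarrow> \<bar>z j - y j\<bar> < d) \<Longrightarrow>
          (\<And>j. j \<ge> n \<Longrightarrow> z j = 0) \<Longrightarrow> z \<in> W"
        using Euclidean_space_open_box[OF W yW] by metis
      have "\<forall>\<^sub>F t in at t0. \<bar>\<gamma> t i - y i\<bar> < d" if "i < n" for i
      proof -
        have "((\<lambda>t. \<gamma> t i) \<longlongrightarrow> y i) (at t0)"
          using DERIV_isCont[OF c[OF that]] by (simp add: isCont_def y_def)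
        from tendstoD[OF this d(1)] show ?thesis by (simp add: dist_real_def)
      qed
      then have "\<forall>\<^sub>F t in at t0. \<forall>i\<in>{..<n}. \<bar>\<gamma> t i - y i\<bar> < d"
        by (intro eventually_ball_finite) auto
      then show "\<forall>\<^sub>F t in at t0. dist (g t) (partial j F y) < e"
      proof eventually_elim
        case (elim t)
        show ?case
        proof (cases "\<gamma> t j = y j")
          case True
          then show ?thesis using e by (simp add: g_def)
        next
          case False
          define P where "P s = (p j t)(j := s)" for s
          have PW: "P s \<in> W" if "\<bar>s - y j\<bar> < d" for s
            by (rule d(2)) (use that elim d(1) Euclidean_space_open_zero[OF V y] j
                in \<open>auto simp: P_def p_def\<close>)
          have P1: "P (\<gamma> t j) = p (Suc j) t" "P (y j) = p j t"
            by (auto simp: P_def p_def fun_eq_iff less_Suc_eq)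
          have D: "((\<lambda>s. F (P s)) has_real_derivative partial j F (P s)) (at s)"
            if "\<bar>s - y j\<bar> < d" for s
          proof -
            have "P s \<in> V" using PW[OF that] W_def by auto
            from DERIV_partial[OF F this j] show ?thesis by (simp add: P_def)
          qed
          obtain \<xi> where \<xi>: "\<bar>\<xi> - y j\<bar> < d"
            "F (P (\<gamma> t j)) - F (P (y j)) = (\<gamma> t j - y j) * partial j F (P \<xi>)"
          proof (cases "y j < \<gamma> t j")
            case True
            obtain z where "y j < z" "z < \<gamma> t j"
              "F (P (\<gamma> t j)) - F (P (y j)) = (\<gamma> t j - y j) * partial j F (P z)"
              using MVT2[OF True, of "\<lambda>s. F (P s)" "\<lambda>s. partial j F (P s)"] D elim j
              by (smt (verit, best) lessThan_iff)
            then show thesis using that[of z] elim j by force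
          next
            case False
            then have *: "\<gamma> t j < y j" using \<open>\<gamma> t j \<noteq> y j\<close> by simp
            obtain z where "\<gamma> t j < z" "z < y j"
              "F (P (y j)) - F (P (\<gamma> t j)) = (y j - \<gamma> t j) * partial j F (P z)"
              using MVT2[OF *, of "\<lambda>s. F (P s)" "\<lambda>s. partial j F (P s)"] D elim j
              by (smt (verit, best) lessThan_iff)
            then show thesis using that[of z] elim j by (force simp: algebra_simps)
          qed
          have "g t = partial j F (P \<xi>)"
            using \<xi>(2) False unfolding P1 g_def by simp
          moreover have "P \<xi> \<in> V \<inter> partial j F -` ball (partial j F y) e"
            using PW[OF \<xi>(1)] unfolding T(2) W_def .
          ultimately show ?thesis by (simp add: dist_commute)
        qed
      qed
    qed
    moreover have "((\<lambda>t. (\<gamma> t j - y j) / (t - t0)) \<longlongrightarrow> c j) (at t0)"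
      using c[OF j] by (simp add: has_field_derivative_iff y_def)
    ultimately show ?thesis
      using tendsto_mult[of g _ "at t0" "\<lambda>t. (\<gamma> t j - y j) / (t - t0)"] by (simp add: g)
  qed
  have "((\<lambda>t. \<Sum>j<n. (F (p (Suc j) t) - F (p j t)) / (t - t0)) \<longlongrightarrow> (\<Sum>j<n. partial j F y * c j)) (at t0)"
    by (intro tendsto_sum slope) simp
  moreover have "\<forall>\<^sub>F t in at t0. (\<Sum>j<n. (F (p (Suc j) t) - F (p j t)) / (t - t0)) =
      (F (\<gamma> t) - F (\<gamma> t0)) / (t - t0)"
  proof -
    have "\<forall>\<^sub>F t in at t0. \<gamma> t \<in> V" using \<gamma> by (simp add: eventually_nhds_conv_at)
    then show ?thesis
    proof eventually_elim
      case (elim t)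
      have "(\<Sum>j<n. (F (p (Suc j) t) - F (p j t)) / (t - t0)) = (\<Sum>j<n. F (p (Suc j) t) - F (p j t)) / (t - t0)"
        by (simp add: sum_divide_distrib)
      also have "(\<Sum>j<n. F (p (Suc j) t) - F (p j t)) = F (p n t) - F (p 0 t)"
        by (rule sum_lessThan_telescope)
      finally show ?case by (simp add: p0 pn[OF elim] y_def)
    qed
  qed
  ultimately have "((\<lambda>t. (F (\<gamma> t) - F (\<gamma> t0)) / (t - t0)) \<longlongrightarrow> (\<Sum>j<n. partial j F y * c j)) (at t0)"
    by (rule Lim_transform_eventually)
  then show ?thesis by (simp add: has_field_derivative_iff y_def)
qed

lemma DERIV_compose_update:
  assumes V: "openin (Euclidean_space n) V" and W: "openin (Euclidean_space m) W"
    and F: "Ck_on n V (Suc 0) F" and \<phi>: "\<And>y. y \<in> W \<Longrightarrow> \<phi> y \<in> V"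
    and \<phi>k: "\<And>j. j < n \<Longrightarrow> Ck_on m W (Suc 0) (\<lambda>y. \<phi> y j)" and i: "i < m" and y: "y \<in> W"
  shows "((\<lambda>t. F (\<phi> (y(i := t)))) has_real_derivative
     (\<Sum>j<n. partial j F (\<phi> y) * partial i (\<lambda>y. \<phi> y j) y)) (at (y i))"
proof -
  have "((\<lambda>t. F (\<phi> (y(i := t)))) has_real_derivative
     (\<Sum>j<n. partial j F (\<phi> (y(i := y i))) * partial i (\<lambda>y. \<phi> y j) y)) (at (y i))"
  proof (rule DERIV_along_curve[OF V F])
    show "\<forall>\<^sub>F t in nhds (y i). \<phi> (y(i := t)) \<in> V"
      using eventually_update_in[OF W y i] by (rule eventually_mono) (rule \<phi>)
  qed (rule DERIV_partial[OF \<phi>k y i])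
  then show ?thesis by simp
qed

lemma Ck_on_compose:
  assumes V: "openin (Euclidean_space n) V" and W: "openin (Euclidean_space m) W"
    and F: "Ck_on n V k F" and \<phi>: "\<And>y. y \<in> W \<Longrightarrow> \<phi> y \<in> V"
    and \<phi>k: "\<And>j. j < n \<Longrightarrow> Ck_on m W k (\<lambda>y. \<phi> y j)"
  shows "Ck_on m W k (\<lambda>y. F (\<phi> y))"
  using F \<phi>k
proof (induction k arbitrary: F)
  case (0 F)
  have "continuous_on W (\<lambda>y. \<phi> y j)" for j
  proof (cases "j < n")
    case False
    have "continuous_on W (\<lambda>y. 0::real)" by simp
    then show ?thesis
      using Euclidean_space_open_zero[OF V \<phi>] False by (auto cong: continuous_on_cong)
  qed (use 0 in simp)
  then have "continuous_on W \<phi>" by (rule continuous_on_coordinatewise_then_product)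
  moreover have "continuous_on V F" using 0 by simp
  ultimately show ?case using continuous_on_compose2[of V F W \<phi>] \<phi> by auto
next
  case (Suc k F)
  have le: "Ck_on n V (Suc k) F \<Longrightarrow> Ck_on n V (Suc 0) F" for n V and F :: "(nat \<Rightarrow> real) \<Rightarrow> real"
    using Ck_on_continuous by auto
  have IHc: "Ck_on m W k (\<lambda>y. F (\<phi> y))"
    using Suc Ck_on_Suc_imp by blast
  show ?case
  proof (rule Ck_on_SucI[OF W, where G = "\<lambda>i y. \<Sum>j<n. partial j F (\<phi> y) * partial i (\<lambda>y. \<phi> y j) y"])
    show "continuous_on W (\<lambda>y. F (\<phi> y))" using IHc Ck_on_continuous by blast
    show "((\<lambda>t. F (\<phi> (y(i := t)))) has_real_derivative
        (\<Sum>j<n. partial j F (\<phi> y) * partial i (\<lambda>y. \<phi> y j) y)) (at (y i))"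
      if "i < m" "y \<in> W" for i y
      by (rule DERIV_compose_update[OF V W le[OF Suc.prems(1)] \<phi> le[OF Suc.prems(2)] that])
    have "Ck_on m W k (\<lambda>y. \<Sum>j\<in>J. partial j F (\<phi> y) * partial i (\<lambda>y. \<phi> y j) y)"
      if "i < m" "J \<subseteq> {..<n}" "finite J" for i J
      using that(3,2)
    proof (induction J)
      case empty
      show ?case using Ck_on_const[OF W] by simp
    next
      case (insert j J)
      have "Ck_on m W k (\<lambda>y. partial j F (\<phi> y) * partial i (\<lambda>y. \<phi> y j) y)"
      proof (rule Ck_on_mult[OF W])
        have j: "j < n" using insert by auto
        show "Ck_on m W k (\<lambda>y. partial j F (\<phi> y))"
        proof (rule Suc.IH)
          show "Ck_on n V k (partial j F)" using Suc.prems(1) j by simp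
        qed (rule Ck_on_Suc_imp[OF Suc.prems(2)])
        show "Ck_on m W k (partial i (\<lambda>y. \<phi> y j))"
          using Suc.prems(2)[OF j] that(1) by simp
      qed
      then show ?case using insert by (simp add: Ck_on_add[OF W])
    qed
    then show "Ck_on m W k (\<lambda>y. \<Sum>j<n. partial j F (\<phi> y) * partial i (\<lambda>y. \<phi> y j) y)"
      if "i < m" for i using that by blast
  qed
qed

lemma Ck_on_subset:
  assumes "Ck_on n V k F" "W \<subseteq> V"
  shows "Ck_on n W k F"
  using assms(1) by (induction k arbitrary: F) (use assms(2) in \<open>auto intro: continuous_on_subset\<close>)

lemma Ck_on_local:
  assumes "\<And>y. y \<in> V \<Longrightarrow> \<exists>W. openin (Euclidean_space n) W \<and> y \<in> W \<and> W \<subseteq> V \<and> Ck_on n W k F"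
  shows "Ck_on n V k F"
  using assms
proof (induction k arbitrary: F)
  case 0
  have "continuous (at y within V) F" if y: "y \<in> V" for y
  proof -
    obtain W where W: "openin (Euclidean_space n) W" "y \<in> W" "W \<subseteq> V" "Ck_on n W 0 F"
      using 0 y by meson
    obtain T where T: "open T" "W = T \<inter> {y. \<forall>i\<ge>n. y i = 0}"
      using W(1) by (auto simp: openin_Euclidean_space_iff)
    have "V \<subseteq> {y. \<forall>i\<ge>n. y i = 0}"
      using 0 by (fastforce simp: openin_Euclidean_space_iff)
    then have "V \<inter> T - {y} = W \<inter> T - {y}" using T W(3) by blast
    then have "at y within V = at y within W"
      using T W(2) by (intro at_within_nhd[of y T]) auto
    then show ?thesis
      using W(2,4) by (simp add: continuous_on_eq_continuous_within)
  qed
  then show ?case by (simp add: continuous_on_eq_continuous_within)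
next
  case (Suc k)
  have loc: "\<exists>W. openin (Euclidean_space n) W \<and> y \<in> W \<and> W \<subseteq> V \<and> Ck_on n W (Suc k) F"
    if "y \<in> V" for y using Suc.prems that by blast
  have "Ck_on n V k F"
    by (rule Suc.IH) (meson loc Ck_on_Suc_imp)
  then have "continuous_on V F" by (rule Ck_on_continuous)
  moreover have "(\<lambda>t. F (y(i := t))) differentiable (at (y i))" if "i < n" "y \<in> V" for i y
    using loc[OF that(2)] that(1) by auto
  moreover have "Ck_on n V k (partial i F)" if "i < n" for i
  proof (rule Suc.IH)
    fix y assume "y \<in> V"
    from loc[OF this] obtain W where "openin (Euclidean_space n) W" "y \<in> W" "W \<subseteq> V" "Ck_on n W (Suc k) F"
      by blast
    with that show "\<exists>W. openin (Euclidean_space n) W \<and> y \<in> W \<and> W \<subseteq> V \<and> Ck_on n W k (partial i F)"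
      by auto
  qed
  ultimately show ?case by simp
qed

section \<open>Smooth functions on a manifold\<close>

lemma Cinf_on_cong:
  assumes "openin (Euclidean_space n) V" "\<And>z. z \<in> V \<Longrightarrow> F z = G z"
  shows "Cinf_on n V F \<longleftrightarrow> Cinf_on n V G"
  unfolding Cinf_on_def using Ck_on_cong[OF assms] by simp

lemma Cinf_on_partial: "Cinf_on n V F \<Longrightarrow> i < n \<Longrightarrow> Cinf_on n V (partial i F)"
  unfolding Cinf_on_def using Ck_on.simps(2) by blast

locale smooth_manifold =
  fixes n :: nat and A :: "('m::{t2_space,second_countable_topology}) chart set"
  assumes smooth_atlas: "smooth_atlas n A"
begin

abbreviation "smooth \<equiv> smooth_fun_on n A"

lemma chart_exists: "\<exists>U q. (U, q) \<in> A \<and> x \<in> U"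
proof -
  have "x \<in> (\<Union>(U, q)\<in>A. U)" using smooth_atlas by (simp add: smooth_atlas_def)
  then show ?thesis by auto
qed

lemma chart_homeomorphic_ex:
  "\<forall>(U, q)\<in>A. open U \<and> (\<exists>V. openin (Euclidean_space n) V \<and>
      homeomorphic_map (top_of_set U) (subtopology (Euclidean_space n) V) q)"
  using smooth_atlas by (simp add: smooth_atlas_def)

lemma chart_open: "(U, q) \<in> A \<Longrightarrow> open U"
  using chart_homeomorphic_ex by (drule_tac bspec) auto

lemma chart_homeomorphic:
  assumes "(U, q) \<in> A"
  obtains V where "openin (Euclidean_space n) V"
    "homeomorphic_map (top_of_set U) (subtopology (Euclidean_space n) V) q"
  using bspec[OF chart_homeomorphic_ex assms] by auto

lemma chart_image_open:
  assumes "(U, q) \<in> A" "open W"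
  shows "openin (Euclidean_space n) (q ` (U \<inter> W))"
proof -
  obtain V where V: "openin (Euclidean_space n) V"
    "homeomorphic_map (top_of_set U) (subtopology (Euclidean_space n) V) q"
    using chart_homeomorphic[OF assms(1)] .
  have "openin (top_of_set U) (U \<inter> W)" using assms(2) by auto
  then have "openin (subtopology (Euclidean_space n) V) (q ` (U \<inter> W))"
    using homeomorphic_map_openness[OF V(2), of "U \<inter> W"] by simp
  then show ?thesis using V(1) openin_trans_full by blast
qed

lemma chart_inj: "(U, q) \<in> A \<Longrightarrow> inj_on q U"
  by (erule chart_homeomorphic) (drule homeomorphic_imp_injective_map, simp)

lemma chart_inv [simp]: "(U, q) \<in> A \<Longrightarrow> x \<in> U \<Longrightarrow> inv_into U q (q x) = x"
  using chart_inj by (simp add: inv_into_f_f)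

lemma chart_continuous: "(U, q) \<in> A \<Longrightarrow> continuous_on U q"
  by (erule chart_homeomorphic)
    (drule homeomorphic_imp_continuous_map,
      simp add: Euclidean_space_def continuous_map_in_subtopology euclidean_product_topology)

lemma chart_inverse_continuous:
  assumes "(U, q) \<in> A"
  shows "continuous_on (q ` U) (inv_into U q)"
proof (rule continuous_on_inverse_open_map)
  obtain V where V: "openin (Euclidean_space n) V"
    "homeomorphic_map (top_of_set U) (subtopology (Euclidean_space n) V) q"
    using chart_homeomorphic[OF assms(1)] .
  have im: "q ` U = V"
    using homeomorphic_imp_surjective_map[OF V(2)] openin_subset[OF V(1)] by auto
  show "continuous_on U q" using chart_continuous[OF assms] .
  show "openin (top_of_set (q ` U)) (q ` T)" if T: "openin (top_of_set U) T" for T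
  proof -
    have TU: "T \<subseteq> U" using openin_subset[OF T] by simp
    have "openin (subtopology (Euclidean_space n) V) (q ` T)"
      using homeomorphic_map_openness[OF V(2), of T] TU T by simp
    then obtain T' where "open T'" "q ` T = T' \<inter> {y. \<forall>i\<ge>n. y i = 0} \<inter> q ` U"
      using im by (auto simp: openin_Euclidean_space_iff openin_subtopology)
    moreover have "q ` U \<subseteq> {y. \<forall>i\<ge>n. y i = 0}"
      using im Euclidean_space_open_zero[OF V(1)] by blast
    ultimately have "q ` T = q ` U \<inter> T'" by blast
    with \<open>open T'\<close> show ?thesis by (auto simp: openin_open)
  qed
qed (use assms in auto)

lemma chart_transition:
  assumes "(U, q) \<in> A" "(U', q') \<in> A" "i < n"
  shows "Cinf_on n (q ` (U \<inter> U')) (\<lambda>y. q' (inv_into U q y) i)"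
proof -
  have "\<forall>(U, q)\<in>A. \<forall>(U', q')\<in>A. \<forall>i<n. Cinf_on n (q ` (U \<inter> U')) (\<lambda>y. q' (inv_into U q y) i)"
    using smooth_atlas by (simp add: smooth_atlas_def)
  from bspec[OF this assms(1)] have "\<forall>(U', q')\<in>A. \<forall>i<n. Cinf_on n (q ` (U \<inter> U')) (\<lambda>y. q' (inv_into U q y) i)"
    by simp
  from bspec[OF this assms(2)] show ?thesis using assms(3) by simp
qed

lemma smooth_Cinf: "smooth W f \<Longrightarrow> (U, q) \<in> A \<Longrightarrow> Cinf_on n (q ` (U \<inter> W)) (\<lambda>y. f (inv_into U q y))"
  unfolding smooth_fun_on_def by blast

lemma smooth_Ck: "smooth W f \<Longrightarrow> (U, q) \<in> A \<Longrightarrow> Ck_on n (q ` (U \<inter> W)) k (\<lambda>y. f (inv_into U q y))"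
  using smooth_Cinf Cinf_on_def by blast

lemma smoothI:
  assumes "\<And>U q k. (U, q) \<in> A \<Longrightarrow> Ck_on n (q ` (U \<inter> W)) k (\<lambda>y. f (inv_into U q y))"
  shows "smooth W f"
  using assms unfolding smooth_fun_on_def Cinf_on_def by blast

lemma smooth_cong:
  assumes "open W" "\<And>x. x \<in> W \<Longrightarrow> f x = g x"
  shows "smooth W f \<longleftrightarrow> smooth W g"
proof -
  have "Cinf_on n (q ` (U \<inter> W)) (\<lambda>y. f (inv_into U q y)) \<longleftrightarrow>
        Cinf_on n (q ` (U \<inter> W)) (\<lambda>y. g (inv_into U q y))" if "(U, q) \<in> A" for U q
    by (rule Cinf_on_cong[OF chart_image_open[OF that assms(1)]]) (use assms(2) that in auto)
  then show ?thesis unfolding smooth_fun_on_def by blast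
qed

lemma smooth_subset: "smooth W f \<Longrightarrow> W' \<subseteq> W \<Longrightarrow> smooth W' f"
  by (rule smoothI, rule Ck_on_subset[OF smooth_Ck]) auto

lemma smooth_local:
  assumes "\<And>x. x \<in> W \<Longrightarrow> \<exists>W'. open W' \<and> x \<in> W' \<and> W' \<subseteq> W \<and> smooth W' f"
  shows "smooth W f"
proof (rule smoothI, rule Ck_on_local)
  fix U q k y assume q: "(U, q) \<in> A" and "y \<in> q ` (U \<inter> W)"
  then obtain x where x: "x \<in> U" "x \<in> W" "y = q x" by blast
  obtain W' where W': "open W'" "x \<in> W'" "W' \<subseteq> W" "smooth W' f" using assms x by blast
  then show "\<exists>V. openin (Euclidean_space n) V \<and> y \<in> V \<and> V \<subseteq> q ` (U \<inter> W) \<and>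
      Ck_on n V k (\<lambda>y. f (inv_into U q y))"
    using x q by (intro exI[of _ "q ` (U \<inter> W')"]) (auto simp: chart_image_open smooth_Ck)
qed

lemma smooth_const: "open W \<Longrightarrow> smooth W (\<lambda>x. c)"
  by (rule smoothI) (rule Ck_on_const[OF chart_image_open])

lemma smooth_add: "open W \<Longrightarrow> smooth W f \<Longrightarrow> smooth W g \<Longrightarrow> smooth W (\<lambda>x. f x + g x)"
  by (rule smoothI) (rule Ck_on_add[OF chart_image_open smooth_Ck smooth_Ck])

lemma smooth_mult: "open W \<Longrightarrow> smooth W f \<Longrightarrow> smooth W g \<Longrightarrow> smooth W (\<lambda>x. f x * g x)"
  by (rule smoothI) (rule Ck_on_mult[OF chart_image_open smooth_Ck smooth_Ck])

lemma smooth_uminus: "open W \<Longrightarrow> smooth W f \<Longrightarrow> smooth W (\<lambda>x. - f x)"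
  using smooth_mult[OF _ smooth_const, of W f "-1"] by simp

lemma smooth_diff: "open W \<Longrightarrow> smooth W f \<Longrightarrow> smooth W g \<Longrightarrow> smooth W (\<lambda>x. f x - g x)"
  using smooth_add[OF _ _ smooth_uminus, of W f g] by simp

lemma smooth_sum:
  assumes "open W" "\<And>i. i \<in> I \<Longrightarrow> smooth W (f i)"
  shows "smooth W (\<lambda>x. \<Sum>i\<in>I. f i x)"
  using assms(2)
proof (induction I rule: infinite_finite_induct)
  case (insert i I)
  then show ?case by (simp add: smooth_add[OF assms(1)])
qed (simp_all add: smooth_const[OF assms(1)])

lemma smooth_compose_real:
  assumes "open W" "smooth W h"
    and "\<And>j t. t \<in> S \<Longrightarrow> (\<phi> j has_real_derivative \<phi> (Suc j) t) (at t)"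
    and "\<And>x. x \<in> W \<Longrightarrow> h x \<in> S"
  shows "smooth W (\<lambda>x. \<phi> j (h x))"
proof (rule smoothI)
  fix U q k assume q: "(U, q) \<in> A"
  show "Ck_on n (q ` (U \<inter> W)) k (\<lambda>y. \<phi> j (h (inv_into U q y)))"
    by (rule Ck_on_compose_real[OF chart_image_open[OF q assms(1)] smooth_Ck[OF assms(2) q], where S = S])
      (use assms(3,4) q in auto)
qed

text \<open>Covers reciprocals and inverse square roots of positive functions.\<close>

lemma smooth_powr:
  assumes "open W" "smooth W h" "\<And>x. x \<in> W \<Longrightarrow> h x > 0"
  shows "smooth W (\<lambda>x. h x powr a)"
proof -
  define \<phi> where "\<phi> j t = (\<Prod>i<j. a - real i) * t powr (a - real j)" for j t
  have "smooth W (\<lambda>x. \<phi> 0 (h x))"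
  proof (rule smooth_compose_real[OF assms(1,2), where S = "{0<..}"])
    show "(\<phi> j has_real_derivative \<phi> (Suc j) t) (at t)" if "t \<in> {0<..}" for j t
      unfolding \<phi>_def using that
      by (auto intro!: derivative_eq_intros simp: algebra_simps)
  qed (use assms(3) in auto)
  then show ?thesis by (simp add: \<phi>_def)
qed

text \<open>Smoothness in one chart implies smoothness in all of them, as the transition maps are smooth.\<close>

lemma smooth_compose_chart:
  assumes q: "(U, q) \<in> A" and W: "open W" "W \<subseteq> U" and F: "\<And>k. Ck_on n (q ` W) k F"
  shows "smooth W (\<lambda>x. F (q x))"
proof (rule smoothI)
  fix U' q' k assume q': "(U', q') \<in> A"
  have W': "q ` W = q ` (U \<inter> W)" using W by (simp add: Int_absorb1)
  show "Ck_on n (q' ` (U' \<inter> W)) k (\<lambda>y. F (q (inv_into U' q' y)))"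
  proof (rule Ck_on_compose[where V = "q ` W" and n = n and \<phi> = "\<lambda>y. q (inv_into U' q' y)"])
    show "openin (Euclidean_space n) (q ` W)" unfolding W' using q W(1) by (rule chart_image_open)
    show "openin (Euclidean_space n) (q' ` (U' \<inter> W))" using q' W(1) by (rule chart_image_open)
    show "Ck_on n (q' ` (U' \<inter> W)) k (\<lambda>y. q (inv_into U' q' y) j)" if "j < n" for j
      using chart_transition[OF q' q that] W(2) unfolding Cinf_on_def
      by (meson Ck_on_subset image_mono Int_mono subset_refl)
  qed (use F q' in auto)
qed

lemma smooth_coord:
  assumes "(U, q) \<in> A"
  shows "smooth U (\<lambda>x. q x i)"
proof -
  have "openin (Euclidean_space n) (q ` U)"
    using chart_image_open[OF assms open_UNIV] by simp
  then show ?thesis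
    using smooth_compose_chart[OF assms chart_open[OF assms], of "\<lambda>y. y i"] Ck_on_coord by simp
qed

lemma smooth_continuous_on:
  assumes "open W" "smooth W f"
  shows "continuous_on W f"
proof -
  have "isCont f x" if x: "x \<in> W" for x
  proof -
    obtain U q where q: "(U, q) \<in> A" "x \<in> U" using chart_exists by blast
    have o: "open (U \<inter> W)" using chart_open q(1) assms(1) by blast
    have c: "continuous_on (U \<inter> W) q"
      using chart_continuous[OF q(1)] by (rule continuous_on_subset) simp
    have "continuous_on (U \<inter> W) (\<lambda>x. f (inv_into U q (q x)))"
      using continuous_on_compose2[OF Ck_on_continuous[OF smooth_Ck[OF assms(2) q(1), of 0]] c] by simp
    then have "continuous_on (U \<inter> W) f"
      by (rule continuous_on_eq) (use q(1) in auto)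
    then show ?thesis using o q(2) x by (simp add: continuous_on_eq_continuous_at)
  qed
  then show ?thesis by (simp add: continuous_at_imp_continuous_on)
qed

subsection \<open>Partial derivatives in a chart\<close>

lemma DERIV_chart:
  assumes "(U, q) \<in> A" "open W" "smooth W f" "x \<in> U" "x \<in> W" "i < n"
  shows "((\<lambda>t. f (inv_into U q ((q x)(i := t)))) has_real_derivative chart_deriv (U, q) i f x) (at (q x i))"
  using DERIV_partial[OF smooth_Ck[OF assms(3,1), of "Suc 0"], of "q x" i] assms by simp

lemma chart_deriv_cong:
  assumes "(U, q) \<in> A" "open W" "x \<in> U" "x \<in> W" "i < n" "\<And>z. z \<in> W \<Longrightarrow> f z = g z"
  shows "chart_deriv (U, q) i f x = chart_deriv (U, q) i g x"
  unfolding chart_deriv.simps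
  by (rule partial_cong[OF chart_image_open[OF assms(1,2)]]) (use assms in auto)

lemma chart_deriv_const [simp]: "chart_deriv \<kappa> i (\<lambda>x. c) x = 0"
  by (cases \<kappa>) (simp add: partial_eqI)

lemma chart_deriv_add:
  assumes "(U, q) \<in> A" "open W" "smooth W f" "smooth W g" "x \<in> U" "x \<in> W" "i < n"
  shows "chart_deriv (U, q) i (\<lambda>z. f z + g z) x = chart_deriv (U, q) i f x + chart_deriv (U, q) i g x"
proof -
  have "((\<lambda>t. f (inv_into U q ((q x)(i := t))) + g (inv_into U q ((q x)(i := t)))) has_real_derivative
    chart_deriv (U, q) i f x + chart_deriv (U, q) i g x) (at (q x i))"
    by (intro DERIV_add DERIV_chart[where W = W] assms)
  from partial_eqI[of "\<lambda>y. f (inv_into U q y) + g (inv_into U q y)", OF this] show ?thesis by simp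
qed

lemma chart_deriv_mult:
  assumes "(U, q) \<in> A" "open W" "smooth W f" "smooth W g" "x \<in> U" "x \<in> W" "i < n"
  shows "chart_deriv (U, q) i (\<lambda>z. f z * g z) x =
    chart_deriv (U, q) i f x * g x + f x * chart_deriv (U, q) i g x"
proof -
  have "((\<lambda>t. f (inv_into U q ((q x)(i := t))) * g (inv_into U q ((q x)(i := t)))) has_real_derivative
    chart_deriv (U, q) i f x * g (inv_into U q ((q x)(i := q x i))) +
    chart_deriv (U, q) i g x * f (inv_into U q ((q x)(i := q x i)))) (at (q x i))"
    by (intro DERIV_mult DERIV_chart[where W = W] assms)
  from partial_eqI[of "\<lambda>y. f (inv_into U q y) * g (inv_into U q y)", OF this] show ?thesis
    using assms by (simp add: mult.commute)
qed

lemma chart_deriv_cmult: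
  assumes "(U, q) \<in> A" "open W" "smooth W f" "x \<in> U" "x \<in> W" "i < n"
  shows "chart_deriv (U, q) i (\<lambda>z. c * f z) x = c * chart_deriv (U, q) i f x"
  using chart_deriv_mult[OF assms(1,2) smooth_const[OF assms(2)] assms(3-)] by simp

lemma chart_deriv_sum:
  assumes "(U, q) \<in> A" "open W" "\<And>j. j \<in> J \<Longrightarrow> smooth W (f j)" "x \<in> U" "x \<in> W" "i < n"
  shows "chart_deriv (U, q) i (\<lambda>z. \<Sum>j\<in>J. f j z) x = (\<Sum>j\<in>J. chart_deriv (U, q) i (f j) x)"
  using assms(3)
proof (induction J rule: infinite_finite_induct)
  case (insert j J)
  have "smooth W (\<lambda>z. \<Sum>j\<in>J. f j z)" using insert.prems by (intro smooth_sum assms(2)) simp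
  from chart_deriv_add[OF assms(1,2) _ this assms(4-6), of "f j"]
  have "chart_deriv (U, q) i (\<lambda>z. f j z + (\<Sum>j\<in>J. f j z)) x =
      chart_deriv (U, q) i (f j) x + chart_deriv (U, q) i (\<lambda>z. \<Sum>j\<in>J. f j z) x"
    using insert.prems by simp
  with insert show ?case by (simp del: chart_deriv.simps)
qed (simp_all del: chart_deriv.simps)

lemma smooth_chart_deriv:
  assumes "(U, q) \<in> A" "open W" "W \<subseteq> U" "smooth W f" "i < n"
  shows "smooth W (chart_deriv (U, q) i f)"
proof -
  have W: "q ` W = q ` (U \<inter> W)" using assms by (simp add: Int_absorb1)
  have "smooth W (\<lambda>x. partial i (\<lambda>y. f (inv_into U q y)) (q x))"
    by (rule smooth_compose_chart[OF assms(1-3)])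
      (use Cinf_on_partial[OF smooth_Cinf[OF assms(4,1)] assms(5)] in \<open>auto simp: Cinf_on_def W\<close>)
  then show ?thesis by (simp add: chart_deriv.simps[abs_def])
qed

lemma chart_deriv_chain:
  assumes q: "(U, q) \<in> A" and q': "(U', q') \<in> A" and W: "open W" and f: "smooth W f"
    and x: "x \<in> U" "x \<in> U'" "x \<in> W" and j: "j < n"
  shows "chart_deriv (U', q') j f x =
    (\<Sum>i<n. chart_deriv (U, q) i f x * chart_deriv (U', q') j (\<lambda>z. q z i) x)"
proof -
  define V where "V = q ` (U \<inter> W)"
  define V' where "V' = q' ` (U' \<inter> (U \<inter> W))"
  define \<phi> where "\<phi> y = q (inv_into U' q' y)" for y
  have V: "openin (Euclidean_space n) V" unfolding V_def using q W by (rule chart_image_open)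
  have V': "openin (Euclidean_space n) V'"
    unfolding V'_def using q' W chart_open[OF q] by (intro chart_image_open) auto
  have y: "q' x \<in> V'" using x by (auto simp: V'_def)
  have "((\<lambda>t. f (inv_into U q (\<phi> ((q' x)(j := t))))) has_real_derivative
     (\<Sum>i<n. partial i (\<lambda>y. f (inv_into U q y)) (\<phi> (q' x)) * partial j (\<lambda>y. \<phi> y i) (q' x))) (at (q' x j))"
  proof (rule DERIV_compose_update[OF V V' _ _ _ j y, where F = "\<lambda>y. f (inv_into U q y)"])
    show "Ck_on n V (Suc 0) (\<lambda>y. f (inv_into U q y))" unfolding V_def using f q by (rule smooth_Ck)
    show "\<phi> y \<in> V" if "y \<in> V'" for y using that q' by (auto simp: V_def V'_def \<phi>_def)
    show "Ck_on n V' (Suc 0) (\<lambda>y. \<phi> y i)" if "i < n" for i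
      using chart_transition[OF q' q that] unfolding Cinf_on_def \<phi>_def V'_def
      by (meson Ck_on_subset image_mono Int_mono subset_refl Int_lower1)
  qed
  from partial_eqI[of "\<lambda>y. f (inv_into U q (\<phi> y))", OF this]
  have "partial j (\<lambda>y. f (inv_into U q (\<phi> y))) (q' x) =
     (\<Sum>i<n. partial i (\<lambda>y. f (inv_into U q y)) (\<phi> (q' x)) * partial j (\<lambda>y. \<phi> y i) (q' x))" .
  moreover have "partial j (\<lambda>y. f (inv_into U q (\<phi> y))) (q' x) = partial j (\<lambda>y. f (inv_into U' q' y)) (q' x)"
    by (rule partial_cong[OF V' y j]) (use q q' in \<open>auto simp: V'_def \<phi>_def\<close>)
  ultimately show ?thesis using x q' by (simp add: \<phi>_def)
qed

end

subsection \<open>Bump functions\<close>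

text \<open>The derivatives of \<open>exp (-1/t)\<close>, extended by \<open>0\<close> to \<open>t \<le> 0\<close>, have the form \<open>p (1/t) exp (-1/t)\<close>
  with polynomials \<open>p\<close>.\<close>

definition flat_exp :: "real poly \<Rightarrow> real \<Rightarrow> real" where
  "flat_exp p t = (if t > 0 then poly p (1/t) * exp (-1/t) else 0)"

lemma flat_exp_tendsto_0: "((\<lambda>t. poly p (1/t) * exp (-1/t)) \<longlongrightarrow> 0) (at_right (0::real))"
proof -
  have "((\<lambda>s. \<Sum>i\<le>degree p. poly.coeff p i * (s ^ i / exp s)) \<longlongrightarrow> (\<Sum>i\<le>degree p. poly.coeff p i * 0)) at_top"
    by (intro tendsto_intros tendsto_power_div_exp_0)
  then have "((\<lambda>s. poly p s * exp (- s)) \<longlongrightarrow> 0) at_top"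
    by (simp add: poly_altdef sum_distrib_right exp_minus divide_inverse mult.assoc)
  from filterlim_compose[OF this filterlim_inverse_at_top_right]
  show ?thesis by (simp add: divide_inverse)
qed

lemma DERIV_flat_exp:
  "(flat_exp p has_real_derivative flat_exp (monom 1 2 * (p - pderiv p)) t) (at t)"
proof -
  consider "t > 0" | "t < 0" | "t = 0" by linarith
  then show ?thesis
  proof cases
    case 1
    have "((\<lambda>t. poly p (1/t) * exp (-1/t)) has_real_derivative
        poly (pderiv p) (1/t) * (- 1 / t^2) * exp (-1/t) + exp (-1/t) * (1/t^2) * poly p (1/t)) (at t)"
      using 1 by (auto intro!: derivative_eq_intros DERIV_chain2[OF poly_DERIV] simp: power2_eq_square)
    then have "((\<lambda>t. poly p (1/t) * exp (-1/t)) has_real_derivative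
        flat_exp (monom 1 2 * (p - pderiv p)) t) (at t)"
      by (rule DERIV_cong) (use 1 in \<open>simp add: flat_exp_def poly_monom algebra_simps power_divide\<close>)
    then show ?thesis
      by (rule has_field_derivative_transform_within_open[where S = "{0<..}"])
        (use 1 in \<open>auto simp: flat_exp_def\<close>)
  next
    case 2
    have "((\<lambda>t. 0) has_real_derivative flat_exp (monom 1 2 * (p - pderiv p)) t) (at t)"
      using 2 by (simp add: flat_exp_def)
    then show ?thesis
      by (rule has_field_derivative_transform_within_open[where S = "{..<0}"])
        (use 2 in \<open>auto simp: flat_exp_def\<close>)
  next
    case 3
    have "((\<lambda>t. flat_exp p t / t) \<longlongrightarrow> 0) (at_right 0)"
      using flat_exp_tendsto_0[of "monom 1 1 * p"]
      by (rule Lim_transform_eventually)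
        (auto simp: eventually_at_right_less flat_exp_def poly_monom
          intro!: eventually_mono[OF eventually_at_right_less])
    moreover have "((\<lambda>t. flat_exp p t / t) \<longlongrightarrow> 0) (at_left 0)"
      by (rule Lim_transform_eventually[where f = "\<lambda>t. 0"])
        (auto simp: flat_exp_def eventually_at_left_field intro!: exI[of _ "-1"])
    ultimately have "((\<lambda>t. flat_exp p t / t) \<longlongrightarrow> 0) (at 0)"
      using filterlim_split_at by blast
    then show ?thesis using 3 by (simp add: has_field_derivative_iff flat_exp_def)
  qed
qed

text \<open>The polynomials that occur in the successive derivatives of \<open>exp (-1/t)\<close>.\<close>

fun flat_exp_poly :: "nat \<Rightarrow> real poly" where
  "flat_exp_poly 0 = 1"
| "flat_exp_poly (Suc j) = monom 1 2 * (flat_exp_poly j - pderiv (flat_exp_poly j))"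

context smooth_manifold
begin

text \<open>The set \<open>K\<close> is compact, hence closed, since the manifold is a Hausdorff space.\<close>

lemma bump_function:
  assumes W: "open W" and x0: "x0 \<in> W"
  obtains \<eta> K where "smooth UNIV \<eta>" "\<eta> x0 > 0" "closed K" "K \<subseteq> W" "\<And>x. x \<notin> K \<Longrightarrow> \<eta> x = 0"
proof -
  obtain U q where q: "(U, q) \<in> A" "x0 \<in> U" using chart_exists by blast
  have UW: "open (U \<inter> W)" using chart_open[OF q(1)] W by auto
  obtain d where d: "d > 0" "\<And>z. (\<And>j. j < n \<Longrightarrow> \<bar>z j - q x0 j\<bar> < d) \<Longrightarrow>
      (\<And>j. j \<ge> n \<Longrightarrow> z j = 0) \<Longrightarrow> z \<in> q ` (U \<inter> W)"
    using Euclidean_space_open_box[OF chart_image_open[OF q(1) W], of "q x0"] q(2) x0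
    by (metis IntI imageI)
  define C where "C = (\<Pi>\<^sub>E i\<in>UNIV. if i < n then {q x0 i - d/2..q x0 i + d/2} else {0})"
  define K where "K = inv_into U q ` C"
  have C: "C \<subseteq> q ` (U \<inter> W)"
  proof
    fix z assume z: "z \<in> C"
    have *: "z j \<in> (if j < n then {q x0 j - d/2..q x0 j + d/2} else {0})" for j
      using z unfolding C_def by (rule PiE_mem) simp
    show "z \<in> q ` (U \<inter> W)"
    proof (rule d(2))
      show "\<bar>z j - q x0 j\<bar> < d" if "j < n" for j
        using *[of j] that d(1) by (simp add: abs_if)
      show "z j = 0" if "j \<ge> n" for j using *[of j] that by simp
    qed
  qed
  have "compactin (product_topology (\<lambda>i::nat. euclidean) UNIV) C"
    unfolding C_def compactin_PiE by auto
  then have "compact C" by (simp add: euclidean_product_topology)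
  moreover have "continuous_on C (inv_into U q)"
    using chart_inverse_continuous[OF q(1)] by (rule continuous_on_subset) (use C in blast)
  ultimately have "compact K" unfolding K_def by (rule compact_continuous_image[rotated])
  then have clK: "closed K" by (rule compact_imp_closed)
  have KW: "K \<subseteq> U \<inter> W" using C q(1) by (auto simp: K_def)
  \<comment> \<open>at points of the chart outside \<open>K\<close> some coordinate differs by more than \<open>d/2\<close>, so that \<open>\<rho> \<ge> (d/2)\<^sup>2\<close>
    and \<open>\<eta>\<close> vanishes\<close>
  define \<rho> where "\<rho> x = (\<Sum>i<n. (q x i - q x0 i) * (q x i - q x0 i))" for x
  define \<eta> where "\<eta> x = (if x \<in> U \<inter> W then flat_exp (flat_exp_poly 0) ((d/2) * (d/2) - \<rho> x) else 0)" for x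
  have \<rho>: "smooth (U \<inter> W) \<rho>"
    unfolding \<rho>_def using smooth_subset[OF smooth_coord[OF q(1)], of "U \<inter> W"]
    by (intro smooth_sum smooth_mult smooth_diff smooth_const UW) auto
  have "smooth (U \<inter> W) (\<lambda>x. flat_exp (flat_exp_poly 0) ((d/2) * (d/2) - \<rho> x))"
    by (rule smooth_compose_real[where S = UNIV and \<phi> = "\<lambda>j. flat_exp (flat_exp_poly j)", OF UW])
      (use smooth_diff[OF UW smooth_const[OF UW] \<rho>] DERIV_flat_exp in auto)
  then have s1: "smooth (U \<inter> W) \<eta>"
    by (subst smooth_cong[OF UW]) (auto simp: \<eta>_def)
  have 0: "\<eta> x = 0" if "x \<notin> K" for x
  proof (cases "x \<in> U \<inter> W")
    case True
    have "q x \<notin> C" using that True q(1) unfolding K_def by (metis IntD1 chart_inv imageI)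
    then obtain j where "q x j \<notin> (if j < n then {q x0 j - d/2..q x0 j + d/2} else {0})"
      unfolding C_def by auto
    moreover have "q x j = 0" if "j \<ge> n"
      using Euclidean_space_open_zero[OF chart_image_open[OF q(1) W]] True that by blast
    ultimately have j: "j < n" "q x j \<notin> {q x0 j - d/2..q x0 j + d/2}" by (auto split: if_splits)
    then have "d/2 \<le> \<bar>q x j - q x0 j\<bar>" by (auto simp: abs_if)
    then have "(d/2) * (d/2) \<le> \<bar>q x j - q x0 j\<bar> * \<bar>q x j - q x0 j\<bar>"
      using d(1) by (intro mult_mono) auto
    also have "\<dots> = (q x j - q x0 j) * (q x j - q x0 j)" by simp
    also have "\<dots> \<le> \<rho> x"
      unfolding \<rho>_def by (rule member_le_sum) (use j in auto)
    finally show ?thesis by (simp add: \<eta>_def flat_exp_def)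
  qed (auto simp: \<eta>_def)
  have s2: "smooth (- K) \<eta>"
  proof (subst smooth_cong[where g = "\<lambda>x. 0"])
    show "open (- K)" using clK by (simp add: open_Compl)
    then show "smooth (- K) (\<lambda>x. 0)" by (rule smooth_const)
  qed (use 0 in auto)
  have "smooth UNIV \<eta>"
  proof (rule smooth_local)
    fix x
    show "\<exists>W'. open W' \<and> x \<in> W' \<and> W' \<subseteq> UNIV \<and> smooth W' \<eta>"
      using s1 s2 UW clK KW by (cases "x \<in> K") (auto intro: exI[of _ "U \<inter> W"] exI[of _ "- K"])
  qed
  moreover have "\<eta> x0 > 0"
    using q(2) x0 d(1) by (simp add: \<eta>_def \<rho>_def flat_exp_def)
  ultimately show thesis using that clK KW 0 by blast
qed

end

section \<open>Linear algebra in the fibres\<close>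

lemma basis_in_fibre: "is_fibre_basis B r e x \<Longrightarrow> a < r \<Longrightarrow> e a x \<in> fibre B x"
  unfolding is_fibre_basis_def by (metis imageI lessThan_iff span_superset subsetD)

lemma basis_expand:
  assumes e: "is_fibre_basis B r e x" and v: "v \<in> fibre B x"
  shows "(\<Sum>a<r. coeff r e a x v *\<^sub>R e a x) = v"
proof -
  let ?S = "(\<lambda>a. e a x) ` {..<r}"
  have "(\<Sum>b\<in>?S. representation ?S v b *\<^sub>R b) = v"
    using e v by (intro real_vector.sum_representation_eq) (auto simp: is_fibre_basis_def)
  moreover have "(\<Sum>b\<in>?S. representation ?S v b *\<^sub>R b) = (\<Sum>a<r. coeff r e a x v *\<^sub>R e a x)"
    using e by (subst sum.reindex) (auto simp: is_fibre_basis_def coeff_def)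
  ultimately show ?thesis by simp
qed

lemma frame_coeff_add:
  assumes "is_fibre_basis B r e x" "v \<in> fibre B x" "w \<in> fibre B x"
  shows "coeff r e a x (v + w) = coeff r e a x v + coeff r e a x w"
  using assms unfolding coeff_def is_fibre_basis_def by (simp add: real_vector.representation_add)

lemma frame_coeff_scale:
  assumes "is_fibre_basis B r e x" "v \<in> fibre B x"
  shows "coeff r e a x (c *\<^sub>R v) = c * coeff r e a x v"
  using assms unfolding coeff_def is_fibre_basis_def by (simp add: real_vector.representation_scale)

lemma frame_coeff_zero: "is_fibre_basis B r e x \<Longrightarrow> coeff r e a x 0 = 0"
  unfolding coeff_def by (simp add: real_vector.representation_zero)

lemma frame_coeff_basis:
  assumes "is_fibre_basis B r e x" "a < r" "b < r"
  shows "coeff r e a x (e b x) = (if a = b then 1 else 0)"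
proof -
  have "e b x = e a x \<longleftrightarrow> a = b"
    using assms unfolding is_fibre_basis_def inj_on_def by auto
  then show ?thesis
    using assms unfolding coeff_def is_fibre_basis_def
    by (auto simp: real_vector.representation_basis)
qed

locale metric_bundle_space =
  fixes B :: "('m::{t2_space,second_countable_topology}, 'v::real_vector) metric_bundle"
  assumes metric_bundle: "metric_vector_bundle B"
begin

sublocale smooth_manifold "mdim B" "atlas B"
  using metric_bundle by unfold_locales (simp add: metric_vector_bundle_def vector_bundle_def)

abbreviation "smsec \<equiv> smooth_section_on B"

lemma frame_exists: "\<exists>U r e. (U, r, e) \<in> frames B \<and> x \<in> U"
proof -
  have "x \<in> (\<Union>(U, r, e)\<in>frames B. U)"
    using metric_bundle by (simp add: metric_vector_bundle_def vector_bundle_def)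
  then show ?thesis by auto
qed

lemma frame:
  assumes "(U, r, e) \<in> frames B"
  shows "open U" "\<And>x. x \<in> U \<Longrightarrow> is_fibre_basis B r e x" "\<And>a. a < r \<Longrightarrow> smsec U (e a)"
proof -
  have *: "\<forall>(U, r, e)\<in>frames B. open U \<and> (\<forall>x\<in>U. is_fibre_basis B r e x) \<and> (\<forall>a<r. smsec U (e a))"
    using metric_bundle by (simp add: metric_vector_bundle_def vector_bundle_def)
  from bspec[OF * assms] show "open U" "\<And>x. x \<in> U \<Longrightarrow> is_fibre_basis B r e x" "\<And>a. a < r \<Longrightarrow> smsec U (e a)"
    by auto
qed

lemma frame_gram_smooth:
  assumes "(U, r, e) \<in> frames B" "a < r" "b < r"
  shows "smooth U (\<lambda>x. form B x (e a x) (e b x))"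
proof -
  have *: "\<forall>(U, r, e)\<in>frames B. \<forall>a<r. \<forall>b<r. smooth U (\<lambda>x. form B x (e a x) (e b x))"
    using metric_bundle by (simp add: metric_vector_bundle_def)
  from bspec[OF * assms(1)] show ?thesis using assms(2,3) by auto
qed

lemma fibre_subspace: "subspace (fibre B x)"
proof -
  obtain U r e where "(U, r, e) \<in> frames B" "x \<in> U" using frame_exists by blast
  from frame(2)[OF this] have "fibre B x = span ((\<lambda>a. e a x) ` {..<r})"
    by (simp add: is_fibre_basis_def)
  then show ?thesis by (simp add: subspace_span)
qed

lemma fibre_zero [simp]: "0 \<in> fibre B x"
  using fibre_subspace by (rule subspace_0)

lemma fibre_add [simp]: "u \<in> fibre B x \<Longrightarrow> v \<in> fibre B x \<Longrightarrow> u + v \<in> fibre B x"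
  using fibre_subspace by (rule subspace_add)

lemma fibre_diff [simp]: "u \<in> fibre B x \<Longrightarrow> v \<in> fibre B x \<Longrightarrow> u - v \<in> fibre B x"
  using fibre_subspace by (rule subspace_diff)

lemma fibre_scale [simp]: "u \<in> fibre B x \<Longrightarrow> c *\<^sub>R u \<in> fibre B x"
  using fibre_subspace by (rule subspace_scale)

lemma fibre_uminus [simp]: "u \<in> fibre B x \<Longrightarrow> - u \<in> fibre B x"
  using fibre_subspace by (rule subspace_neg)

lemma fibre_sum: "(\<And>i. i \<in> I \<Longrightarrow> w i \<in> fibre B x) \<Longrightarrow> (\<Sum>i\<in>I. w i) \<in> fibre B x"
  using fibre_subspace by (rule subspace_sum)

lemma frame_coeff_sum:
  assumes "is_fibre_basis B r e x" "\<And>i. i \<in> I \<Longrightarrow> w i \<in> fibre B x"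
  shows "coeff r e a x (\<Sum>i\<in>I. c i *\<^sub>R w i) = (\<Sum>i\<in>I. c i * coeff r e a x (w i))"
  using assms(2)
proof (induction I rule: infinite_finite_induct)
  case (insert i I)
  then have "(\<Sum>i\<in>I. c i *\<^sub>R w i) \<in> fibre B x" by (intro fibre_sum fibre_scale) auto
  with insert show ?case by (simp add: frame_coeff_add[OF assms(1)] frame_coeff_scale[OF assms(1)])
qed (simp_all add: frame_coeff_zero[OF assms(1)])

lemma form_axioms:
  "\<forall>x. \<forall>u\<in>fibre B x. \<forall>v\<in>fibre B x. form B x u v = form B x v u"
  "\<forall>x. \<forall>u\<in>fibre B x. \<forall>v\<in>fibre B x. \<forall>w\<in>fibre B x.
    form B x (u + v) w = form B x u w + form B x v w"
  "\<forall>x c. \<forall>u\<in>fibre B x. \<forall>w\<in>fibre B x. form B x (c *\<^sub>R u) w = c * form B x u w"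
  "\<forall>x. \<forall>u\<in>fibre B x. (\<forall>v\<in>fibre B x. form B x u v = 0) \<longrightarrow> u = 0"
proof -
  note * = metric_bundle[unfolded metric_vector_bundle_def]
  note ** = *[THEN conjunct2]
  note *** = **[THEN conjunct2]
  note **** = ***[THEN conjunct2]
  show "\<forall>x. \<forall>u\<in>fibre B x. \<forall>v\<in>fibre B x. form B x u v = form B x v u"
    by (rule **[THEN conjunct1])
  show "\<forall>x. \<forall>u\<in>fibre B x. \<forall>v\<in>fibre B x. \<forall>w\<in>fibre B x.
      form B x (u + v) w = form B x u w + form B x v w"
    by (rule ***[THEN conjunct1])
  show "\<forall>x c. \<forall>u\<in>fibre B x. \<forall>w\<in>fibre B x. form B x (c *\<^sub>R u) w = c * form B x u w"
    by (rule ****[THEN conjunct1])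
  show "\<forall>x. \<forall>u\<in>fibre B x. (\<forall>v\<in>fibre B x. form B x u v = 0) \<longrightarrow> u = 0"
    by (rule ****[THEN conjunct2, THEN conjunct1])
qed

lemma form_sym: "u \<in> fibre B x \<Longrightarrow> v \<in> fibre B x \<Longrightarrow> form B x u v = form B x v u"
  using form_axioms(1) by blast

lemma form_add_left:
  "u \<in> fibre B x \<Longrightarrow> v \<in> fibre B x \<Longrightarrow> w \<in> fibre B x \<Longrightarrow>
    form B x (u + v) w = form B x u w + form B x v w"
  using form_axioms(2) by blast

lemma form_scale_left:
  "u \<in> fibre B x \<Longrightarrow> w \<in> fibre B x \<Longrightarrow> form B x (c *\<^sub>R u) w = c * form B x u w"
  using form_axioms(3) by blast

lemma form_add_right:
  "u \<in> fibre B x \<Longrightarrow> v \<in> fibre B x \<Longrightarrow> w \<in> fibre B x \<Longrightarrow>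
    form B x w (u + v) = form B x w u + form B x w v"
  using form_add_left form_sym fibre_add by metis

lemma form_scale_right:
  "u \<in> fibre B x \<Longrightarrow> w \<in> fibre B x \<Longrightarrow> form B x w (c *\<^sub>R u) = c * form B x w u"
  using form_scale_left form_sym fibre_scale by metis

lemma form_zero_left [simp]: "w \<in> fibre B x \<Longrightarrow> form B x 0 w = 0"
  using form_scale_left[of 0 x w 0] by simp

lemma form_zero_right [simp]: "w \<in> fibre B x \<Longrightarrow> form B x w 0 = 0"
  using form_scale_right[of 0 x w 0] by simp

lemma form_uminus_left: "u \<in> fibre B x \<Longrightarrow> w \<in> fibre B x \<Longrightarrow> form B x (- u) w = - form B x u w"
  using form_scale_left[of u x w "-1"] by simp

lemma form_uminus_right: "u \<in> fibre B x \<Longrightarrow> w \<in> fibre B x \<Longrightarrow> form B x w (- u) = - form B x w u"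
  using form_scale_right[of u x w "-1"] by simp

lemma form_diff_left:
  "u \<in> fibre B x \<Longrightarrow> v \<in> fibre B x \<Longrightarrow> w \<in> fibre B x \<Longrightarrow>
    form B x (u - v) w = form B x u w - form B x v w"
  using form_add_left[of u x "- v" w] by (simp add: form_uminus_left)

lemma form_diff_right:
  "u \<in> fibre B x \<Longrightarrow> v \<in> fibre B x \<Longrightarrow> w \<in> fibre B x \<Longrightarrow>
    form B x w (u - v) = form B x w u - form B x w v"
  using form_add_right[of u x "- v" w] by (simp add: form_uminus_right)

lemma form_sum_left:
  assumes "\<And>i. i \<in> I \<Longrightarrow> w i \<in> fibre B x" "v \<in> fibre B x"
  shows "form B x (\<Sum>i\<in>I. c i *\<^sub>R w i) v = (\<Sum>i\<in>I. c i * form B x (w i) v)"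
  using assms(1)
proof (induction I rule: infinite_finite_induct)
  case (insert i I)
  then have "(\<Sum>i\<in>I. c i *\<^sub>R w i) \<in> fibre B x" by (intro fibre_sum fibre_scale) auto
  with insert assms(2) show ?case by (simp add: form_add_left form_scale_left)
qed (use assms(2) in simp_all)

lemma form_sum_right:
  assumes "\<And>i. i \<in> I \<Longrightarrow> w i \<in> fibre B x" "v \<in> fibre B x"
  shows "form B x v (\<Sum>i\<in>I. c i *\<^sub>R w i) = (\<Sum>i\<in>I. c i * form B x v (w i))"
proof -
  have "(\<Sum>i\<in>I. c i *\<^sub>R w i) \<in> fibre B x" using assms by (intro fibre_sum fibre_scale) auto
  then show ?thesis
    using form_sum_left[of I w x v c] assms by (simp add: form_sym[of v])
qed

lemma form_nondegenerate:
  "u \<in> fibre B x \<Longrightarrow> (\<And>v. v \<in> fibre B x \<Longrightarrow> form B x u v = 0) \<Longrightarrow> u = 0"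
  using form_axioms(4) by blast

lemma form_ext:
  assumes "u \<in> fibre B x" "v \<in> fibre B x" "\<And>w. w \<in> fibre B x \<Longrightarrow> form B x u w = form B x v w"
  shows "u = v"
  using form_nondegenerate[of "u - v" x] assms by (simp add: form_diff_left)

lemma form_basis_ext:
  assumes "is_fibre_basis B r e x" "u \<in> fibre B x" "v \<in> fibre B x"
    "\<And>a. a < r \<Longrightarrow> form B x u (e a x) = form B x v (e a x)"
  shows "u = v"
proof (rule form_ext[OF assms(2,3)])
  fix w assume w: "w \<in> fibre B x"
  have *: "form B x z w = (\<Sum>a<r. coeff r e a x w * form B x z (e a x))" if "z \<in> fibre B x" for z
    using form_sum_right[of "{..<r}" "\<lambda>a. e a x" x z "\<lambda>a. coeff r e a x w"] that
      basis_in_fibre[OF assms(1)] basis_expand[OF assms(1) w] by simp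
  show "form B x u w = form B x v w" using *[OF assms(2)] *[OF assms(3)] assms(4) by simp
qed

section \<open>Smooth sections\<close>

lemma smsec_fibre: "smsec W s \<Longrightarrow> x \<in> W \<Longrightarrow> s x \<in> fibre B x"
  unfolding smooth_section_on_def by blast

lemma smsec_coeff:
  assumes "smsec W s" "(U, r, e) \<in> frames B" "a < r"
  shows "smooth (U \<inter> W) (\<lambda>x. coeff r e a x (s x))"
  using assms(1) assms(2,3) unfolding smooth_section_on_def by blast

lemma smsecI:
  assumes "\<And>x. x \<in> W \<Longrightarrow> s x \<in> fibre B x"
    "\<And>U r e a. (U, r, e) \<in> frames B \<Longrightarrow> a < r \<Longrightarrow> smooth (U \<inter> W) (\<lambda>x. coeff r e a x (s x))"
  shows "smsec W s"
  using assms unfolding smooth_section_on_def by blast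

lemma sections_iff: "s \<in> sections B \<longleftrightarrow> smsec UNIV s"
  by (simp add: sections_def)

lemma sections_fibre: "s \<in> sections B \<Longrightarrow> s x \<in> fibre B x"
  using smsec_fibre sections_iff by blast

lemma smsec_subset: "smsec W s \<Longrightarrow> W' \<subseteq> W \<Longrightarrow> smsec W' s"
  by (rule smsecI) (auto intro: smsec_fibre smooth_subset[OF smsec_coeff])

lemma sections_smsec: "s \<in> sections B \<Longrightarrow> smsec W s"
  using smsec_subset sections_iff by blast

lemma smsec_cong:
  assumes "open W" "\<And>x. x \<in> W \<Longrightarrow> s x = s' x" "smsec W s"
  shows "smsec W s'"
proof (rule smsecI)
  fix U r e a assume *: "(U, r, e) \<in> frames B" "a < r"
  have o: "open (U \<inter> W)" using frame(1)[OF *(1)] assms(1) by auto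
  show "smooth (U \<inter> W) (\<lambda>x. coeff r e a x (s' x))"
    using smsec_coeff[OF assms(3) *] by (subst smooth_cong[OF o, of _ "\<lambda>x. coeff r e a x (s x)"]) (auto simp: assms(2))
qed (use assms smsec_fibre in metis)

lemma smsec_local:
  assumes "\<And>x. x \<in> W \<Longrightarrow> \<exists>W'. open W' \<and> x \<in> W' \<and> W' \<subseteq> W \<and> smsec W' s"
  shows "smsec W s"
proof (rule smsecI)
  show "s x \<in> fibre B x" if "x \<in> W" for x using assms[OF that] smsec_fibre by blast
  fix U r e a assume *: "(U, r, e) \<in> frames B" "a < r"
  show "smooth (U \<inter> W) (\<lambda>x. coeff r e a x (s x))"
  proof (rule smooth_local)
    fix x assume x: "x \<in> U \<inter> W"
    obtain W' where W': "open W'" "x \<in> W'" "W' \<subseteq> W" "smsec W' s" using assms x by blast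
    then show "\<exists>W'. open W' \<and> x \<in> W' \<and> W' \<subseteq> U \<inter> W \<and> smooth W' (\<lambda>x. coeff r e a x (s x))"
      using smsec_coeff[OF W'(4) *] frame(1)[OF *(1)] x by (intro exI[of _ "U \<inter> W'"]) auto
  qed
qed

lemma smsec_zero: "open W \<Longrightarrow> smsec W (\<lambda>x. 0)"
proof (rule smsecI)
  fix U r e a assume *: "open W" "(U, r, e) \<in> frames B" "a < r"
  then have o: "open (U \<inter> W)" using frame(1) by blast
  have "coeff r e a x 0 = 0" if "x \<in> U \<inter> W" for x
    using frame_coeff_zero[OF frame(2)[OF *(2)]] that by simp
  then show "smooth (U \<inter> W) (\<lambda>x. coeff r e a x 0)"
    using smooth_const[OF o, of 0] by (subst smooth_cong[OF o, of _ "\<lambda>x. 0"])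
qed simp

lemma smsec_add:
  assumes "open W" "smsec W s" "smsec W s'"
  shows "smsec W (\<lambda>x. s x + s' x)"
proof (rule smsecI)
  fix U r e a assume *: "(U, r, e) \<in> frames B" "a < r"
  then have o: "open (U \<inter> W)" using frame(1) assms(1) by blast
  have "coeff r e a x (s x + s' x) = coeff r e a x (s x) + coeff r e a x (s' x)" if "x \<in> U \<inter> W" for x
    using frame_coeff_add[OF frame(2)[OF *(1)] smsec_fibre[OF assms(2)] smsec_fibre[OF assms(3)]] that
    by simp
  then show "smooth (U \<inter> W) (\<lambda>x. coeff r e a x (s x + s' x))"
    using smooth_add[OF o smsec_coeff[OF assms(2) *] smsec_coeff[OF assms(3) *]]
    by (subst smooth_cong[OF o, of _ "\<lambda>x. coeff r e a x (s x) + coeff r e a x (s' x)"])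
qed (use assms smsec_fibre in auto)

lemma smsec_scale:
  assumes "open W" "smooth W f" "smsec W s"
  shows "smsec W (\<lambda>x. f x *\<^sub>R s x)"
proof (rule smsecI)
  fix U r e a assume *: "(U, r, e) \<in> frames B" "a < r"
  then have o: "open (U \<inter> W)" using frame(1) assms(1) by blast
  have f: "smooth (U \<inter> W) f" using assms(2) by (rule smooth_subset) auto
  have "coeff r e a x (f x *\<^sub>R s x) = f x * coeff r e a x (s x)" if "x \<in> U \<inter> W" for x
    using frame_coeff_scale[OF frame(2)[OF *(1)] smsec_fibre[OF assms(3)]] that by simp
  then show "smooth (U \<inter> W) (\<lambda>x. coeff r e a x (f x *\<^sub>R s x))"
    using smooth_mult[OF o f smsec_coeff[OF assms(3) *]]
    by (subst smooth_cong[OF o, of _ "\<lambda>x. f x * coeff r e a x (s x)"])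
qed (use assms smsec_fibre in auto)

lemma smsec_cscale: "open W \<Longrightarrow> smsec W s \<Longrightarrow> smsec W (\<lambda>x. c *\<^sub>R s x)"
  by (rule smsec_scale[OF _ smooth_const])

lemma smsec_diff:
  assumes "open W" "smsec W s" "smsec W s'"
  shows "smsec W (\<lambda>x. s x - s' x)"
  using smsec_add[OF assms(1,2) smsec_cscale[OF assms(1,3), of "-1"]] by simp

lemma smsec_sum:
  assumes "open W" "\<And>i. i \<in> I \<Longrightarrow> smsec W (s i)"
  shows "smsec W (\<lambda>x. \<Sum>i\<in>I. s i x)"
  using assms(2)
proof (induction I rule: infinite_finite_induct)
  case (insert i I)
  then show ?case by (simp add: smsec_add[OF assms(1)])
qed (simp_all add: smsec_zero[OF assms(1)])

lemma smooth_form: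
  assumes "open W" "smsec W s" "smsec W s'"
  shows "smooth W (\<lambda>x. form B x (s x) (s' x))"
proof (rule smooth_local)
  fix x assume x: "x \<in> W"
  obtain U r e where e: "(U, r, e) \<in> frames B" "x \<in> U" using frame_exists by blast
  have o: "open (U \<inter> W)" using frame(1)[OF e(1)] assms(1) by blast
  have "smooth (U \<inter> W) (\<lambda>x. \<Sum>a<r. coeff r e a x (s x) *
      (\<Sum>b<r. coeff r e b x (s' x) * form B x (e a x) (e b x)))"
    using smsec_coeff[OF assms(2) e(1)] smsec_coeff[OF assms(3) e(1)]
      smooth_subset[OF frame_gram_smooth[OF e(1)], of _ _ "U \<inter> W"]
    by (intro smooth_sum smooth_mult o) auto
  moreover have "(\<Sum>a<r. coeff r e a z (s z) * (\<Sum>b<r. coeff r e b z (s' z) * form B z (e a z) (e b z))) =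
      form B z (s z) (s' z)" if z: "z \<in> U \<inter> W" for z
  proof -
    have b: "is_fibre_basis B r e z" using frame(2)[OF e(1)] z by blast
    have f: "s z \<in> fibre B z" "s' z \<in> fibre B z" using assms smsec_fibre z by auto
    have "form B z w (s' z) = (\<Sum>b<r. coeff r e b z (s' z) * form B z w (e b z))"
      if "w \<in> fibre B z" for w
      using form_sum_right[of "{..<r}" "\<lambda>a. e a z" z w "\<lambda>a. coeff r e a z (s' z)"] that
        basis_in_fibre[OF b] basis_expand[OF b f(2)] by simp
    moreover have "form B z (s z) (s' z) = (\<Sum>a<r. coeff r e a z (s z) * form B z (e a z) (s' z))"
      using form_sum_left[of "{..<r}" "\<lambda>a. e a z" z "s' z" "\<lambda>a. coeff r e a z (s z)"] f
        basis_in_fibre[OF b] basis_expand[OF b f(1)] by simp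
    ultimately show ?thesis using basis_in_fibre[OF b] by simp
  qed
  ultimately have "smooth (U \<inter> W) (\<lambda>x. form B x (s x) (s' x))"
    by (subst (asm) smooth_cong[OF o]) auto
  then show "\<exists>W'. open W' \<and> x \<in> W' \<and> W' \<subseteq> W \<and> smooth W' (\<lambda>x. form B x (s x) (s' x))"
    using o x e(2) by blast
qed

text \<open>A local section extends to a global one after multiplication by a bump function.\<close>

lemma extend_section:
  assumes W: "open W" "x0 \<in> W" and s: "smsec W s"
  obtains s' f W' where "s' \<in> sections B" "open W'" "x0 \<in> W'" "W' \<subseteq> W" "smooth W' f"
    "\<And>x. x \<in> W' \<Longrightarrow> f x > 0" "\<And>x. x \<in> W' \<Longrightarrow> s' x = f x *\<^sub>R s x"
proof -
  obtain \<eta> K where \<eta>: "smooth UNIV \<eta>" "\<eta> x0 > 0" "closed K" "K \<subseteq> W" "\<And>x. x \<notin> K \<Longrightarrow> \<eta> x = 0"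
    using bump_function[OF W] by metis
  define s' where "s' x = (if x \<in> W then \<eta> x *\<^sub>R s x else 0)" for x
  define W' where "W' = {x \<in> W. \<eta> x > 0}"
  have "continuous_on UNIV \<eta>" using smooth_continuous_on \<eta>(1) by blast
  then have "open {x. \<eta> x > 0}" by (intro open_Collect_less) auto
  then have W': "open W'" unfolding W'_def Collect_conj_eq using W(1) by auto
  have "smsec UNIV s'"
  proof (rule smsec_local)
    fix x
    have 1: "smsec W s'"
      by (rule smsec_cong[OF W(1) _ smsec_scale[OF W(1) smooth_subset[OF \<eta>(1)] s]]) (auto simp: s'_def)
    have 2: "smsec (- K) s'"
      by (rule smsec_cong[OF _ _ smsec_zero]) (use \<eta> in \<open>auto simp: s'_def\<close>)
    show "\<exists>W'. open W' \<and> x \<in> W' \<and> W' \<subseteq> UNIV \<and> smsec W' s'"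
      using 1 2 W \<eta>(3,4) by (cases "x \<in> K") (auto intro: exI[of _ W] exI[of _ "- K"])
  qed
  then have "s' \<in> sections B" by (simp add: sections_iff)
  moreover have "smooth W' \<eta>" using \<eta>(1) by (rule smooth_subset) simp
  moreover have "x0 \<in> W'" "W' \<subseteq> W" using W(2) \<eta>(2) by (auto simp: W'_def)
  moreover have "\<eta> x > 0" "s' x = \<eta> x *\<^sub>R s x" if "x \<in> W'" for x
    using that by (auto simp: W'_def s'_def)
  ultimately show thesis using W' by (intro that[of s' W' \<eta>])
qed

lemma section_through:
  assumes "v \<in> fibre B x"
  obtains s where "s \<in> sections B" "s x = v"
proof -
  obtain U r e where e: "(U, r, e) \<in> frames B" "x \<in> U" using frame_exists by blast
  have U: "open U" using frame(1)[OF e(1)] .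
  define s where "s z = (\<Sum>a<r. coeff r e a x v *\<^sub>R e a z)" for z
  have s: "smsec U s"
    unfolding s_def using frame(3)[OF e(1)] by (intro smsec_sum smsec_cscale U) auto
  have sx: "s x = v" unfolding s_def using basis_expand[OF frame(2)[OF e] assms] .
  obtain s' f W' where *: "s' \<in> sections B" "open W'" "x \<in> W'" "W' \<subseteq> U" "smooth W' f"
    "\<And>x. x \<in> W' \<Longrightarrow> f x > (0::real)" "\<And>x. x \<in> W' \<Longrightarrow> s' x = f x *\<^sub>R s x"
    using extend_section[OF U e(2) s] by metis
  have "(\<lambda>z. (1 / f x) *\<^sub>R s' z) \<in> sections B"
    using *(1) smsec_cscale[of UNIV s'] by (simp add: sections_iff)
  moreover have "(1 / f x) *\<^sub>R s' x = v" using *(6,7)[OF *(3)] sx by simp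
  ultimately show thesis using that by blast
qed

section \<open>Bundle endomorphisms\<close>

lemma endo_sum:
  assumes "bundle_endo B N" "\<And>i. i \<in> I \<Longrightarrow> w i \<in> fibre B x"
  shows "N x (\<Sum>i\<in>I. c i *\<^sub>R w i) = (\<Sum>i\<in>I. c i *\<^sub>R N x (w i))"
proof -
  have add: "N x (u + v) = N x u + N x v" if "u \<in> fibre B x" "v \<in> fibre B x" for u v
    using assms(1) that unfolding bundle_endo_def by blast
  have sc: "N x (c *\<^sub>R u) = c *\<^sub>R N x u" if "u \<in> fibre B x" for u c
    using assms(1) that unfolding bundle_endo_def by blast
  have 0: "N x 0 = 0" using sc[of 0 0] by simp
  show ?thesis using assms(2)
  proof (induction I rule: infinite_finite_induct)
    case (insert i I)
    then have "(\<Sum>i\<in>I. c i *\<^sub>R w i) \<in> fibre B x" by (intro fibre_sum fibre_scale) auto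
    with insert show ?case by (simp add: add sc)
  qed (simp_all add: 0)
qed

lemma smsec_endo:
  assumes N: "bundle_endo B N" and W: "open W" and s: "smsec W s"
  shows "smsec W (\<lambda>x. N x (s x))"
proof (rule smsec_local)
  fix x assume x: "x \<in> W"
  obtain U r e where e: "(U, r, e) \<in> frames B" "x \<in> U" using frame_exists by blast
  have o: "open (U \<inter> W)" using frame(1)[OF e(1)] W by blast
  have "\<forall>(U, r, e)\<in>frames B. \<forall>a<r. smsec U (\<lambda>x. N x (e a x))"
    using N unfolding bundle_endo_def by blast
  from bspec[OF this e(1)] have Ne: "smsec U (\<lambda>x. N x (e a x))" if "a < r" for a using that by auto
  have "smsec (U \<inter> W) (\<lambda>x. \<Sum>a<r. coeff r e a x (s x) *\<^sub>R N x (e a x))"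
    using smsec_coeff[OF s e(1)] Ne by (intro smsec_sum smsec_scale o) (auto intro: smsec_subset)
  then have "smsec (U \<inter> W) (\<lambda>x. N x (s x))"
  proof (rule smsec_cong[OF o, rotated])
    fix z assume z: "z \<in> U \<inter> W"
    have b: "is_fibre_basis B r e z" using frame(2)[OF e(1)] z by blast
    have "N z (\<Sum>a<r. coeff r e a z (s z) *\<^sub>R e a z) = (\<Sum>a<r. coeff r e a z (s z) *\<^sub>R N z (e a z))"
      using basis_in_fibre[OF b] by (intro endo_sum[OF N]) auto
    then show "(\<Sum>a<r. coeff r e a z (s z) *\<^sub>R N z (e a z)) = N z (s z)"
      using basis_expand[OF b, of "s z"] smsec_fibre[OF s, of z] z by simp
  qed
  then show "\<exists>W'. open W' \<and> x \<in> W' \<and> W' \<subseteq> W \<and> smsec W' (\<lambda>x. N x (s x))"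
    using o x e(2) by blast
qed

section \<open>Orthonormal frames and adapted charts\<close>

text \<open>The Gram-Schmidt process for an indefinite form: as long as \<open>k\<close> is less than the rank,
  some vector has a component orthogonal to the first \<open>k\<close> sections that is not isotropic. Otherwise
  polarization and non-degeneracy would force these sections to span the fibre.\<close>

lemma orthonormal_partial_frame:
  assumes e: "(U, r, e) \<in> frames B" "x0 \<in> U"
  shows "k \<le> r \<Longrightarrow> \<exists>W f \<epsilon>. open W \<and> x0 \<in> W \<and> (\<forall>a<k. smsec W (f a)) \<and>
    (\<forall>a<k. \<epsilon> a * \<epsilon> a = (1::real)) \<and>
    (\<forall>x\<in>W. \<forall>a<k. \<forall>b<k. form B x (f a x) (f b x) = (if a = b then \<epsilon> a else 0))"
proof (induction k)
  case 0
  show ?case by (intro exI[of _ UNIV]) auto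
next
  case (Suc k)
  then obtain W f \<epsilon> where W: "open W" "x0 \<in> W" and f: "\<And>a. a < k \<Longrightarrow> smsec W (f a)"
    and \<epsilon>: "\<And>a. a < k \<Longrightarrow> \<epsilon> a * \<epsilon> a = (1::real)"
    and orth: "\<And>x a b. x \<in> W \<Longrightarrow> a < k \<Longrightarrow> b < k \<Longrightarrow>
      form B x (f a x) (f b x) = (if a = b then \<epsilon> a else 0)"
    by (metis Suc_leD)
  have f_in: "f a x \<in> fibre B x" if "x \<in> W" "a < k" for a x
    using smsec_fibre f that by blast
  \<comment> \<open>the component orthogonal to the partial frame\<close>
  define P where "P x v = v - (\<Sum>a<k. (\<epsilon> a * form B x v (f a x)) *\<^sub>R f a x)" for x v
  have P_in: "P x v \<in> fibre B x" if "x \<in> W" "v \<in> fibre B x" for x v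
    unfolding P_def using that f_in by (intro fibre_diff fibre_sum fibre_scale) auto
  have P_orth: "form B x (P x v) (f b x) = 0" if x: "x \<in> W" "v \<in> fibre B x" and b: "b < k" for x v b
  proof -
    have "form B x (\<Sum>a<k. (\<epsilon> a * form B x v (f a x)) *\<^sub>R f a x) (f b x) =
        (\<Sum>a<k. (\<epsilon> a * form B x v (f a x)) * form B x (f a x) (f b x))"
      using f_in x b by (intro form_sum_left) auto
    also have "\<dots> = (\<Sum>a<k. if a = b then form B x v (f b x) else 0)"
      using orth[OF x(1) _ b] \<epsilon>[OF b] by (intro sum.cong) auto
    also have "\<dots> = form B x v (f b x)" using b by simp
    finally have "form B x (\<Sum>a<k. (\<epsilon> a * form B x v (f a x)) *\<^sub>R f a x) (f b x) = form B x v (f b x)" .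
    moreover have "(\<Sum>a<k. (\<epsilon> a * form B x v (f a x)) *\<^sub>R f a x) \<in> fibre B x"
      using f_in x by (intro fibre_sum fibre_scale) auto
    ultimately show ?thesis unfolding P_def using x f_in b by (simp add: form_diff_left)
  qed
  have Pw: "form B x p (P x w) = form B x p w"
    if "x \<in> W" "w \<in> fibre B x" "p \<in> fibre B x" "\<And>a. a < k \<Longrightarrow> form B x p (f a x) = 0" for x p w
  proof -
    have "form B x p (\<Sum>a<k. (\<epsilon> a * form B x w (f a x)) *\<^sub>R f a x) =
        (\<Sum>a<k. (\<epsilon> a * form B x w (f a x)) * form B x p (f a x))"
      using f_in that by (intro form_sum_right) auto
    also have "\<dots> = 0" using that(4) by simp
    finally have "form B x p (\<Sum>a<k. (\<epsilon> a * form B x w (f a x)) *\<^sub>R f a x) = 0" .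
    moreover have "(\<Sum>a<k. (\<epsilon> a * form B x w (f a x)) *\<^sub>R f a x) \<in> fibre B x"
      using f_in that by (intro fibre_sum fibre_scale) auto
    ultimately show ?thesis unfolding P_def using that by (simp add: form_diff_right)
  qed
  have "\<exists>v\<in>fibre B x0. form B x0 (P x0 v) (P x0 v) \<noteq> 0"
  proof (rule ccontr)
    assume "\<not> ?thesis"
    then have iso: "form B x0 (P x0 v) (P x0 v) = 0" if "v \<in> fibre B x0" for v using that by blast
    have "fibre B x0 \<subseteq> span ((\<lambda>a. f a x0) ` {..<k})"
    proof
      fix v assume v: "v \<in> fibre B x0"
      define p where "p = P x0 v"
      have p: "p \<in> fibre B x0" "\<And>a. a < k \<Longrightarrow> form B x0 p (f a x0) = 0"
        using P_in[OF W(2) v] P_orth[OF W(2) v] by (auto simp: p_def)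
      have "p = 0"
      proof (rule form_nondegenerate[OF p(1)])
        fix w assume w: "w \<in> fibre B x0"
        have "P x0 (v + w) = p + P x0 w"
          using v w W(2) f_in
          by (simp add: P_def p_def form_add_left algebra_simps sum.distrib)
        with iso[of "v + w"] iso[OF v] iso[OF w] have "form B x0 p (P x0 w) = 0"
          using v w p(1) P_in[OF W(2)]
          by (simp add: form_add_left form_add_right p_def[symmetric] form_sym[of "P x0 w" x0 p])
        then show "form B x0 p w = 0" using Pw[OF W(2) w p] by simp
      qed
      then have "v = (\<Sum>a<k. (\<epsilon> a * form B x0 v (f a x0)) *\<^sub>R f a x0)"
        by (simp add: p_def P_def)
      also have "\<dots> \<in> span ((\<lambda>a. f a x0) ` {..<k})"
        by (intro span_sum span_scale span_base) auto
      finally show "v \<in> span ((\<lambda>a. f a x0) ` {..<k})" .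
    qed
    moreover have b: "is_fibre_basis B r e x0" using frame(2)[OF e] .
    ultimately have "(\<lambda>a. e a x0) ` {..<r} \<subseteq> span ((\<lambda>a. f a x0) ` {..<k})"
      using basis_in_fibre[OF b] by blast
    then have "card ((\<lambda>a. e a x0) ` {..<r}) \<le> card ((\<lambda>a. f a x0) ` {..<k})"
      using b real_vector.independent_span_bound[of "(\<lambda>a. f a x0) ` {..<k}" "(\<lambda>a. e a x0) ` {..<r}"]
      by (auto simp: is_fibre_basis_def)
    also have "\<dots> \<le> k" using card_image_le[of "{..<k}"] by simp
    finally have "card ((\<lambda>a. e a x0) ` {..<r}) \<le> k" .
    moreover have "card ((\<lambda>a. e a x0) ` {..<r}) = r"
      using b by (simp add: is_fibre_basis_def card_image)
    ultimately show False using Suc.prems by simp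
  qed
  then obtain v where v: "v \<in> fibre B x0" "form B x0 (P x0 v) (P x0 v) \<noteq> 0" by blast
  define s where "s z = (\<Sum>a<r. coeff r e a x0 v *\<^sub>R e a z)" for z
  have s0: "s x0 = v" unfolding s_def using basis_expand[OF frame(2)[OF e] v(1)] .
  have U: "open U" using frame(1)[OF e(1)] .
  have sU: "smsec U s"
    unfolding s_def using frame(3)[OF e(1)] by (intro smsec_sum smsec_cscale U) auto
  define g where "g z = P z (s z)" for z
  have o: "open (U \<inter> W)" using U W by auto
  have sUW: "smsec (U \<inter> W) s" using sU by (rule smsec_subset) simp
  have fUW: "smsec (U \<inter> W) (f a)" if "a < k" for a using f[OF that] by (rule smsec_subset) simp
  have g: "smsec (U \<inter> W) g"
    unfolding g_def P_def using sUW fUW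
    by (intro smsec_diff smsec_sum smsec_scale smooth_mult smooth_const smooth_form o) auto
  define h where "h z = form B z (g z) (g z)" for z
  define \<sigma> where "\<sigma> = sgn (h x0)"
  have \<sigma>: "\<sigma> * \<sigma> = 1" "\<sigma> * h x0 > 0"
    using v(2) by (auto simp: \<sigma>_def h_def g_def s0 sgn_if)
  have h: "smooth (U \<inter> W) (\<lambda>z. \<sigma> * h z)"
    unfolding h_def using g by (intro smooth_mult smooth_const smooth_form o)
  define W' where "W' = {z \<in> U \<inter> W. 0 < \<sigma> * h z}"
  have W': "open W'"
  proof -
    have "continuous_on (U \<inter> W) (\<lambda>z. \<sigma> * h z)" using smooth_continuous_on[OF o h] .
    then have "open ((U \<inter> W) \<inter> (\<lambda>z. \<sigma> * h z) -` {0<..})"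
      using o by (rule continuous_open_preimage) simp
    moreover have "W' = (U \<inter> W) \<inter> (\<lambda>z. \<sigma> * h z) -` {0<..}" by (auto simp: W'_def)
    ultimately show ?thesis by simp
  qed
  have W'UW: "W' \<subseteq> U \<inter> W" by (auto simp: W'_def)
  define f' where "f' a = (if a = k then (\<lambda>z. (\<sigma> * h z) powr (- 1 / 2) *\<^sub>R g z) else f a)" for a
  define \<epsilon>' where "\<epsilon>' a = (if a = k then \<sigma> else \<epsilon> a)" for a
  have "smsec W' (\<lambda>z. (\<sigma> * h z) powr (- 1 / 2) *\<^sub>R g z)"
    using smooth_subset[OF h W'UW] smsec_subset[OF g W'UW]
    by (intro smsec_scale smooth_powr W') (auto simp: W'_def)
  then have 1: "smsec W' (f' a)" if "a < Suc k" for a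
    using that smsec_subset[OF f, of a W'] W'UW by (auto simp: f'_def less_Suc_eq)
  have 2: "\<epsilon>' a * \<epsilon>' a = 1" if "a < Suc k" for a
    using that \<epsilon> \<sigma>(1) by (auto simp: \<epsilon>'_def less_Suc_eq)
  have 3: "form B x (f' a x) (f' b x) = (if a = b then \<epsilon>' a else 0)"
    if x: "x \<in> W'" and a: "a < Suc k" and b: "b < Suc k" for x a b
  proof -
    have xW: "x \<in> W" "x \<in> U \<inter> W" "\<sigma> * h x > 0" using x by (auto simp: W'_def)
    have gf: "g x \<in> fibre B x" using smsec_fibre[OF g xW(2)] .
    have sf: "s x \<in> fibre B x" using smsec_fibre[OF sUW xW(2)] .
    let ?c = "(\<sigma> * h x) powr (- 1 / 2)"
    have gk: "form B x (?c *\<^sub>R g x) (f c x) = 0" if "c < k" for c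
      using P_orth[OF xW(1) sf that] gf f_in[OF xW(1) that] by (simp add: form_scale_left g_def)
    have kg: "form B x (f c x) (?c *\<^sub>R g x) = 0" if "c < k" for c
      using gk[OF that] gf f_in[OF xW(1) that] by (subst form_sym) auto
    have "?c * ?c = 1 / (\<sigma> * h x)"
      using xW(3) by (simp add: powr_add[symmetric] powr_minus_divide)
    then have "?c * (?c * h x) = \<sigma>"
      using xW(3) \<sigma>(1) by (metis mult.assoc mult.commute nonzero_mult_div_cancel_right
          mult_eq_0_iff less_irrefl div_by_1 mult_1 times_divide_eq_left)
    then have gg: "form B x (?c *\<^sub>R g x) (?c *\<^sub>R g x) = \<sigma>"
      using gf by (simp add: form_scale_left form_scale_right h_def)
    show ?thesis
      using a b gk kg gg orth[OF xW(1)] by (auto simp: f'_def \<epsilon>'_def less_Suc_eq)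
  qed
  have "x0 \<in> W'" using W e(2) \<sigma>(2) by (simp add: W'_def)
  with W' 1 2 3 show ?case by blast
qed

lemma orthonormal_frame:
  obtains W r f \<epsilon> where "open W" "x0 \<in> W" "\<And>a. a < r \<Longrightarrow> smsec W (f a)"
    "\<And>x. x \<in> W \<Longrightarrow> is_fibre_basis B r f x" "\<And>a. a < r \<Longrightarrow> \<epsilon> a * \<epsilon> a = (1::real)"
    "\<And>x a b. x \<in> W \<Longrightarrow> a < r \<Longrightarrow> b < r \<Longrightarrow> form B x (f a x) (f b x) = (if a = b then \<epsilon> a else 0)"
proof -
  obtain U r e where e: "(U, r, e) \<in> frames B" "x0 \<in> U" using frame_exists by blast
  have U: "open U" using frame(1)[OF e(1)] .
  obtain W f \<epsilon> where *: "open W" "x0 \<in> W" "\<forall>a<r. smsec W (f a)" "\<forall>a<r. \<epsilon> a * \<epsilon> a = (1::real)"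
    "\<forall>x\<in>W. \<forall>a<r. \<forall>b<r. form B x (f a x) (f b x) = (if a = b then \<epsilon> a else 0)"
    using orthonormal_partial_frame[OF e order_refl] by blast
  have W: "open W" "x0 \<in> W" using * by auto
  have f: "smsec W (f a)" if "a < r" for a using *(3) that by blast
  have \<epsilon>: "\<epsilon> a * \<epsilon> a = 1" if "a < r" for a using *(4) that by blast
  have orth: "form B x (f a x) (f b x) = (if a = b then \<epsilon> a else 0)"
    if "x \<in> W" "a < r" "b < r" for x a b using *(5) that by blast
  have "is_fibre_basis B r f x" if x: "x \<in> U \<inter> W" for x
  proof -
    have f_in: "f a x \<in> fibre B x" if "a < r" for a
      using smsec_fibre f that x by blast
    have \<epsilon>0: "\<epsilon> a \<noteq> 0" if "a < r" for a using \<epsilon>[OF that] by auto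
    have inj: "inj_on (\<lambda>a. f a x) {..<r}"
    proof (rule inj_onI)
      fix a b assume "a \<in> {..<r}" "b \<in> {..<r}" "f a x = f b x"
      then show "a = b" using orth[of x a a] orth[of x b a] \<epsilon>0[of a] x by (auto split: if_splits)
    qed
    have ind: "independent ((\<lambda>a. f a x) ` {..<r})"
    proof
      assume "dependent ((\<lambda>a. f a x) ` {..<r})"
      then obtain c where c: "\<exists>v\<in>(\<lambda>a. f a x) ` {..<r}. c v \<noteq> 0"
          "(\<Sum>v\<in>(\<lambda>a. f a x) ` {..<r}. c v *\<^sub>R v) = 0"
        by (auto simp: real_vector.dependent_finite)
      then obtain b where b: "b < r" "c (f b x) \<noteq> 0" by auto
      have "0 = form B x (\<Sum>v\<in>(\<lambda>a. f a x) ` {..<r}. c v *\<^sub>R v) (f b x)"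
        using c(2) f_in[OF b(1)] by simp
      also have "(\<Sum>v\<in>(\<lambda>a. f a x) ` {..<r}. c v *\<^sub>R v) = (\<Sum>a<r. c (f a x) *\<^sub>R f a x)"
        using inj by (simp add: sum.reindex)
      also have "form B x \<dots> (f b x) = (\<Sum>a<r. c (f a x) * form B x (f a x) (f b x))"
        using f_in b by (intro form_sum_left) auto
      also have "\<dots> = (\<Sum>a<r. if a = b then c (f b x) * \<epsilon> b else 0)"
        using orth[of x _ b] x b by (intro sum.cong) auto
      also have "\<dots> = c (f b x) * \<epsilon> b" using b by simp
      finally show False using b \<epsilon>0 by simp
    qed
    have sub: "span ((\<lambda>a. f a x) ` {..<r}) \<subseteq> fibre B x"
      using f_in fibre_subspace by (intro span_minimal) auto
    have "fibre B x \<subseteq> span ((\<lambda>a. f a x) ` {..<r})"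
    proof
      fix v assume v: "v \<in> fibre B x"
      show "v \<in> span ((\<lambda>a. f a x) ` {..<r})"
      proof (rule ccontr)
        assume nv: "v \<notin> span ((\<lambda>a. f a x) ` {..<r})"
        then have "independent (insert v ((\<lambda>a. f a x) ` {..<r}))"
          using ind real_vector.independent_insertI by blast
        moreover have "insert v ((\<lambda>a. f a x) ` {..<r}) \<subseteq> span ((\<lambda>a. e a x) ` {..<r})"
          using frame(2)[OF e(1), of x] x v f_in by (auto simp: is_fibre_basis_def)
        ultimately have "card (insert v ((\<lambda>a. f a x) ` {..<r})) \<le> card ((\<lambda>a. e a x) ` {..<r})"
          using real_vector.independent_span_bound by blast
        also have "\<dots> \<le> r" using card_image_le[of "{..<r}"] by simp
        finally have "card (insert v ((\<lambda>a. f a x) ` {..<r})) \<le> r" .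
        moreover have "v \<notin> (\<lambda>a. f a x) ` {..<r}" by (rule contra_subsetD[OF span_superset nv])
        ultimately show False by (simp add: card_image[OF inj])
      qed
    qed
    then show ?thesis using inj ind sub by (auto simp: is_fibre_basis_def)
  qed
  moreover have "open (U \<inter> W)" "x0 \<in> U \<inter> W" using U W e(2) by auto
  moreover have "smsec (U \<inter> W) (f a)" if "a < r" for a using f[OF that] by (rule smsec_subset) simp
  ultimately show thesis using \<epsilon> orth by (intro that[of "U \<inter> W" r f \<epsilon>]) auto
qed

lemma adapted_chart_exists: "\<exists>\<kappa>\<in>adapted_charts B. x \<in> ac_dom \<kappa>"
proof -
  obtain W r f \<epsilon> where W: "open W" "x \<in> W" "\<And>a. a < r \<Longrightarrow> smsec W (f a)"
    "\<And>x. x \<in> W \<Longrightarrow> is_fibre_basis B r f x"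
    "\<And>x a b. x \<in> W \<Longrightarrow> a < r \<Longrightarrow> b < r \<Longrightarrow> form B x (f a x) (f b x) = (if a = b then \<epsilon> a else 0)"
    using orthonormal_frame[of x] by metis
  obtain U q where q: "(U, q) \<in> atlas B" "x \<in> U" using chart_exists by blast
  define \<kappa> where "\<kappa> = \<lparr>ac_dom = W \<inter> U, ac_chart = (U, q), ac_rank = r, ac_frame = f,
    ac_gram = (\<lambda>a b. if a = b then \<epsilon> a else 0)\<rparr>"
  have "\<kappa> \<in> adapted_charts B"
    unfolding adapted_charts_def \<kappa>_def using W q chart_open[OF q(1)] smsec_subset[OF W(3), of _ "W \<inter> U"] by auto
  moreover have "x \<in> ac_dom \<kappa>" using W(2) q(2) by (simp add: \<kappa>_def)
  ultimately show ?thesis by blast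
qed

text \<open>The coordinate functionals of any basis of a fibre are represented by the form.\<close>

lemma dual_vector:
  assumes e: "is_fibre_basis B r e x"
  obtains d where "d \<in> fibre B x" "\<And>v. v \<in> fibre B x \<Longrightarrow> form B x d v = coeff r e a x v"
proof -
  obtain W k f \<epsilon> where W: "x \<in> W" "\<And>x. x \<in> W \<Longrightarrow> is_fibre_basis B k f x"
    "\<And>a. a < k \<Longrightarrow> \<epsilon> a * \<epsilon> a = (1::real)"
    "\<And>x a b. x \<in> W \<Longrightarrow> a < k \<Longrightarrow> b < k \<Longrightarrow> form B x (f a x) (f b x) = (if a = b then \<epsilon> a else 0)"
    using orthonormal_frame[of x] by metis
  note f = W(2)[OF W(1)]
  note f_in = basis_in_fibre[OF f]
  define d where "d = (\<Sum>b<k. (\<epsilon> b * coeff r e a x (f b x)) *\<^sub>R f b x)"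
  have d: "d \<in> fibre B x" unfolding d_def using f_in by (intro fibre_sum fibre_scale) auto
  moreover have "form B x d v = coeff r e a x v" if v: "v \<in> fibre B x" for v
  proof -
    have df: "form B x d (f c x) = coeff r e a x (f c x)" if c: "c < k" for c
    proof -
      have "form B x d (f c x) = (\<Sum>b<k. (\<epsilon> b * coeff r e a x (f b x)) * form B x (f b x) (f c x))"
        unfolding d_def using f_in c by (intro form_sum_left) auto
      also have "\<dots> = (\<Sum>b<k. if b = c then coeff r e a x (f c x) else 0)"
        using W(4)[OF W(1) _ c] W(3)[OF c] by (intro sum.cong) auto
      finally show ?thesis using c by simp
    qed
    have "form B x d v = form B x d (\<Sum>c<k. coeff k f c x v *\<^sub>R f c x)"
      using basis_expand[OF f v] by simp
    also have "\<dots> = (\<Sum>c<k. coeff k f c x v * form B x d (f c x))"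
      using f_in d by (intro form_sum_right) auto
    also have "\<dots> = (\<Sum>c<k. coeff k f c x v * coeff r e a x (f c x))" using df by simp
    also have "\<dots> = coeff r e a x (\<Sum>c<k. coeff k f c x v *\<^sub>R f c x)"
      using f_in by (intro frame_coeff_sum[OF e, symmetric]) auto
    also have "\<dots> = coeff r e a x v" using basis_expand[OF f v] by simp
    finally show ?thesis .
  qed
  ultimately show thesis using that by blast
qed

lemma adapted_chart:
  assumes "\<kappa> \<in> adapted_charts B"
  shows "open (ac_dom \<kappa>)" "ac_chart \<kappa> \<in> atlas B" "ac_dom \<kappa> \<subseteq> fst (ac_chart \<kappa>)"
    "\<And>x. x \<in> ac_dom \<kappa> \<Longrightarrow> is_fibre_basis B (ac_rank \<kappa>) (ac_frame \<kappa>) x"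
    "\<And>a. a < ac_rank \<kappa> \<Longrightarrow> smsec (ac_dom \<kappa>) (ac_frame \<kappa> a)"
    "\<And>x a b. x \<in> ac_dom \<kappa> \<Longrightarrow> a < ac_rank \<kappa> \<Longrightarrow> b < ac_rank \<kappa> \<Longrightarrow>
      form B x (ac_frame \<kappa> a x) (ac_frame \<kappa> b x) = ac_gram \<kappa> a b"
  using assms unfolding adapted_charts_def by simp_all

text \<open>The matrix \<open>inv_gram \<kappa>\<close> has the entries \<open>\<langle>d\<^sub>a, d\<^sub>b\<rangle>\<close>, where \<open>d\<^sub>a\<close> represents the \<open>a\<close>-th coordinate
  functional; so it turns the components \<open>\<langle>v, e\<^sub>b\<rangle>\<close> of a vector into its coefficients.\<close>

lemma inv_gram:
  assumes \<kappa>: "\<kappa> \<in> adapted_charts B" and x: "x \<in> ac_dom \<kappa>"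
  shows coeff_inv_gram: "\<And>a v. a < ac_rank \<kappa> \<Longrightarrow> v \<in> fibre B x \<Longrightarrow>
      coeff (ac_rank \<kappa>) (ac_frame \<kappa>) a x v =
      (\<Sum>b<ac_rank \<kappa>. inv_gram \<kappa> a b * form B x v (ac_frame \<kappa> b x))"
    and inv_gram_sym: "inv_gram \<kappa> a b = inv_gram \<kappa> b a"
proof -
  define r where "r = ac_rank \<kappa>"
  define e where "e = ac_frame \<kappa>"
  have e: "is_fibre_basis B r e x" using adapted_chart(4)[OF \<kappa> x] by (simp add: r_def e_def)
  note e_in = basis_in_fibre[OF e]
  have gram: "form B x (e a x) (e b x) = ac_gram \<kappa> a b" if "a < r" "b < r" for a b
    using adapted_chart(6)[OF \<kappa> x] that by (simp add: r_def e_def)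
  have "\<forall>a. \<exists>d. d \<in> fibre B x \<and> (\<forall>v\<in>fibre B x. form B x d v = coeff r e a x v)"
    using dual_vector[OF e] by metis
  then obtain d where d: "\<And>a. d a \<in> fibre B x"
    "\<And>a v. v \<in> fibre B x \<Longrightarrow> form B x (d a) v = coeff r e a x v" by metis
  define H where "H a b = (if a < r \<and> b < r then coeff r e b x (d a) else 0)" for a b
  have H: "(\<Sum>b<r. H a b * ac_gram \<kappa> b c) = (if a = c then 1 else 0)" if a: "a < r" and c: "c < r" for a c
  proof -
    have "(\<Sum>b<r. H a b * ac_gram \<kappa> b c) = (\<Sum>b<r. coeff r e b x (d a) * form B x (e b x) (e c x))"
      using a c gram by (intro sum.cong) (auto simp: H_def)
    also have "\<dots> = form B x (\<Sum>b<r. coeff r e b x (d a) *\<^sub>R e b x) (e c x)"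
      using e_in c by (intro form_sum_left[symmetric]) auto
    also have "\<dots> = form B x (d a) (e c x)" using basis_expand[OF e d(1)] by simp
    also have "\<dots> = (if a = c then 1 else 0)" using d(2)[OF e_in[OF c]] frame_coeff_basis[OF e a c] by simp
    finally show ?thesis .
  qed
  have HI: "inv_gram \<kappa> = H"
    unfolding inv_gram_def r_def[symmetric]
  proof (rule the_equality)
    show "(\<forall>a b. \<not> (a < r \<and> b < r) \<longrightarrow> H a b = 0) \<and>
      (\<forall>a<r. \<forall>c<r. (\<Sum>b<r. H a b * ac_gram \<kappa> b c) = (if a = c then 1 else 0))"
      using H by (simp add: H_def)
    fix h assume h: "(\<forall>a b. \<not> (a < r \<and> b < r) \<longrightarrow> h a b = 0) \<and>
      (\<forall>a<r. \<forall>c<r. (\<Sum>b<r. h a b * ac_gram \<kappa> b c) = (if a = c then 1 else 0))"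
    have "h a b = H a b" if a: "a < r" and b: "b < r" for a b
    proof -
      define w where "w = (\<Sum>b<r. h a b *\<^sub>R e b x)"
      have w: "w \<in> fibre B x" unfolding w_def using e_in by (intro fibre_sum fibre_scale) auto
      have "w = d a"
      proof (rule form_basis_ext[OF e w d(1)])
        fix c assume c: "c < r"
        have "form B x w (e c x) = (\<Sum>b<r. h a b * form B x (e b x) (e c x))"
          unfolding w_def using e_in c by (intro form_sum_left) auto
        also have "\<dots> = (\<Sum>b<r. h a b * ac_gram \<kappa> b c)" using gram c by simp
        also have "\<dots> = (if a = c then 1 else 0)" using h a c by blast
        also have "\<dots> = form B x (d a) (e c x)" using d(2)[OF e_in[OF c]] frame_coeff_basis[OF e a c] by simp
        finally show "form B x w (e c x) = form B x (d a) (e c x)" .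
      qed
      moreover have "coeff r e b x w = (\<Sum>c<r. h a c * coeff r e b x (e c x))"
        unfolding w_def using e_in by (intro frame_coeff_sum[OF e]) auto
      moreover have "\<dots> = (\<Sum>c<r. if c = b then h a b else 0)"
        using frame_coeff_basis[OF e b] by (intro sum.cong) auto
      ultimately show ?thesis using a b by (simp add: H_def)
    qed
    moreover have "h a b = H a b" if "\<not> (a < r \<and> b < r)" for a b
      using h that unfolding H_def by auto
    ultimately show "h = H" by blast
  qed
  show "coeff (ac_rank \<kappa>) (ac_frame \<kappa>) a x v =
      (\<Sum>b<ac_rank \<kappa>. inv_gram \<kappa> a b * form B x v (ac_frame \<kappa> b x))"
    if "a < ac_rank \<kappa>" "v \<in> fibre B x" for a v
  proof -
    have a: "a < r" using that(1) by (simp add: r_def)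
    have "coeff r e a x v = form B x v (d a)" using d that(2) by (simp add: form_sym[of v])
    also have "\<dots> = form B x v (\<Sum>b<r. coeff r e b x (d a) *\<^sub>R e b x)" using basis_expand[OF e d(1)] by simp
    also have "\<dots> = (\<Sum>b<r. coeff r e b x (d a) * form B x v (e b x))"
      using e_in that by (intro form_sum_right) auto
    also have "\<dots> = (\<Sum>b<r. inv_gram \<kappa> a b * form B x v (e b x))"
      unfolding HI using a by (intro sum.cong) (auto simp: H_def)
    finally show ?thesis by (simp add: r_def e_def)
  qed
  have "coeff r e b x (d a) = coeff r e a x (d b)" for a b
    using d(2)[OF d(1), of a b] d(2)[OF d(1), of b a] form_sym[OF d(1) d(1)] by simp
  then show "inv_gram \<kappa> a b = inv_gram \<kappa> b a" unfolding HI H_def by auto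
qed

end

section \<open>Brackets of local functions\<close>

text \<open>At the point \<open>x\<close>, the local function \<open>F\<close> is homogeneous of degree \<open>k\<close>; the parameters \<open>n\<close> and \<open>r\<close> are the
  dimension of the manifold and the rank of the bundle.\<close>

definition homogeneous :: "nat \<Rightarrow> nat \<Rightarrow> nat \<Rightarrow> 'm lfun \<Rightarrow> 'm \<Rightarrow> bool" where
  "homogeneous n r k F x \<longleftrightarrow> (\<forall>m S. (m, S) \<notin> monomials n r k \<longrightarrow> F m S x = 0)"

lemma homogeneousD: "homogeneous n r k F x \<Longrightarrow> (m, S) \<notin> monomials n r k \<Longrightarrow> F m S x = 0"
  by (simp add: homogeneous_def)

lemma homogeneous_lmult:
  assumes "homogeneous n r j F x" "homogeneous n r k G x"
  shows "homogeneous n r (j + k) (lmult F G) x"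
  unfolding homogeneous_def
proof (intro allI impI)
  fix m S assume mS: "(m, S) \<notin> monomials n r (j + k)"
  have "F m1 S1 x * G (m - m1) (S - S1) x = 0" if "m1 \<subseteq># m" "S1 \<subseteq> S" for m1 S1
  proof (rule ccontr)
    assume "F m1 S1 x * G (m - m1) (S - S1) x \<noteq> 0"
    then have *: "(m1, S1) \<in> monomials n r j" "(m - m1, S - S1) \<in> monomials n r k"
      using assms homogeneousD by fastforce+
    have m: "m = m1 + (m - m1)" using that(1) by simp
    have "set_mset m = set_mset m1 \<union> set_mset (m - m1)" by (subst m) simp
    moreover have "size m = size m1 + size (m - m1)" by (subst m) (rule size_union)
    moreover have S: "S = S1 \<union> (S - S1)" using that(2) by auto
    moreover have "finite S1" "finite (S - S1)"
      using * finite_subset[of _ "{..<r}"] by (auto simp: monomials_def)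
    then have "card S = card S1 + card (S - S1)"
      by (subst S) (rule card_Un_disjoint; auto)
    ultimately have "(m, S) \<in> monomials n r (j + k)"
      using * by (auto simp: monomials_def)
    with mS show False ..
  qed
  then show "lmult F G m S x = 0"
    unfolding lmult_def by (intro sum.neutral ballI) (simp add: mult.assoc)
qed

lemma homogeneous_d_p:
  assumes "homogeneous n r (k + 2) F x"
  shows "homogeneous n r k (d_p i F) x"
  unfolding homogeneous_def d_p_def
  using homogeneousD[OF assms] by (auto simp: monomials_def)

lemma monomials_insert:
  "(m, insert a S) \<in> monomials n r (k + 1) \<Longrightarrow> a \<notin> S \<Longrightarrow> (m, S) \<in> monomials n r k"
  using finite_subset[of S "{..<r}"] by (auto simp: monomials_def)

lemma homogeneous_d_tau_left:
  assumes "homogeneous n r (k + 1) F x"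
  shows "homogeneous n r k (d_tau_left a F) x"
  unfolding homogeneous_def d_tau_left_def
  using homogeneousD[OF assms] monomials_insert by (metis mult_zero_right)

lemma homogeneous_d_tau_right:
  assumes "homogeneous n r (k + 1) F x"
  shows "homogeneous n r k (d_tau_right a F) x"
  unfolding homogeneous_def d_tau_right_def
  using homogeneousD[OF assms] monomials_insert by (metis mult_zero_right)

subsection \<open>Coefficients of products\<close>

lemma shuffle_sign_empty [simp]: "shuffle_sign {} T = 1" "shuffle_sign S {} = 1"
  by (simp_all add: shuffle_sign_def)

lemma shuffle_sign_singletons:
  "shuffle_sign {a} {b} = (if b < a then -1 else 1)"
proof -
  have "{(s, t). s \<in> {a} \<and> t \<in> {b} \<and> t < s} = (if b < a then {(a, b)} else {})" by auto
  then show ?thesis by (simp add: shuffle_sign_def)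
qed

lemma lmult_no_p:
  "lmult F G {#} S x = (\<Sum>S1\<in>Pow S. shuffle_sign S1 (S - S1) * F {#} S1 x * G {#} (S - S1) x)"
  by (simp add: lmult_def)

lemma lmult_no_p_empty: "lmult F G {#} {} x = F {#} {} x * G {#} {} x"
  by (simp add: lmult_no_p)

lemma lmult_no_p_single:
  "lmult F G {#} {c} x = F {#} {} x * G {#} {c} x + F {#} {c} x * G {#} {} x"
  by (simp add: lmult_no_p Pow_insert)

lemma lmult_no_p_pair:
  assumes "a \<noteq> c"
  shows "lmult F G {#} {a, c} x = F {#} {} x * G {#} {a, c} x + F {#} {a, c} x * G {#} {} x +
    (if c < a then -1 else 1) * (F {#} {a} x * G {#} {c} x - F {#} {c} x * G {#} {a} x)"
proof -
  have P: "Pow {a, c} = {{}, {a}, {c}, {a, c}}" by (auto simp: Pow_insert)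
  have d: "{a, c} - {a} = {c}" "{a, c} - {c} = {a}" using assms by auto
  have n: "{a} \<noteq> {c}" "{a} \<noteq> {a, c}" "{c} \<noteq> {a, c}" using assms by auto
  show ?thesis
    unfolding lmult_no_p P using assms n by (auto simp: d shuffle_sign_singletons)
qed

lemma submultiset_single: "{m1. m1 \<subseteq># {#i#}} = {{#}, {#i#}}"
proof -
  have "m1 = {#} \<or> m1 = {#i#}" if "m1 \<subseteq># {#i#}" for m1
  proof (cases m1)
    case (add y m')
    have "size m1 \<le> 1" using size_mset_mono[OF that] by simp
    moreover have "y = i" using mset_subset_eqD[OF that, of y] add by simp
    ultimately show ?thesis using add by simp
  qed simp
  then show ?thesis by auto
qed

lemma lmult_p_empty:
  "lmult F G {#i#} {} x = F {#} {} x * G {#i#} {} x + F {#i#} {} x * G {#} {} x"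
  by (simp add: lmult_def submultiset_single)

lemma lmult_p_single:
  "lmult F G {#i#} {c} x = F {#} {} x * G {#i#} {c} x + F {#} {c} x * G {#i#} {} x +
    F {#i#} {} x * G {#} {c} x + F {#i#} {c} x * G {#} {} x"
  by (simp add: lmult_def submultiset_single Pow_insert)

lemma lmult_zero_left: "(\<And>m S. F m S x = 0) \<Longrightarrow> lmult F G m S x = 0"
  by (simp add: lmult_def)

lemma lmult_zero_right: "(\<And>m S. G m S x = 0) \<Longrightarrow> lmult F G m S x = 0"
  by (simp add: lmult_def)

lemma card_less_pair:
  "p \<noteq> q \<Longrightarrow> card {s. (s = p \<or> s = q) \<and> s < (t::nat)} = (if p < t then 1 else 0) + (if q < t then 1 else 0)"
proof -
  assume "p \<noteq> q"
  moreover have "{s. (s = p \<or> s = q) \<and> s < t} = (if p < t then {p} else {}) \<union> (if q < t then {q} else {})" by auto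
  ultimately show ?thesis by auto
qed

lemma card_greater_single: "card {s. s = p \<and> (t::nat) < s} = (if t < p then 1 else 0)"
proof -
  have "{s. s = p \<and> t < s} = (if t < p then {p} else {})" by auto
  then show ?thesis by auto
qed

lemma card_less_single: "card {s. s = p \<and> s < (t::nat)} = (if p < t then 1 else 0)"
proof -
  have "{s. s = p \<and> s < t} = (if p < t then {p} else {})" by auto
  then show ?thesis by auto
qed

text \<open>The components of the cubic part, as a skew-symmetric function of three indices.\<close>

lemma cubic_coeff:
  "d_tau_right b (d_tau_left a F) {#} {c} x =
    (if b = c \<or> a = b \<or> a = c then 0 else
      (if b < c then -1 else 1) * (if b < a then -1 else 1) * (if c < a then -1 else 1) * F {#} {a, b, c} x)"
  using card_less_pair[of b c a] by (auto simp: d_tau_right_def d_tau_left_def card_greater_single)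

lemma d_tau_swap:
  "d_tau_right b (d_tau_left a F) {#} {c} x = - d_tau_right a (d_tau_left b F) {#} {c} x"
  "d_tau_right b (d_tau_left a F) {#} {c} x = - d_tau_right c (d_tau_left a F) {#} {b} x"
proof -
  have perm: "{b, a, c} = {a, b, c}" "{a, c, b} = {a, b, c}" by auto
  show "d_tau_right b (d_tau_left a F) {#} {c} x = - d_tau_right a (d_tau_left b F) {#} {c} x"
    unfolding cubic_coeff perm by auto
  show "d_tau_right b (d_tau_left a F) {#} {c} x = - d_tau_right c (d_tau_left a F) {#} {b} x"
    unfolding cubic_coeff perm by auto
qed

subsection \<open>The bracket with sections\<close>

lemma section_fun_single:
  "c < ac_rank \<kappa> \<Longrightarrow> section_fun B u \<kappa> {#} {c} = (\<lambda>x. form B x (u x) (ac_frame \<kappa> c x))"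
proof
  fix x assume "c < ac_rank \<kappa>"
  have "section_fun B u \<kappa> {#} {c} x =
      (\<Sum>a<ac_rank \<kappa>. if a = c then form B x (u x) (ac_frame \<kappa> c x) else 0)"
    unfolding section_fun_def ltau_def by (intro sum.cong) auto
  then show "section_fun B u \<kappa> {#} {c} x = form B x (u x) (ac_frame \<kappa> c x)"
    using \<open>c < ac_rank \<kappa>\<close> by simp
qed

lemma monomials_1: "(m, S) \<in> monomials n r 1 \<longleftrightarrow> m = {#} \<and> (\<exists>c<r. S = {c})"
proof -
  have "2 * size m + card S = 1 \<longleftrightarrow> size m = 0 \<and> card S = 1" by arith
  then show ?thesis by (auto simp: monomials_def card_1_singleton_iff)
qed

lemma section_fun_zero:
  "(m, S) \<notin> monomials n (ac_rank \<kappa>) 1 \<Longrightarrow> section_fun B u \<kappa> m S = (\<lambda>x. 0)"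
  by (auto simp: section_fun_def ltau_def monomials_1 fun_eq_iff simp del: One_nat_def intro!: sum.neutral)

lemma homogeneous_section_fun: "homogeneous n (ac_rank \<kappa>) 1 (section_fun B u \<kappa>) x"
  by (simp add: homogeneous_def section_fun_zero)

lemma homogeneous_d_q_section_fun: "homogeneous n (ac_rank \<kappa>) 1 (d_q \<kappa> i (section_fun B u \<kappa>)) x"
  by (cases "ac_chart \<kappa>") (auto simp: homogeneous_def section_fun_zero d_q_def intro: partial_eqI)

lemma d_q_section_fun:
  "c < ac_rank \<kappa> \<Longrightarrow> d_q \<kappa> i (section_fun B u \<kappa>) {#} {c} x =
    chart_deriv (ac_chart \<kappa>) i (\<lambda>x. form B x (u x) (ac_frame \<kappa> c x)) x"
  by (simp add: d_q_def section_fun_single)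

lemma d_p_section_fun: "d_p i (section_fun B u \<kappa>) m S x = 0"
proof -
  have "(add_mset i m, S) \<notin> monomials 0 (ac_rank \<kappa>) 1" by (simp add: monomials_1 del: One_nat_def)
  then show ?thesis using section_fun_zero[of "add_mset i m" S 0 \<kappa> B u] by (simp add: d_p_def)
qed

lemma homogeneous_d_tau_section_fun:
  "homogeneous n (ac_rank \<kappa>) 0 (d_tau_left b (section_fun B u \<kappa>)) x"
  "homogeneous n (ac_rank \<kappa>) 0 (d_tau_right b (section_fun B u \<kappa>)) x"
  using homogeneous_section_fun[of n \<kappa> B u x]
  by (auto intro: homogeneous_d_tau_left homogeneous_d_tau_right)

lemma d_tau_section_fun:
  assumes "b < ac_rank \<kappa>"
  shows "d_tau_left b (section_fun B u \<kappa>) {#} {} x = form B x (u x) (ac_frame \<kappa> b x)"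
    "d_tau_right b (section_fun B u \<kappa>) {#} {} x = form B x (u x) (ac_frame \<kappa> b x)"
  using assms by (simp_all add: d_tau_left_def d_tau_right_def section_fun_single)

lemma homogeneous_bracket_section:
  assumes "homogeneous n (ac_rank \<kappa>) (k + 2) F x"
  shows "homogeneous n (ac_rank \<kappa>) (k + 1) (poisson n \<kappa> (section_fun B u \<kappa>) F) x"
  unfolding homogeneous_def poisson_def
proof (intro allI impI)
  fix m S assume mS: "(m, S) \<notin> monomials n (ac_rank \<kappa>) (k + 1)"
  have "lmult (d_q \<kappa> i (section_fun B u \<kappa>)) (d_p i F) m S x = 0" for i
    using homogeneousD[OF homogeneous_lmult[OF homogeneous_d_q_section_fun homogeneous_d_p[OF assms]]] mS
    by (simp add: add.commute)
  moreover have "lmult (d_tau_right a (section_fun B u \<kappa>)) (d_tau_left b F) m S x = 0" for a b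
    using homogeneousD[OF homogeneous_lmult[OF homogeneous_d_tau_section_fun(2)
          homogeneous_d_tau_left[of n "ac_rank \<kappa>" "k + 1" F x]]] assms mS
    by simp
  ultimately show "(\<Sum>i<n. lmult (d_q \<kappa> i (section_fun B u \<kappa>)) (d_p i F) m S x -
        lmult (d_p i (section_fun B u \<kappa>)) (d_q \<kappa> i F) m S x) +
      (\<Sum>a<ac_rank \<kappa>. \<Sum>b<ac_rank \<kappa>. inv_gram \<kappa> a b *
        lmult (d_tau_right a (section_fun B u \<kappa>)) (d_tau_left b F) m S x) = 0"
    by (simp add: lmult_zero_left d_p_section_fun)
qed

lemma homogeneous_section_bracket:
  assumes "homogeneous n (ac_rank \<kappa>) (k + 2) F x"
  shows "homogeneous n (ac_rank \<kappa>) (k + 1) (poisson n \<kappa> F (section_fun B u \<kappa>)) x"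
  unfolding homogeneous_def poisson_def
proof (intro allI impI)
  fix m S assume mS: "(m, S) \<notin> monomials n (ac_rank \<kappa>) (k + 1)"
  have "lmult (d_p i F) (d_q \<kappa> i (section_fun B u \<kappa>)) m S x = 0" for i
    using homogeneousD[OF homogeneous_lmult[OF homogeneous_d_p[OF assms] homogeneous_d_q_section_fun]] mS
    by simp
  moreover have "lmult (d_tau_right a F) (d_tau_left b (section_fun B u \<kappa>)) m S x = 0" for a b
    using homogeneousD[OF homogeneous_lmult[OF homogeneous_d_tau_right[of n "ac_rank \<kappa>" "k + 1" F x]
      homogeneous_d_tau_section_fun(1)]] assms mS
    by simp
  ultimately show "(\<Sum>i<n. lmult (d_q \<kappa> i F) (d_p i (section_fun B u \<kappa>)) m S x -
        lmult (d_p i F) (d_q \<kappa> i (section_fun B u \<kappa>)) m S x) +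
      (\<Sum>a<ac_rank \<kappa>. \<Sum>b<ac_rank \<kappa>. inv_gram \<kappa> a b *
        lmult (d_tau_right a F) (d_tau_left b (section_fun B u \<kappa>)) m S x) = 0"
    by (simp add: lmult_zero_right d_p_section_fun)
qed

lemma not_monomials_1:
  "({#}, {}) \<notin> monomials n r 1" "({#i#}, S) \<notin> monomials n r 1" "({#}, {}) \<notin> monomials n r 2"
  "a \<noteq> c \<Longrightarrow> ({#}, {a, c}) \<notin> monomials n r 1"
  "({#i#}, S) \<notin> monomials n r 0" "a \<noteq> c \<Longrightarrow> ({#}, {a, c}) \<notin> monomials n r 0"
  "({#}, {c}) \<notin> monomials n r 0" "({#}, {c}) \<notin> monomials n r 2"
  by (auto simp: monomials_def)

text \<open>The derived bracket \<open>{{u, \<Theta>}, v}\<close> in adapted coordinates, in terms of the coefficients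
  \<open>A\<^sub>i\<^sub>b\<close> of \<open>p\<^sub>i \<tau>\<^sup>b\<close> and \<open>C\<^sub>a\<^sub>b\<^sub>c\<close> of the cubic part of \<open>\<Theta>\<close>.\<close>

lemma derived_bracket_coeff:
  fixes B :: "('m, 'v) metric_bundle" and \<kappa> :: "('m, 'v) adapted_chart" and u v :: "'m \<Rightarrow> 'v"
    and F :: "'m lfun"
  assumes F: "homogeneous n (ac_rank \<kappa>) 3 F x" and c: "c < ac_rank \<kappa>"
  defines "r \<equiv> ac_rank \<kappa>"
  defines "h \<equiv> inv_gram \<kappa>"
  defines "u' \<equiv> \<lambda>b. \<Sum>a<r. h a b * form B x (u x) (ac_frame \<kappa> a x)"
  defines "v' \<equiv> \<lambda>a. \<Sum>b<r. h a b * form B x (v x) (ac_frame \<kappa> b x)"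
  defines "du \<equiv> \<lambda>i c. chart_deriv (ac_chart \<kappa>) i (\<lambda>x. form B x (u x) (ac_frame \<kappa> c x)) x"
  defines "dv \<equiv> \<lambda>i c. chart_deriv (ac_chart \<kappa>) i (\<lambda>x. form B x (v x) (ac_frame \<kappa> c x)) x"
  shows "poisson n \<kappa> (poisson n \<kappa> (section_fun B u \<kappa>) F) (section_fun B v \<kappa>) {#} {c} x =
    - (\<Sum>i<n. (\<Sum>b<r. u' b * F {#i#} {b} x) * dv i c) +
    (\<Sum>a<r. v' a * ((\<Sum>i<n. du i c * F {#i#} {a} x - du i a * F {#i#} {c} x) +
      (\<Sum>b<r. u' b * d_tau_right a (d_tau_left b F) {#} {c} x)))"
proof -
  define U where "U = section_fun B u \<kappa>"
  define V where "V = section_fun B v \<kappa>"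
  define G where "G = poisson n \<kappa> U F"
  note U0 = homogeneousD[OF homogeneous_d_q_section_fun[of n \<kappa> _ B u x, folded U_def]]
  note V0 = homogeneousD[OF homogeneous_d_q_section_fun[of n \<kappa> _ B v x, folded V_def]]
  note Ur0 = homogeneousD[OF homogeneous_d_tau_section_fun(2)[of n \<kappa> _ B u x, folded U_def]]
  note Vl0 = homogeneousD[OF homogeneous_d_tau_section_fun(1)[of n \<kappa> _ B v x, folded V_def]]
  have G2: "homogeneous n r 2 G x"
    using homogeneous_bracket_section[of n \<kappa> 1 F x B u] F by (simp add: G_def U_def r_def numeral_eq_Suc)
  note G0 = homogeneousD[OF G2]
  have swap: "(\<Sum>a<r. \<Sum>b<r. h a b * (form B x (u x) (ac_frame \<kappa> a x) * f b)) = (\<Sum>b<r. u' b * f b)" for f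
    unfolding u'_def by (subst sum.swap) (simp add: sum_distrib_right mult.assoc)
  have Gp: "G {#i#} {} x = (\<Sum>b<r. u' b * F {#i#} {b} x)" for i
  proof -
    have "lmult (d_tau_right a U) (d_tau_left b F) {#i#} {} x = form B x (u x) (ac_frame \<kappa> a x) * F {#i#} {b} x"
      if "a < r" for a b
      using that by (simp add: lmult_p_empty Ur0 not_monomials_1)
        (simp add: d_tau_left_def U_def d_tau_section_fun r_def)
    moreover have "lmult (d_q \<kappa> j U) (d_p j F) {#i#} {} x = 0" for j
      by (simp add: lmult_p_empty U0 not_monomials_1 del: One_nat_def)
    moreover have "lmult (d_p j U) (d_q \<kappa> j F) {#i#} {} x = 0" for j
      by (rule lmult_zero_left) (simp add: U_def d_p_section_fun)
    ultimately have "G {#i#} {} x = (\<Sum>a<r. \<Sum>b<r. h a b * (form B x (u x) (ac_frame \<kappa> a x) * F {#i#} {b} x))"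
      by (simp add: G_def poisson_def r_def h_def)
    then show ?thesis by (simp add: swap)
  qed
  have Gt: "G {#} {a, c} x = (if c < a then -1 else 1) * (\<Sum>i<n. du i a * F {#i#} {c} x - du i c * F {#i#} {a} x) +
      (\<Sum>b<r. u' b * d_tau_left b F {#} {a, c} x)" if a: "a < r" "a \<noteq> c" for a
  proof -
    have "lmult (d_tau_right a' U) (d_tau_left b F) {#} {a, c} x =
        form B x (u x) (ac_frame \<kappa> a' x) * d_tau_left b F {#} {a, c} x" if "a' < r" for a' b
      using that a by (simp add: lmult_no_p_pair Ur0 not_monomials_1)
        (simp add: U_def d_tau_section_fun r_def)
    moreover have "lmult (d_q \<kappa> i U) (d_p i F) {#} {a, c} x =
        (if c < a then -1 else 1) * (du i a * F {#i#} {c} x - du i c * F {#i#} {a} x)" for i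
      using a c by (simp add: lmult_no_p_pair U0 not_monomials_1 del: One_nat_def)
        (simp add: d_p_def U_def d_q_section_fun r_def du_def)
    moreover have "lmult (d_p j U) (d_q \<kappa> j F) {#} {a, c} x = 0" for j
      by (rule lmult_zero_left) (simp add: U_def d_p_section_fun)
    ultimately have "G {#} {a, c} x = (\<Sum>i<n. (if c < a then -1 else 1) * (du i a * F {#i#} {c} x - du i c * F {#i#} {a} x)) +
        (\<Sum>a'<r. \<Sum>b<r. h a' b * (form B x (u x) (ac_frame \<kappa> a' x) * d_tau_left b F {#} {a, c} x))"
      by (simp add: G_def poisson_def r_def h_def)
    then show ?thesis by (simp only: swap sum_distrib_left)
  qed
  have RG: "d_tau_right a G {#} {c} x = (\<Sum>i<n. du i c * F {#i#} {a} x - du i a * F {#i#} {c} x) +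
      (\<Sum>b<r. u' b * d_tau_right a (d_tau_left b F) {#} {c} x)" if a: "a < r" for a
  proof (cases "a = c")
    case True
    then show ?thesis by (simp add: d_tau_right_def)
  next
    case False
    have "(\<Sum>i<n. du i c * F {#i#} {a} x - du i a * F {#i#} {c} x) =
        - (\<Sum>i<n. du i a * F {#i#} {c} x - du i c * F {#i#} {a} x)"
      by (simp add: sum_negf[symmetric])
    moreover have "d_tau_right a (d_tau_left b F) {#} {c} x = (if a < c then -1 else 1) * d_tau_left b F {#} {a, c} x" for b
      using False by (simp add: d_tau_right_def[of a] card_greater_single)
    moreover have "d_tau_right a G {#} {c} x = (if a < c then -1 else 1) * G {#} {a, c} x"
      using False by (simp add: d_tau_right_def card_greater_single)
    ultimately show ?thesis
      unfolding Gt[OF a False] using False by (auto simp: sum_negf)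
  qed
  have "lmult (d_p i G) (d_q \<kappa> i V) {#} {c} x = (\<Sum>b<r. u' b * F {#i#} {b} x) * dv i c" for i
  proof -
    have "d_p i G {#} {} x = (\<Sum>b<r. u' b * F {#i#} {b} x)" by (simp add: d_p_def Gp)
    then show ?thesis
      using c by (simp add: lmult_no_p_single V0 not_monomials_1 del: One_nat_def) (simp add: V_def d_q_section_fun dv_def)
  qed
  moreover have "lmult (d_q \<kappa> i G) (d_p i V) {#} {c} x = 0" for i
    by (rule lmult_zero_right) (simp add: V_def d_p_section_fun)
  moreover have "lmult (d_tau_right a G) (d_tau_left b V) {#} {c} x =
      d_tau_right a G {#} {c} x * form B x (v x) (ac_frame \<kappa> b x)" if "b < r" for a b
    using that by (simp add: lmult_no_p_single Vl0 not_monomials_1) (simp add: V_def d_tau_section_fun r_def)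
  ultimately have "poisson n \<kappa> G V {#} {c} x =
      - (\<Sum>i<n. (\<Sum>b<r. u' b * F {#i#} {b} x) * dv i c) +
      (\<Sum>a<r. \<Sum>b<r. h a b * (d_tau_right a G {#} {c} x * form B x (v x) (ac_frame \<kappa> b x)))"
    by (simp add: poisson_def r_def h_def sum_negf)
  also have "(\<Sum>a<r. \<Sum>b<r. h a b * (d_tau_right a G {#} {c} x * form B x (v x) (ac_frame \<kappa> b x))) =
      (\<Sum>a<r. v' a * d_tau_right a G {#} {c} x)"
    unfolding v'_def by (simp add: sum_distrib_right sum_distrib_left mult_ac)
  also have "\<dots> = (\<Sum>a<r. v' a * ((\<Sum>i<n. du i c * F {#i#} {a} x - du i a * F {#i#} {c} x) +
      (\<Sum>b<r. u' b * d_tau_right a (d_tau_left b F) {#} {c} x)))"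
    using RG by simp
  finally show ?thesis by (simp add: G_def U_def V_def)
qed

section \<open>Change of adapted coordinates\<close>

subsection \<open>Cubic polynomials in the odd coordinates\<close>

lemma sorted_list_of_set_3: "d < e \<Longrightarrow> e < f \<Longrightarrow> sorted_list_of_set {d, e, f :: nat} = [d, e, f]"
  using sorted_list_of_set.idem_if_sorted_distinct[of "[d, e, f]"] by auto

lemma card_3_sorted:
  assumes "card (S :: nat set) = 3"
  obtains d e f where "d < e" "e < f" "S = {d, e, f}"
proof -
  have fin: "finite S" using assms card_ge_0_finite by force
  have "\<exists>d e f. xs = [d, e, f]" if "length xs = 3" for xs :: "nat list"
    using that by (auto simp: numeral_3_eq_3 length_Suc_conv)
  then obtain d e f where l: "sorted_list_of_set S = [d, e, f]"
    using assms by fastforce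
  have "S = {d, e, f}" using set_sorted_list_of_set[OF fin] unfolding l by auto
  moreover have "d < e \<and> e < f"
  proof -
    have "sorted (sorted_list_of_set S)" "distinct (sorted_list_of_set S)" by simp_all
    then show ?thesis unfolding l by auto
  qed
  ultimately show thesis using that by blast
qed

text \<open>The determinant with columns \<open>u\<close>, \<open>v\<close>, \<open>w\<close> and rows \<open>d\<close>, \<open>e\<close>, \<open>f\<close>.\<close>

definition det3 :: "(nat \<Rightarrow> real) \<Rightarrow> (nat \<Rightarrow> real) \<Rightarrow> (nat \<Rightarrow> real) \<Rightarrow> nat \<Rightarrow> nat \<Rightarrow> nat \<Rightarrow> real" where
  "det3 u v w d e f = u d * (v e * w f - v f * w e) - u e * (v d * w f - v f * w d) + u f * (v d * w e - v e * w d)"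

text \<open>The full contraction of the cubic part, as a sum over ordered triples and over subsets.\<close>

lemma cubic_contraction:
  fixes F :: "'m lfun"
  shows "(\<Sum>a<r. \<Sum>b<r. \<Sum>c<r. u a * v b * w c * d_tau_right b (d_tau_left a F) {#} {c} x) =
    - (\<Sum>S\<in>{S. S \<subseteq> {..<r} \<and> card S = 3}. F {#} S x *
        (case sorted_list_of_set S of [d, e, f] \<Rightarrow> det3 u v w d e f))"
proof -
  let ?C = "\<lambda>(a, b, c). u a * v b * w c * d_tau_right b (d_tau_left a F) {#} {c} x"
  let ?R = "{..<r} \<times> {..<r} \<times> {..<r}"
  let ?D = "{(a, b, c). a < r \<and> b < r \<and> c < r \<and> a \<noteq> b \<and> a \<noteq> c \<and> b \<noteq> c}"
  let ?T = "{S. S \<subseteq> {..<r} \<and> card S = 3}"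
  let ?g = "\<lambda>(a, b, c). {a, b, c :: nat}"
  have finD: "finite ?D" by (rule finite_subset[of _ ?R]) auto
  have finT: "finite ?T" by (rule finite_subset[of _ "Pow {..<r}"]) auto
  have "(\<Sum>a<r. \<Sum>b<r. \<Sum>c<r. u a * v b * w c * d_tau_right b (d_tau_left a F) {#} {c} x) = sum ?C ?R"
    by (simp add: sum.cartesian_product)
  also have "\<dots> = sum ?C ?D"
    by (rule sum.mono_neutral_right) (auto simp: cubic_coeff)
  also have "\<dots> = (\<Sum>S\<in>?T. sum ?C {t \<in> ?D. ?g t = S})"
    by (rule sum.group[symmetric, OF finD finT]) auto
  also have "\<dots> = (\<Sum>S\<in>?T. - (F {#} S x * (case sorted_list_of_set S of [d, e, f] \<Rightarrow> det3 u v w d e f)))"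
  proof (rule sum.cong[OF refl])
    fix S assume S: "S \<in> ?T"
    then obtain d e f where *: "d < e" "e < f" "S = {d, e, f}" using card_3_sorted[of S] by blast
    have l: "sorted_list_of_set S = [d, e, f]"
      unfolding *(3) using *(1,2) by (rule sorted_list_of_set_3)
    have "{t \<in> ?D. ?g t = S} = {(d, e, f), (d, f, e), (e, d, f), (e, f, d), (f, d, e), (f, e, d)}"
    proof (rule set_eqI)
      fix t :: "nat \<times> nat \<times> nat"
      obtain a b c where t: "t = (a, b, c)" by (cases t)
      have "(a \<noteq> b \<and> a \<noteq> c \<and> b \<noteq> c \<and> {a, b, c} = {d, e, f}) \<longleftrightarrow>
        (a, b, c) \<in> {(d, e, f), (d, f, e), (e, d, f), (e, f, d), (f, d, e), (f, e, d)}"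
      proof
        assume A: "a \<noteq> b \<and> a \<noteq> c \<and> b \<noteq> c \<and> {a, b, c} = {d, e, f}"
        then have "a \<in> {d, e, f}" "b \<in> {d, e, f}" "c \<in> {d, e, f}" by blast+
        with A show "(a, b, c) \<in> {(d, e, f), (d, f, e), (e, d, f), (e, f, d), (f, d, e), (f, e, d)}"
          by auto
      next
        assume "(a, b, c) \<in> {(d, e, f), (d, f, e), (e, d, f), (e, f, d), (f, d, e), (f, e, d)}"
        then show "a \<noteq> b \<and> a \<noteq> c \<and> b \<noteq> c \<and> {a, b, c} = {d, e, f}"
          using *(1,2) by auto
      qed
      moreover have "a < r \<and> b < r \<and> c < r" if "{a, b, c} = {d, e, f}"
        using S *(3) that by (metis (no_types, lifting) insertI1 insertCI lessThan_iff mem_Collect_eq subsetD)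
      moreover have "t \<in> {t \<in> ?D. ?g t = S} \<longleftrightarrow>
        (a < r \<and> b < r \<and> c < r) \<and> (a \<noteq> b \<and> a \<noteq> c \<and> b \<noteq> c \<and> {a, b, c} = {d, e, f})"
        unfolding t *(3) by simp
      ultimately show "t \<in> {t \<in> ?D. ?g t = S} \<longleftrightarrow>
        t \<in> {(d, e, f), (d, f, e), (e, d, f), (e, f, d), (f, d, e), (f, e, d)}"
        unfolding t by argo
    qed
    moreover have "{d, f, e} = S" "{e, d, f} = S" "{e, f, d} = S" "{f, d, e} = S" "{f, e, d} = S" "{d, e, f} = S"
      using *(3) by auto
    ultimately have "sum ?C {t \<in> ?D. ?g t = S} = - F {#} S x * det3 u v w d e f"
      using *(1,2) by (simp add: cubic_coeff det3_def algebra_simps)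
    then show "sum ?C {t \<in> ?D. ?g t = S} = - (F {#} S x * (case sorted_list_of_set S of [d, e, f] \<Rightarrow> det3 u v w d e f))"
      by (simp add: l)
  qed
  finally show ?thesis by (simp add: sum_negf)
qed

lemma not_monomials_2:
  "({#}, {}) \<notin> monomials n r 2" "({#}, {c}) \<notin> monomials n r 2"
  "({#i#}, {c}) \<notin> monomials n r 2"
  "a \<noteq> b \<Longrightarrow> a \<noteq> c \<Longrightarrow> b \<noteq> c \<Longrightarrow> ({#}, {a, b, c}) \<notin> monomials n r 2"
  "a \<noteq> b \<Longrightarrow> a \<noteq> c \<Longrightarrow> b \<noteq> c \<Longrightarrow> ({#}, {a, b, c}) \<notin> monomials n r 1"
  by (auto simp: monomials_def)

lemma shuffle_sign_1_2:
  assumes "b \<noteq> c"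
  shows "shuffle_sign {a} {b, c} = (if b < a then -1 else 1) * (if c < a then -1 else 1)"
proof -
  have "{(s, t). s \<in> {a} \<and> t \<in> {b, c} \<and> t < s} = (if b < a then {(a, b)} else {}) \<union> (if c < a then {(a, c)} else {})"
    by auto
  then show ?thesis using assms by (auto simp: shuffle_sign_def)
qed

lemma shuffle_sign_2_1:
  assumes "b \<noteq> c"
  shows "shuffle_sign {b, c} {a} = (if a < b then -1 else 1) * (if a < c then -1 else 1)"
proof -
  have "{(s, t). s \<in> {b, c} \<and> t \<in> {a} \<and> t < s} = (if a < b then {(b, a)} else {}) \<union> (if a < c then {(c, a)} else {})"
    by auto
  then show ?thesis using assms by (auto simp: shuffle_sign_def)
qed

lemma sum_Pow_insert:
  fixes f :: "'a set \<Rightarrow> real"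
  assumes "finite T" "a \<notin> T"
  shows "sum f (Pow (insert a T)) = sum f (Pow T) + (\<Sum>S\<in>Pow T. f (insert a S))"
proof -
  have "inj_on (insert a) (Pow T)" using assms(2) by (auto simp: inj_on_def)
  moreover have "Pow T \<inter> insert a ` Pow T = {}" using assms(2) by auto
  ultimately show ?thesis
    using assms(1) unfolding Pow_insert by (subst sum.union_disjoint) (auto simp: sum.reindex)
qed

lemma lmult_no_p_triple:
  assumes "a \<noteq> b" "a \<noteq> c" "b \<noteq> c"
  shows "lmult F G {#} {a, b, c} x =
    F {#} {} x * G {#} {a, b, c} x + F {#} {a, b, c} x * G {#} {} x +
    shuffle_sign {a} {b, c} * F {#} {a} x * G {#} {b, c} x +
    shuffle_sign {b} {a, c} * F {#} {b} x * G {#} {a, c} x +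
    shuffle_sign {c} {a, b} * F {#} {c} x * G {#} {a, b} x +
    shuffle_sign {b, c} {a} * F {#} {b, c} x * G {#} {a} x +
    shuffle_sign {a, c} {b} * F {#} {a, c} x * G {#} {b} x +
    shuffle_sign {a, b} {c} * F {#} {a, b} x * G {#} {c} x"
proof -
  have d: "{a, b, c} - {a} = {b, c}" "{a, b, c} - {b} = {a, c}" "{a, b, c} - {c} = {a, b}"
    "{a, b, c} - {b, c} = {a}" "{a, b, c} - {a, c} = {b}" "{a, b, c} - {a, b} = {c}"
    using assms by auto
  have "sum f (Pow {a, b, c}) =
     f {} + f {a} + f {b} + f {c} + f {b, c} + f {a, c} + f {a, b} + f {a, b, c}" for f :: "nat set \<Rightarrow> real"
    using assms by (simp add: sum_Pow_insert)
  then show ?thesis unfolding lmult_no_p by (simp add: d)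
qed

lemma d_tau_left_pair: "d_tau_left a P {#} {b} x = (if a = b then 0 else (if b < a then -1 else 1) * P {#} {a, b} x)"
  by (simp add: d_tau_left_def card_less_single)

text \<open>The cubic part of a product of a quadratic and a linear function, in either order: a quadratic function
  is even. The skew-symmetric components of \<open>P\<close> are \<open>d_tau_left a P {#} {b}\<close>.\<close>

lemma cubic_quadratic_linear:
  assumes P: "homogeneous n r 2 P x" and l: "homogeneous n r 1 l x"
  shows "d_tau_right b (d_tau_left a (lmult P l)) {#} {c} x =
      - (d_tau_left a P {#} {b} x * l {#} {c} x - d_tau_left a P {#} {c} x * l {#} {b} x +
         d_tau_left b P {#} {c} x * l {#} {a} x)"
    "d_tau_right b (d_tau_left a (lmult l P)) {#} {c} x =
      - (d_tau_left a P {#} {b} x * l {#} {c} x - d_tau_left a P {#} {c} x * l {#} {b} x +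
         d_tau_left b P {#} {c} x * l {#} {a} x)"
proof -
  note P0 = homogeneousD[OF P] and l0 = homogeneousD[OF l]
  have sw: "{b, a} = {a, b}" "{c, a} = {a, c}" "{c, b} = {b, c}" by auto
  have "d_tau_right b (d_tau_left a (lmult P l)) {#} {c} x =
      - (d_tau_left a P {#} {b} x * l {#} {c} x - d_tau_left a P {#} {c} x * l {#} {b} x +
         d_tau_left b P {#} {c} x * l {#} {a} x) \<and>
    d_tau_right b (d_tau_left a (lmult l P)) {#} {c} x =
      - (d_tau_left a P {#} {b} x * l {#} {c} x - d_tau_left a P {#} {c} x * l {#} {b} x +
         d_tau_left b P {#} {c} x * l {#} {a} x)"
  proof (cases "a = b \<or> a = c \<or> b = c")
    case True
    then show ?thesis by (auto simp: cubic_coeff d_tau_left_pair sw)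
  next
    case False
    then have n: "a \<noteq> b" "a \<noteq> c" "b \<noteq> c" by auto
    have z: "P {#} {} x = 0" "P {#} {a} x = 0" "P {#} {b} x = 0" "P {#} {c} x = 0" "P {#} {a, b, c} x = 0"
      "l {#} {} x = 0" "l {#} {a, b} x = 0" "l {#} {a, c} x = 0" "l {#} {b, c} x = 0" "l {#} {a, b, c} x = 0"
      using n by (auto intro!: P0 l0 simp: not_monomials_2 not_monomials_1 simp del: One_nat_def)
    show ?thesis
      unfolding cubic_coeff lmult_no_p_triple[OF n] d_tau_left_pair using n z
      by (auto simp: shuffle_sign_1_2 shuffle_sign_2_1)
  qed
  then show "d_tau_right b (d_tau_left a (lmult P l)) {#} {c} x =
      - (d_tau_left a P {#} {b} x * l {#} {c} x - d_tau_left a P {#} {c} x * l {#} {b} x +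
         d_tau_left b P {#} {c} x * l {#} {a} x)"
    "d_tau_right b (d_tau_left a (lmult l P)) {#} {c} x =
      - (d_tau_left a P {#} {b} x * l {#} {c} x - d_tau_left a P {#} {c} x * l {#} {b} x +
         d_tau_left b P {#} {c} x * l {#} {a} x)" by auto
qed

lemma d_tau_left_linear_product:
  assumes "homogeneous n r 1 k x" "homogeneous n r 1 l x"
  shows "d_tau_left a (lmult k l) {#} {b} x = k {#} {a} x * l {#} {b} x - k {#} {b} x * l {#} {a} x"
proof (cases "a = b")
  case False
  then have "k {#} {a, b} x = 0" "k {#} {} x = 0" "l {#} {a, b} x = 0" "l {#} {} x = 0"
    by (auto intro!: homogeneousD[OF assms(1)] homogeneousD[OF assms(2)] simp: not_monomials_1 simp del: One_nat_def)
  then show ?thesis using False by (simp add: d_tau_left_pair lmult_no_p_pair)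
qed (simp add: d_tau_left_pair)

lemma homogeneous_lone: "homogeneous n r 0 lone x"
  by (simp add: homogeneous_def lone_def monomials_def)

lemma cubic_linear_product:
  assumes "homogeneous n r 1 k1 x" "homogeneous n r 1 k2 x" "homogeneous n r 1 k3 x"
  shows "d_tau_right b (d_tau_left a (lmult k1 (lmult k2 (lmult k3 lone)))) {#} {c} x =
    - det3 (\<lambda>d. k1 {#} {d} x) (\<lambda>d. k2 {#} {d} x) (\<lambda>d. k3 {#} {d} x) a b c"
proof -
  have k3: "homogeneous n r 1 (lmult k3 lone) x"
    using homogeneous_lmult[OF assms(3) homogeneous_lone] by simp
  have k3': "lmult k3 lone {#} {d} x = k3 {#} {d} x" for d
    by (simp add: lmult_no_p_single lone_def)
  have k23: "homogeneous n r 2 (lmult k2 (lmult k3 lone)) x"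
    using homogeneous_lmult[OF assms(2) k3] by (simp add: numeral_2_eq_2)
  show ?thesis
    unfolding cubic_quadratic_linear(2)[OF k23 assms(1)] d_tau_left_linear_product[OF assms(2) k3] k3'
    by (simp add: det3_def algebra_simps)
qed

lemma d_tau_linear_combination:
  assumes "\<And>m S. F m S x = (\<Sum>i\<in>I. k i * G i m S x) + (\<Sum>i\<in>J. l i * H i m S x)"
  shows "d_tau_right b (d_tau_left a F) {#} {c} x =
    (\<Sum>i\<in>I. k i * d_tau_right b (d_tau_left a (G i)) {#} {c} x) +
    (\<Sum>i\<in>J. l i * d_tau_right b (d_tau_left a (H i)) {#} {c} x)"
  unfolding cubic_coeff assms
  by (auto simp: sum_distrib_left sum_negf)

subsection \<open>The coordinates of one chart as functions in those of another\<close>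

lemma homogeneous_add: "homogeneous n r k F x \<Longrightarrow> homogeneous n r k G x \<Longrightarrow>
    homogeneous n r k (\<lambda>m S x. F m S x + G m S x) x"
  by (simp add: homogeneous_def)

lemma homogeneous_sum: "(\<And>i. i \<in> I \<Longrightarrow> homogeneous n r k (F i) x) \<Longrightarrow>
    homogeneous n r k (\<lambda>m S x. \<Sum>i\<in>I. c i x * F i m S x) x"
  by (simp add: homogeneous_def)

lemma homogeneous_ltau: "a < r \<Longrightarrow> homogeneous n r 1 (ltau a) x"
  by (auto simp: homogeneous_def ltau_def monomials_1 simp del: One_nat_def)

lemma homogeneous_new_tau: "homogeneous n (ac_rank \<kappa>) 1 (new_tau \<kappa> \<kappa>' c) x"
  unfolding new_tau_def[abs_def] by (rule homogeneous_sum) (simp add: homogeneous_ltau del: One_nat_def)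

lemma homogeneous_theta: "homogeneous n (ac_rank \<kappa>) 1 (theta \<kappa> a) x"
  unfolding theta_def[abs_def] by (rule homogeneous_sum) (simp add: homogeneous_ltau del: One_nat_def)

lemma homogeneous_d_old_tau: "homogeneous n (ac_rank \<kappa>) 1 (d_old_tau \<kappa> \<kappa>' j a) x"
  unfolding d_old_tau_def[abs_def] by (rule homogeneous_sum) (simp add: homogeneous_new_tau del: One_nat_def)

lemma homogeneous_new_p: "homogeneous n (ac_rank \<kappa>) 2 (new_p n \<kappa> \<kappa>' j) x"
proof -
  have "homogeneous n (ac_rank \<kappa>) 2 (lp i) x" if "i < n" for i
    using that by (auto simp: homogeneous_def lp_def monomials_def)
  then have 1: "homogeneous n (ac_rank \<kappa>) 2 (\<lambda>m S x. \<Sum>i<n. chart_deriv (ac_chart \<kappa>') j (\<lambda>z. snd (ac_chart \<kappa>) z i) x * lp i m S x) x"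
    by (intro homogeneous_sum) auto
  have "homogeneous n (ac_rank \<kappa>) 2 (lmult (theta \<kappa> a) (d_old_tau \<kappa> \<kappa>' j a)) x" for a
    using homogeneous_lmult[OF homogeneous_theta homogeneous_d_old_tau] by (simp add: numeral_2_eq_2)
  then have 2: "homogeneous n (ac_rank \<kappa>) 2 (\<lambda>m S x. \<Sum>a<ac_rank \<kappa>. lmult (theta \<kappa> a) (d_old_tau \<kappa> \<kappa>' j a) m S x) x"
    using homogeneous_sum[where c = "\<lambda>_ _. 1" and I = "{..<ac_rank \<kappa>}"
        and F = "\<lambda>a. lmult (theta \<kappa> a) (d_old_tau \<kappa> \<kappa>' j a)"] by simp
  show ?thesis using homogeneous_add[OF 1 2] by (simp add: new_p_def[abs_def])
qed

lemma ltau_sum: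
  assumes "a < r"
  shows "(\<Sum>b<r. f b * ltau b {#} {a} x) = f a"
proof -
  have "(\<Sum>b<r. f b * ltau b {#} {a} x) = (\<Sum>b<r. if b = a then f a else 0)"
    by (intro sum.cong) (auto simp: ltau_def)
  then show ?thesis using assms by simp
qed

lemma new_tau_single:
  "a < ac_rank \<kappa> \<Longrightarrow> new_tau \<kappa> \<kappa>' c {#} {a} x = coeff (ac_rank \<kappa>') (ac_frame \<kappa>') c x (ac_frame \<kappa> a x)"
  by (simp add: new_tau_def ltau_sum)

lemma theta_single: "b < ac_rank \<kappa> \<Longrightarrow> theta \<kappa> a {#} {b} x = 1/2 * ac_gram \<kappa> a b"
  unfolding theta_def by (rule ltau_sum)

lemma new_p_single:
  assumes "i < n"
  shows "new_p n \<kappa> \<kappa>' j {#i#} {} x = chart_deriv (ac_chart \<kappa>') j (\<lambda>z. snd (ac_chart \<kappa>) z i) x"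
proof -
  have "lmult (theta \<kappa> a) (d_old_tau \<kappa> \<kappa>' j a) {#i#} {} x = 0" for a
    by (simp add: lmult_p_empty theta_def ltau_def)
  moreover have "(\<Sum>k<n. chart_deriv (ac_chart \<kappa>') j (\<lambda>z. snd (ac_chart \<kappa>) z k) x * lp k {#i#} {} x) =
     (\<Sum>k<n. if k = i then chart_deriv (ac_chart \<kappa>') j (\<lambda>z. snd (ac_chart \<kappa>) z i) x else 0)"
    by (intro sum.cong) (auto simp: lp_def)
  ultimately show ?thesis using assms by (simp add: new_p_def)
qed

lemma d_tau_left_new_p:
  "d_tau_left a (new_p n \<kappa> \<kappa>' j) {#} {b} x =
    (\<Sum>k<ac_rank \<kappa>. theta \<kappa> k {#} {a} x * d_old_tau \<kappa> \<kappa>' j k {#} {b} x -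
      theta \<kappa> k {#} {b} x * d_old_tau \<kappa> \<kappa>' j k {#} {a} x)"
proof -
  have "new_p n \<kappa> \<kappa>' j {#} S x = (\<Sum>k<ac_rank \<kappa>. lmult (theta \<kappa> k) (d_old_tau \<kappa> \<kappa>' j k) {#} S x)" for S
    by (simp add: new_p_def lp_def)
  then have "d_tau_left a (new_p n \<kappa> \<kappa>' j) {#} {b} x =
      (\<Sum>k<ac_rank \<kappa>. d_tau_left a (lmult (theta \<kappa> k) (d_old_tau \<kappa> \<kappa>' j k)) {#} {b} x)"
    by (simp add: d_tau_left_pair sum_negf)
  then show ?thesis
    by (simp add: d_tau_left_linear_product[OF homogeneous_theta homogeneous_d_old_tau])
qed

lemma new_monomial_p_tau: "new_monomial n \<kappa> \<kappa>' {#j#} {d} = lmult (new_p n \<kappa> \<kappa>' j) (lmult (new_tau \<kappa> \<kappa>' d) lone)"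
  by (simp add: new_monomial_def)

lemma new_monomial_tau:
  "sorted_list_of_set S = [d, e, f] \<Longrightarrow> new_monomial n \<kappa> \<kappa>' {#} S =
    lmult (new_tau \<kappa> \<kappa>' d) (lmult (new_tau \<kappa> \<kappa>' e) (lmult (new_tau \<kappa> \<kappa>' f) lone))"
  by (simp add: new_monomial_def)

lemma sum_monomials_3:
  fixes f :: "nat multiset \<Rightarrow> nat set \<Rightarrow> real"
  shows "(\<Sum>(m, S)\<in>monomials n r 3. f m S) =
    (\<Sum>(j, d)\<in>{..<n} \<times> {..<r}. f {#j#} {d}) + (\<Sum>S\<in>{S. S \<subseteq> {..<r} \<and> card S = 3}. f {#} S)"
proof -
  let ?P = "(\<lambda>(j, d). ({#j#}, {d})) ` ({..<n} \<times> {..<r})"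
  let ?T = "Pair {#} ` {S. S \<subseteq> {..<r} \<and> card S = 3}"
  have fin: "finite ?P" "finite ?T" by (auto intro!: finite_imageI finite_subset[of _ "Pow {..<r}"])
  have dis: "?P \<inter> ?T = {}" by auto
  have "monomials n r 3 = ?P \<union> ?T"
  proof (intro set_eqI iffI)
    fix t assume t: "t \<in> monomials n r 3"
    obtain m S where mS: "t = (m, S)" by (cases t)
    have *: "set_mset m \<subseteq> {..<n}" "S \<subseteq> {..<r}" "2 * size m + card S = 3"
      using t mS by (auto simp: monomials_def)
    have "(size m = 0 \<and> card S = 3) \<or> (size m = 1 \<and> card S = 1)" using *(3) by presburger
    then consider "size m = 0" "card S = 3" | "size m = 1" "card S = 1" by blast
    then show "t \<in> ?P \<union> ?T"
    proof cases
      case 1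
      then show ?thesis using * mS by auto
    next
      case 2
      then obtain j d where "m = {#j#}" "S = {d}"
        by (metis One_nat_def card_1_singletonE size_1_singleton_mset)
      then show ?thesis using * mS by auto
    qed
  next
    fix t assume "t \<in> ?P \<union> ?T"
    then show "t \<in> monomials n r 3" by (auto simp: monomials_def)
  qed
  then have "(\<Sum>(m, S)\<in>monomials n r 3. f m S) = (\<Sum>(m, S)\<in>?P. f m S) + (\<Sum>(m, S)\<in>?T. f m S)"
    using sum.union_disjoint[OF fin dis] by simp
  moreover have "(\<Sum>(m, S)\<in>?P. f m S) = (\<Sum>(j, d)\<in>{..<n} \<times> {..<r}. f {#j#} {d})"
    by (subst sum.reindex) (auto simp: inj_on_def case_prod_beta)
  moreover have "(\<Sum>(m, S)\<in>?T. f m S) = (\<Sum>S\<in>{S. S \<subseteq> {..<r} \<and> card S = 3}. f {#} S)"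
    by (subst sum.reindex) (auto simp: inj_on_def)
  ultimately show ?thesis by simp
qed

text \<open>The coefficients of \<open>p\<^sub>i \<tau>\<^sup>a\<close> transform as a tensor: only the linear part of the new momenta
  contributes.\<close>

lemma substitute_mixed:
  assumes "i < n" "a < ac_rank \<kappa>"
  shows "substitute n 3 \<kappa> \<kappa>' F {#i#} {a} x =
    (\<Sum>(j, d)\<in>{..<n} \<times> {..<ac_rank \<kappa>'}. F {#j#} {d} x *
      (chart_deriv (ac_chart \<kappa>') j (\<lambda>z. snd (ac_chart \<kappa>) z i) x *
       coeff (ac_rank \<kappa>') (ac_frame \<kappa>') d x (ac_frame \<kappa> a x)))"
proof -
  have "new_monomial n \<kappa> \<kappa>' {#} S {#i#} {a} x = 0" if card: "card S = 3" for S
  proof -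
    obtain d e f where "d < e" "e < f" "S = {d, e, f}" using card_3_sorted[OF card] .
    then have "sorted_list_of_set S = [d, e, f]"
      using sorted_list_of_set_3 by simp
    then show ?thesis
      by (simp add: new_monomial_tau lmult_p_single lmult_p_empty lmult_no_p_empty new_tau_def ltau_def lone_def)
  qed
  moreover have "new_monomial n \<kappa> \<kappa>' {#j#} {d} {#i#} {a} x =
      chart_deriv (ac_chart \<kappa>') j (\<lambda>z. snd (ac_chart \<kappa>) z i) x *
       coeff (ac_rank \<kappa>') (ac_frame \<kappa>') d x (ac_frame \<kappa> a x)" for j d
  proof -
    note p0 = homogeneousD[OF homogeneous_new_p[of n \<kappa> \<kappa>' j x]]
    show ?thesis
      using assms by (simp add: new_monomial_p_tau lmult_p_single p0 not_monomials_2 lmult_no_p_single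
        new_tau_single new_p_single lone_def)
  qed
  ultimately show ?thesis
    unfolding substitute_def sum_monomials_3 by (simp add: case_prod_beta)
qed

text \<open>The cubic coefficients do not transform as a tensor: the part of the new momenta that is quadratic
  in the \<open>\<tau>\<^sup>a\<close> feeds the mixed coefficients into the cubic ones.\<close>

lemma substitute_cubic:
  assumes "\<And>m S. F m S x = substitute n 3 \<kappa> \<kappa>' F' m S x"
  shows "d_tau_right b (d_tau_left a F) {#} {c} x =
    (\<Sum>(j, d)\<in>{..<n} \<times> {..<ac_rank \<kappa>'}. F' {#j#} {d} x *
      - (d_tau_left a (new_p n \<kappa> \<kappa>' j) {#} {b} x * new_tau \<kappa> \<kappa>' d {#} {c} x -
         d_tau_left a (new_p n \<kappa> \<kappa>' j) {#} {c} x * new_tau \<kappa> \<kappa>' d {#} {b} x +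
         d_tau_left b (new_p n \<kappa> \<kappa>' j) {#} {c} x * new_tau \<kappa> \<kappa>' d {#} {a} x)) -
    (\<Sum>S\<in>{S. S \<subseteq> {..<ac_rank \<kappa>'} \<and> card S = 3}. F' {#} S x *
      (case sorted_list_of_set S of [d, e, f] \<Rightarrow>
        det3 (\<lambda>a. new_tau \<kappa> \<kappa>' d {#} {a} x) (\<lambda>a. new_tau \<kappa> \<kappa>' e {#} {a} x)
          (\<lambda>a. new_tau \<kappa> \<kappa>' f {#} {a} x) a b c))"
proof -
  have "F m S x = (\<Sum>t\<in>{..<n} \<times> {..<ac_rank \<kappa>'}. F' {#fst t#} {snd t} x * new_monomial n \<kappa> \<kappa>' {#fst t#} {snd t} m S x) +
      (\<Sum>T\<in>{S. S \<subseteq> {..<ac_rank \<kappa>'} \<and> card S = 3}. F' {#} T x * new_monomial n \<kappa> \<kappa>' {#} T m S x)" for m S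
    unfolding assms substitute_def sum_monomials_3 by (simp add: case_prod_beta)
  then have *: "d_tau_right b (d_tau_left a F) {#} {c} x =
      (\<Sum>t\<in>{..<n} \<times> {..<ac_rank \<kappa>'}. F' {#fst t#} {snd t} x *
        d_tau_right b (d_tau_left a (new_monomial n \<kappa> \<kappa>' {#fst t#} {snd t})) {#} {c} x) +
      (\<Sum>T\<in>{S. S \<subseteq> {..<ac_rank \<kappa>'} \<and> card S = 3}. F' {#} T x *
        d_tau_right b (d_tau_left a (new_monomial n \<kappa> \<kappa>' {#} T)) {#} {c} x)"
    by (rule d_tau_linear_combination)
  have "d_tau_right b (d_tau_left a (new_monomial n \<kappa> \<kappa>' {#j#} {d})) {#} {c} x =
     - (d_tau_left a (new_p n \<kappa> \<kappa>' j) {#} {b} x * new_tau \<kappa> \<kappa>' d {#} {c} x -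
         d_tau_left a (new_p n \<kappa> \<kappa>' j) {#} {c} x * new_tau \<kappa> \<kappa>' d {#} {b} x +
         d_tau_left b (new_p n \<kappa> \<kappa>' j) {#} {c} x * new_tau \<kappa> \<kappa>' d {#} {a} x)" for j d
  proof -
    have t: "homogeneous n (ac_rank \<kappa>) 1 (lmult (new_tau \<kappa> \<kappa>' d) lone) x"
      using homogeneous_lmult[OF homogeneous_new_tau homogeneous_lone] by simp
    have t': "lmult (new_tau \<kappa> \<kappa>' d) lone {#} {c} x = new_tau \<kappa> \<kappa>' d {#} {c} x" for c
      by (simp add: lmult_no_p_single lone_def)
    show ?thesis unfolding new_monomial_p_tau cubic_quadratic_linear(1)[OF homogeneous_new_p t] t' ..
  qed
  moreover have "d_tau_right b (d_tau_left a (new_monomial n \<kappa> \<kappa>' {#} S)) {#} {c} x =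
     - (case sorted_list_of_set S of [d, e, f] \<Rightarrow>
        det3 (\<lambda>a. new_tau \<kappa> \<kappa>' d {#} {a} x) (\<lambda>a. new_tau \<kappa> \<kappa>' e {#} {a} x)
          (\<lambda>a. new_tau \<kappa> \<kappa>' f {#} {a} x) a b c)" if card: "card S = 3" for S
  proof -
    obtain d e f where "d < e" "e < f" "S = {d, e, f}" using card_3_sorted[OF card] .
    then have l: "sorted_list_of_set S = [d, e, f]"
      using sorted_list_of_set_3 by simp
    show ?thesis
      unfolding new_monomial_tau[OF l] cubic_linear_product[OF homogeneous_new_tau homogeneous_new_tau homogeneous_new_tau]
      by (simp add: l)
  qed
  ultimately show ?thesis
    unfolding * by (simp add: case_prod_beta sum_negf)
qed

section \<open>The Dorfman bracket in adapted coordinates\<close>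

subsection \<open>Contraction of three indices\<close>

text \<open>The contraction of \<open>\<phi>\<close> with three vectors, given by their coefficients.\<close>

definition contract3 ::
    "nat \<Rightarrow> (nat \<Rightarrow> real) \<Rightarrow> (nat \<Rightarrow> real) \<Rightarrow> (nat \<Rightarrow> real) \<Rightarrow> (nat \<Rightarrow> nat \<Rightarrow> nat \<Rightarrow> real) \<Rightarrow> real" where
  "contract3 r u v w \<phi> = (\<Sum>a<r. \<Sum>b<r. \<Sum>c<r. u a * v b * w c * \<phi> a b c)"

lemma contract3_add: "contract3 r u v w (\<lambda>a b c. \<phi> a b c + \<psi> a b c) = contract3 r u v w \<phi> + contract3 r u v w \<psi>"
  by (simp add: contract3_def distrib_left sum.distrib)

lemma contract3_diff: "contract3 r u v w (\<lambda>a b c. \<phi> a b c - \<psi> a b c) = contract3 r u v w \<phi> - contract3 r u v w \<psi>"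
  by (simp add: contract3_def right_diff_distrib sum_subtractf)

lemma contract3_scale: "contract3 r u v w (\<lambda>a b c. k * \<phi> a b c) = k * contract3 r u v w \<phi>"
  by (simp add: contract3_def sum_distrib_left mult_ac)

lemma contract3_minus: "contract3 r u v w (\<lambda>a b c. - \<phi> a b c) = - contract3 r u v w \<phi>"
  by (simp add: contract3_def sum_negf)

lemma contract3_sum: "contract3 r u v w (\<lambda>a b c. \<Sum>i\<in>I. \<phi> i a b c) = (\<Sum>i\<in>I. contract3 r u v w (\<phi> i))"
proof (induction I rule: infinite_finite_induct)
  case (insert i I)
  then show ?case by (simp add: contract3_add)
qed (simp_all add: contract3_def)

lemma contract3_12: "contract3 r u v w (\<lambda>a b c. P a b * t c) = (\<Sum>a<r. \<Sum>b<r. u a * v b * P a b) * (\<Sum>c<r. w c * t c)"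
proof -
  have "(\<Sum>c<r. u a * v b * w c * (P a b * t c)) = (u a * v b * P a b) * (\<Sum>c<r. w c * t c)" for a b
    by (simp add: sum_distrib_left mult_ac)
  then show ?thesis by (simp add: contract3_def sum_distrib_right)
qed

lemma contract3_swap: "contract3 r u v w (\<lambda>a b c. \<phi> a c b) = contract3 r u w v \<phi>"
proof -
  have "(\<Sum>b<r. \<Sum>c<r. u a * v b * w c * \<phi> a c b) = (\<Sum>c<r. \<Sum>b<r. u a * w c * v b * \<phi> a c b)" for a
    by (subst sum.swap) (simp add: mult_ac)
  then show ?thesis by (simp add: contract3_def)
qed

lemma contract3_13: "contract3 r u v w (\<lambda>a b c. P a c * t b) = (\<Sum>a<r. \<Sum>c<r. u a * w c * P a c) * (\<Sum>b<r. v b * t b)"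
  using contract3_swap[of r u v w "\<lambda>a b c. P a b * t c"] by (simp add: contract3_12)

lemma contract3_23: "contract3 r u v w (\<lambda>a b c. P b c * t a) = (\<Sum>b<r. \<Sum>c<r. v b * w c * P b c) * (\<Sum>a<r. u a * t a)"
proof -
  have "(\<Sum>b<r. \<Sum>c<r. u a * v b * w c * (P b c * t a)) = (u a * t a) * (\<Sum>b<r. \<Sum>c<r. v b * w c * P b c)" for a
    by (simp add: sum_distrib_left mult_ac)
  then have "contract3 r u v w (\<lambda>a b c. P b c * t a) = (\<Sum>a<r. u a * t a) * (\<Sum>b<r. \<Sum>c<r. v b * w c * P b c)"
    by (simp add: contract3_def sum_distrib_right)
  then show ?thesis by simp
qed

lemma contract3_det3:
  "contract3 r u v w (\<lambda>a b c. det3 (t d) (t e) (t f) a b c) =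
    det3 (\<lambda>d. \<Sum>a<r. u a * t d a) (\<lambda>d. \<Sum>a<r. v a * t d a) (\<lambda>d. \<Sum>a<r. w a * t d a) d e f"
proof -
  have "(\<Sum>a<r. \<Sum>b<r. u a * v b * (f a * g b)) = (\<Sum>a<r. u a * f a) * (\<Sum>b<r. v b * g b)" for u v f g :: "nat \<Rightarrow> real"
    by (simp add: sum_product mult_ac)
  then have p: "contract3 r u v w (\<lambda>a b c. f a * g b * h c) =
      (\<Sum>a<r. u a * f a) * (\<Sum>b<r. v b * g b) * (\<Sum>c<r. w c * h c)" for f g h
    by (simp add: contract3_12[of r u v w "\<lambda>a b. f a * g b"])
  have "det3 (t d) (t e) (t f) a b c =
     t d a * t e b * t f c - t d a * t f b * t e c - t e a * t d b * t f c + t f a * t d b * t e c +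
     (t e a * t f b * t d c - t f a * t e b * t d c)" for a b c
    by (simp add: det3_def algebra_simps)
  then show ?thesis
    by (simp only: contract3_add contract3_diff p) (simp add: det3_def algebra_simps)
qed

context metric_bundle_space
begin

text \<open>Coefficients of a vector in the frame of an adapted chart, and components of a section
  as functions on its domain.\<close>

abbreviation frame_coeff :: "('m, 'v) adapted_chart \<Rightarrow> 'v \<Rightarrow> nat \<Rightarrow> 'm \<Rightarrow> real" where
  "frame_coeff \<kappa> w a x \<equiv> coeff (ac_rank \<kappa>) (ac_frame \<kappa>) a x w"

abbreviation component :: "('m, 'v) adapted_chart \<Rightarrow> ('m \<Rightarrow> 'v) \<Rightarrow> nat \<Rightarrow> 'm \<Rightarrow> real" where
  "component \<kappa> v a \<equiv> \<lambda>z. form B z (v z) (ac_frame \<kappa> a z)"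

text \<open>The anchor of a vector \<open>w\<close>: its coordinates, and its action on functions. The sign comes from
  \<open>{p\<^sub>i, q\<^sup>i} = -1\<close>.\<close>

definition anchor_coord :: "('m, 'v) adapted_chart \<Rightarrow> 'm lfun \<Rightarrow> nat \<Rightarrow> 'v \<Rightarrow> 'm \<Rightarrow> real" where
  "anchor_coord \<kappa> F i w x = - (\<Sum>b<ac_rank \<kappa>. frame_coeff \<kappa> w b x * F {#i#} {b} x)"

definition anchor :: "('m, 'v) adapted_chart \<Rightarrow> 'm lfun \<Rightarrow> 'v \<Rightarrow> ('m \<Rightarrow> real) \<Rightarrow> 'm \<Rightarrow> real" where
  "anchor \<kappa> F w f x = (\<Sum>i<mdim B. anchor_coord \<kappa> F i w x * chart_deriv (ac_chart \<kappa>) i f x)"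

text \<open>The cubic part of a local function, as a trilinear form on the fibre.\<close>

definition cubic :: "('m, 'v) adapted_chart \<Rightarrow> 'm lfun \<Rightarrow> 'v \<Rightarrow> 'v \<Rightarrow> 'v \<Rightarrow> 'm \<Rightarrow> real" where
  "cubic \<kappa> F u v w x = contract3 (ac_rank \<kappa>)
    (\<lambda>a. frame_coeff \<kappa> u a x) (\<lambda>b. frame_coeff \<kappa> v b x) (\<lambda>c. frame_coeff \<kappa> w c x)
    (\<lambda>a b c. d_tau_right b (d_tau_left a F) {#} {c} x)"

text \<open>The value of \<open>\<langle>[u, v], w\<rangle>\<close> at \<open>x\<close>, for sections \<open>u\<close>, \<open>v\<close> and a vector \<open>w\<close>: the three derivative
  terms use the flat connection for which the frame is parallel, and the last one is the cubic part
  of \<open>\<Theta>\<close>.\<close>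

definition dorfman_form ::
    "('m, 'v) adapted_chart \<Rightarrow> 'm lfun \<Rightarrow> ('m \<Rightarrow> 'v) \<Rightarrow> ('m \<Rightarrow> 'v) \<Rightarrow> 'v \<Rightarrow> 'm \<Rightarrow> real" where
  "dorfman_form \<kappa> F u v w x =
    (\<Sum>c<ac_rank \<kappa>. anchor \<kappa> F (u x) (component \<kappa> v c) x * frame_coeff \<kappa> w c x) -
    (\<Sum>c<ac_rank \<kappa>. anchor \<kappa> F (v x) (component \<kappa> u c) x * frame_coeff \<kappa> w c x) +
    (\<Sum>c<ac_rank \<kappa>. anchor \<kappa> F w (component \<kappa> u c) x * frame_coeff \<kappa> (v x) c x) +
    cubic \<kappa> F (u x) (v x) w x"

lemma bracket_dorfman_form:
  assumes \<kappa>: "\<kappa> \<in> adapted_charts B" and x: "x \<in> ac_dom \<kappa>"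
    and F: "homogeneous (mdim B) (ac_rank \<kappa>) 3 F x"
    and u: "u x \<in> fibre B x" and v: "v x \<in> fibre B x"
  shows "(\<Sum>c<ac_rank \<kappa>. frame_coeff \<kappa> w c x *
      poisson (mdim B) \<kappa> (poisson (mdim B) \<kappa> (section_fun B u \<kappa>) F) (section_fun B v \<kappa>) {#} {c} x) =
    dorfman_form \<kappa> F u v w x"
proof -
  define r where "r = ac_rank \<kappa>"
  define n where "n = mdim B"
  define u' where "u' b = frame_coeff \<kappa> (u x) b x" for b
  define v' where "v' b = frame_coeff \<kappa> (v x) b x" for b
  define w' where "w' b = frame_coeff \<kappa> w b x" for b
  define du where "du i c = chart_deriv (ac_chart \<kappa>) i (component \<kappa> u c) x" for i c
  define dv where "dv i c = chart_deriv (ac_chart \<kappa>) i (component \<kappa> v c) x" for i c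
  define A where "A i b = F {#i#} {b} x" for i b
  define C where "C a b c = d_tau_right b (d_tau_left a F) {#} {c} x" for a b c
  have u'_eq: "(\<Sum>a<r. inv_gram \<kappa> a b * form B x (u x) (ac_frame \<kappa> a x)) = u' b" if "b < r" for b
    using coeff_inv_gram[OF \<kappa> x _ u, of b] that inv_gram_sym[OF \<kappa> x, of b] by (simp add: r_def u'_def)
  have v'_eq: "(\<Sum>a<r. inv_gram \<kappa> b a * form B x (v x) (ac_frame \<kappa> a x)) = v' b" if "b < r" for b
    using coeff_inv_gram[OF \<kappa> x _ v, of b] that by (simp add: r_def v'_def)
  have D: "poisson n \<kappa> (poisson n \<kappa> (section_fun B u \<kappa>) F) (section_fun B v \<kappa>) {#} {c} x =
    - (\<Sum>i<n. (\<Sum>b<r. u' b * A i b) * dv i c) +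
    (\<Sum>a<r. v' a * ((\<Sum>i<n. du i c * A i a - du i a * A i c) + (\<Sum>b<r. u' b * C b a c)))"
    if "c < r" for c
    using derived_bracket_coeff[of n \<kappa> F x c B u v] F that u'_eq v'_eq
    by (simp add: n_def[symmetric] r_def[symmetric] du_def dv_def A_def C_def)
  have X: "anchor_coord \<kappa> F i (u x) x = - (\<Sum>b<r. u' b * A i b)"
    "anchor_coord \<kappa> F i (v x) x = - (\<Sum>b<r. v' b * A i b)"
    "anchor_coord \<kappa> F i w x = - (\<Sum>b<r. w' b * A i b)" for i
    by (simp_all add: anchor_coord_def u'_def v'_def w'_def A_def r_def)
  have t1: "(\<Sum>c<r. w' c * - (\<Sum>i<n. (\<Sum>b<r. u' b * A i b) * dv i c)) =
      (\<Sum>c<r. anchor \<kappa> F (u x) (component \<kappa> v c) x * w' c)"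
    unfolding anchor_def X dv_def[symmetric] n_def[symmetric]
    by (intro sum.cong) (simp_all add: sum_negf mult.commute)
  have t2: "(\<Sum>c<r. w' c * (\<Sum>a<r. v' a * (\<Sum>i<n. du i c * A i a))) =
      - (\<Sum>c<r. anchor \<kappa> F (v x) (component \<kappa> u c) x * w' c)"
  proof -
    have "(\<Sum>a<r. v' a * (\<Sum>i<n. du i c * A i a)) = - anchor \<kappa> F (v x) (component \<kappa> u c) x" for c
    proof -
      have "(\<Sum>a<r. v' a * (\<Sum>i<n. du i c * A i a)) = (\<Sum>a<r. \<Sum>i<n. v' a * A i a * du i c)"
        by (simp add: sum_distrib_left mult_ac)
      also have "\<dots> = (\<Sum>i<n. (\<Sum>a<r. v' a * A i a) * du i c)"
        by (subst sum.swap) (simp add: sum_distrib_right)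
      finally show ?thesis
        unfolding anchor_def X du_def[symmetric] n_def[symmetric] by (simp add: sum_negf)
    qed
    then show ?thesis by (simp add: sum_negf mult.commute)
  qed
  have t3: "(\<Sum>c<r. w' c * (\<Sum>a<r. v' a * (\<Sum>i<n. du i a * A i c))) =
      - (\<Sum>a<r. anchor \<kappa> F w (component \<kappa> u a) x * v' a)"
  proof -
    have "(\<Sum>c<r. w' c * (\<Sum>a<r. v' a * (\<Sum>i<n. du i a * A i c))) =
        (\<Sum>c<r. \<Sum>a<r. v' a * (\<Sum>i<n. w' c * A i c * du i a))"
      by (simp add: sum_distrib_left mult_ac)
    also have "\<dots> = (\<Sum>a<r. v' a * (\<Sum>c<r. \<Sum>i<n. w' c * A i c * du i a))"
      by (subst sum.swap) (simp add: sum_distrib_left)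
    also have "\<dots> = (\<Sum>a<r. v' a * (\<Sum>i<n. (\<Sum>c<r. w' c * A i c) * du i a))"
      by (subst sum.swap[of _ "{..<n}"]) (simp add: sum_distrib_right)
    also have "\<dots> = (\<Sum>a<r. v' a * - anchor \<kappa> F w (component \<kappa> u a) x)"
      unfolding anchor_def X du_def[symmetric] n_def[symmetric] by (simp add: sum_negf)
    finally show ?thesis by (simp add: sum_negf mult.commute)
  qed
  have t4: "(\<Sum>c<r. w' c * (\<Sum>a<r. v' a * (\<Sum>b<r. u' b * C b a c))) = cubic \<kappa> F (u x) (v x) w x"
  proof -
    have "cubic \<kappa> F (u x) (v x) w x = (\<Sum>b<r. \<Sum>a<r. \<Sum>c<r. w' c * (v' a * (u' b * C b a c)))"
      by (simp add: cubic_def contract3_def r_def u'_def v'_def w'_def C_def mult_ac)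
    also have "\<dots> = (\<Sum>b<r. \<Sum>c<r. \<Sum>a<r. w' c * (v' a * (u' b * C b a c)))"
      by (rule sum.cong[OF refl]) (rule sum.swap)
    also have "\<dots> = (\<Sum>c<r. \<Sum>b<r. \<Sum>a<r. w' c * (v' a * (u' b * C b a c)))"
      by (rule sum.swap)
    also have "\<dots> = (\<Sum>c<r. \<Sum>a<r. \<Sum>b<r. w' c * (v' a * (u' b * C b a c)))"
      by (rule sum.cong[OF refl]) (rule sum.swap)
    finally show ?thesis by (simp add: sum_distrib_left)
  qed
  have "(\<Sum>c<r. w' c * (- (\<Sum>i<n. (\<Sum>b<r. u' b * A i b) * dv i c) +
      (\<Sum>a<r. v' a * ((\<Sum>i<n. du i c * A i a - du i a * A i c) + (\<Sum>b<r. u' b * C b a c))))) =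
    (\<Sum>c<r. w' c * - (\<Sum>i<n. (\<Sum>b<r. u' b * A i b) * dv i c)) +
    (\<Sum>c<r. w' c * (\<Sum>a<r. v' a * (\<Sum>i<n. du i c * A i a))) -
    (\<Sum>c<r. w' c * (\<Sum>a<r. v' a * (\<Sum>i<n. du i a * A i c))) +
    (\<Sum>c<r. w' c * (\<Sum>a<r. v' a * (\<Sum>b<r. u' b * C b a c)))"
    by (simp only: distrib_left right_diff_distrib sum.distrib sum_subtractf)
  also have "\<dots> = dorfman_form \<kappa> F u v w x"
    unfolding t1 t2 t3 t4 dorfman_form_def
    by (simp add: r_def w'_def v'_def)
  finally show ?thesis
    using D by (simp add: n_def[symmetric] r_def[symmetric] w'_def)
qed

subsection \<open>The anchor as a derivation\<close>

lemma adapted_chart_pair: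
  assumes "\<kappa> \<in> adapted_charts B"
  obtains U q where "ac_chart \<kappa> = (U, q)" "(U, q) \<in> atlas B" "ac_dom \<kappa> \<subseteq> U"
  using adapted_chart(2,3)[OF assms] by (cases "ac_chart \<kappa>") auto

lemma smooth_component:
  assumes "\<kappa> \<in> adapted_charts B" "open W" "W \<subseteq> ac_dom \<kappa>" "smsec W v" "a < ac_rank \<kappa>"
  shows "smooth W (component \<kappa> v a)"
  using adapted_chart(5)[OF assms(1,5)] assms by (intro smooth_form) (auto intro: smsec_subset)

context
  fixes \<kappa> and F :: "'m lfun" and x W
  assumes \<kappa>: "\<kappa> \<in> adapted_charts B" and x: "x \<in> ac_dom \<kappa>" "x \<in> W" and W: "open W"
begin

lemma anchor_sum:
  assumes "\<And>j. j \<in> J \<Longrightarrow> smooth W (f j)"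
  shows "anchor \<kappa> F w (\<lambda>z. \<Sum>j\<in>J. f j z) x = (\<Sum>j\<in>J. anchor \<kappa> F w (f j) x)"
proof -
  obtain U q where q: "ac_chart \<kappa> = (U, q)" "(U, q) \<in> atlas B" "ac_dom \<kappa> \<subseteq> U"
    using adapted_chart_pair[OF \<kappa>] .
  have "chart_deriv (U, q) i (\<lambda>z. \<Sum>j\<in>J. f j z) x = (\<Sum>j\<in>J. chart_deriv (U, q) i (f j) x)" if "i < mdim B" for i
    using q x W assms that by (intro chart_deriv_sum[where W = W]) auto
  then have "anchor \<kappa> F w (\<lambda>z. \<Sum>j\<in>J. f j z) x =
     (\<Sum>i<mdim B. \<Sum>j\<in>J. anchor_coord \<kappa> F i w x * chart_deriv (U, q) i (f j) x)"
    unfolding anchor_def q(1) by (simp add: sum_distrib_left del: chart_deriv.simps)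
  then show ?thesis unfolding anchor_def q(1) by (subst (asm) sum.swap)
qed

lemma anchor_mult:
  assumes "smooth W f" "smooth W g"
  shows "anchor \<kappa> F w (\<lambda>z. f z * g z) x = anchor \<kappa> F w f x * g x + f x * anchor \<kappa> F w g x"
proof -
  obtain U q where q: "ac_chart \<kappa> = (U, q)" "(U, q) \<in> atlas B" "ac_dom \<kappa> \<subseteq> U"
    using adapted_chart_pair[OF \<kappa>] .
  have "chart_deriv (U, q) i (\<lambda>z. f z * g z) x =
      chart_deriv (U, q) i f x * g x + f x * chart_deriv (U, q) i g x" if "i < mdim B" for i
    using q x W assms that by (intro chart_deriv_mult[where W = W]) auto
  then have "anchor \<kappa> F w (\<lambda>z. f z * g z) x = (\<Sum>i<mdim B. anchor_coord \<kappa> F i w x *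
      (chart_deriv (U, q) i f x * g x + f x * chart_deriv (U, q) i g x))"
    unfolding anchor_def q(1) by (simp del: chart_deriv.simps)
  then show ?thesis
    unfolding anchor_def q(1)
    by (simp add: distrib_left sum.distrib sum_distrib_left sum_distrib_right mult_ac del: chart_deriv.simps)
qed

lemma anchor_cmult:
  assumes "smooth W f"
  shows "anchor \<kappa> F w (\<lambda>z. c * f z) x = c * anchor \<kappa> F w f x"
  using anchor_mult[OF smooth_const[OF W, of c] assms] by (simp add: anchor_def)

lemma anchor_cong:
  assumes "\<And>z. z \<in> W \<Longrightarrow> f z = g z"
  shows "anchor \<kappa> F w f x = anchor \<kappa> F w g x"
proof -
  obtain U q where q: "ac_chart \<kappa> = (U, q)" "(U, q) \<in> atlas B" "ac_dom \<kappa> \<subseteq> U"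
    using adapted_chart_pair[OF \<kappa>] .
  have "chart_deriv (U, q) i f x = chart_deriv (U, q) i g x" if "i < mdim B" for i
    using q x W assms that by (intro chart_deriv_cong[where W = W]) auto
  then show ?thesis unfolding anchor_def q(1) by (simp del: chart_deriv.simps)
qed

end

lemma anchor_const [simp]: "anchor \<kappa> F w (\<lambda>z. c) x = 0"
  by (simp add: anchor_def)

lemma form_components:
  assumes \<kappa>: "\<kappa> \<in> adapted_charts B" and x: "x \<in> ac_dom \<kappa>" and v: "v \<in> fibre B x" and w: "w \<in> fibre B x"
  shows "form B x v w = (\<Sum>c<ac_rank \<kappa>. form B x v (ac_frame \<kappa> c x) * frame_coeff \<kappa> w c x)"
proof -
  note e = adapted_chart(4)[OF \<kappa> x]
  have "form B x v w = form B x v (\<Sum>c<ac_rank \<kappa>. frame_coeff \<kappa> w c x *\<^sub>R ac_frame \<kappa> c x)"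
    using basis_expand[OF e w] by simp
  also have "\<dots> = (\<Sum>c<ac_rank \<kappa>. frame_coeff \<kappa> w c x * form B x v (ac_frame \<kappa> c x))"
    using basis_in_fibre[OF e] v by (intro form_sum_right) auto
  finally show ?thesis by (simp add: mult.commute)
qed

lemma anchor_form:
  assumes \<kappa>: "\<kappa> \<in> adapted_charts B" and x: "x \<in> ac_dom \<kappa>" and v: "smsec (ac_dom \<kappa>) v" and w: "smsec (ac_dom \<kappa>) w"
  shows "anchor \<kappa> F y (\<lambda>z. form B z (v z) (w z)) x =
    (\<Sum>c<ac_rank \<kappa>. anchor \<kappa> F y (component \<kappa> v c) x * frame_coeff \<kappa> (w x) c x) +
    (\<Sum>c<ac_rank \<kappa>. anchor \<kappa> F y (component \<kappa> w c) x * frame_coeff \<kappa> (v x) c x)"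
proof -
  let ?W = "ac_dom \<kappa>"
  let ?r = "ac_rank \<kappa>"
  have W: "open ?W" using adapted_chart(1)[OF \<kappa>] .
  have sv: "smooth ?W (component \<kappa> v c)" if "c < ?r" for c using smooth_component[OF \<kappa> W _ v that] by simp
  have sw: "smooth ?W (component \<kappa> w c)" if "c < ?r" for c using smooth_component[OF \<kappa> W _ w that] by simp
  have cw: "frame_coeff \<kappa> (w z) c z = (\<Sum>b<?r. inv_gram \<kappa> c b * component \<kappa> w b z)" if "z \<in> ?W" "c < ?r" for z c
    using coeff_inv_gram[OF \<kappa> that] smsec_fibre[OF w that(1)] by simp
  have cv: "frame_coeff \<kappa> (v z) c z = (\<Sum>b<?r. inv_gram \<kappa> b c * component \<kappa> v b z)" if "z \<in> ?W" "c < ?r" for z c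
    using coeff_inv_gram[OF \<kappa> that] smsec_fibre[OF v that(1)] inv_gram_sym[OF \<kappa> x, of c] by simp
  have "anchor \<kappa> F y (\<lambda>z. form B z (v z) (w z)) x =
      anchor \<kappa> F y (\<lambda>z. \<Sum>c<?r. component \<kappa> v c z * (\<Sum>b<?r. inv_gram \<kappa> c b * component \<kappa> w b z)) x"
  proof (rule anchor_cong[OF \<kappa> x x W])
    fix z assume z: "z \<in> ?W"
    show "form B z (v z) (w z) = (\<Sum>c<?r. component \<kappa> v c z * (\<Sum>b<?r. inv_gram \<kappa> c b * component \<kappa> w b z))"
      using form_components[OF \<kappa> z smsec_fibre[OF v z] smsec_fibre[OF w z]] cw[OF z] by simp
  qed
  also have "\<dots> = (\<Sum>c<?r. anchor \<kappa> F y (\<lambda>z. component \<kappa> v c z * (\<Sum>b<?r. inv_gram \<kappa> c b * component \<kappa> w b z)) x)"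
    using sv sw by (intro anchor_sum[OF \<kappa> x x W] smooth_mult smooth_sum smooth_const W) auto
  also have "\<dots> = (\<Sum>c<?r. anchor \<kappa> F y (component \<kappa> v c) x * (\<Sum>b<?r. inv_gram \<kappa> c b * component \<kappa> w b x) +
      component \<kappa> v c x * (\<Sum>b<?r. inv_gram \<kappa> c b * anchor \<kappa> F y (component \<kappa> w b) x))"
  proof (rule sum.cong[OF refl])
    fix c assume c: "c \<in> {..<?r}"
    have "anchor \<kappa> F y (\<lambda>z. \<Sum>b<?r. inv_gram \<kappa> c b * component \<kappa> w b z) x =
        (\<Sum>b<?r. anchor \<kappa> F y (\<lambda>z. inv_gram \<kappa> c b * component \<kappa> w b z) x)"
      using sw by (intro anchor_sum[OF \<kappa> x x W] smooth_mult smooth_const W) auto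
    also have "\<dots> = (\<Sum>b<?r. inv_gram \<kappa> c b * anchor \<kappa> F y (component \<kappa> w b) x)"
      using sw by (intro sum.cong refl anchor_cmult[OF \<kappa> x x W]) auto
    finally have 1: "anchor \<kappa> F y (\<lambda>z. \<Sum>b<?r. inv_gram \<kappa> c b * component \<kappa> w b z) x = \<dots>" .
    have "smooth ?W (\<lambda>z. \<Sum>b<?r. inv_gram \<kappa> c b * component \<kappa> w b z)"
      using sw by (intro smooth_sum smooth_mult smooth_const W) auto
    from anchor_mult[OF \<kappa> x x W sv this, where F = F and w = y] c
    show "anchor \<kappa> F y (\<lambda>z. component \<kappa> v c z * (\<Sum>b<?r. inv_gram \<kappa> c b * component \<kappa> w b z)) x =
      anchor \<kappa> F y (component \<kappa> v c) x * (\<Sum>b<?r. inv_gram \<kappa> c b * component \<kappa> w b x) +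
      component \<kappa> v c x * (\<Sum>b<?r. inv_gram \<kappa> c b * anchor \<kappa> F y (component \<kappa> w b) x)"
      by (simp add: 1)
  qed
  also have "\<dots> = (\<Sum>c<?r. anchor \<kappa> F y (component \<kappa> v c) x * frame_coeff \<kappa> (w x) c x) +
      (\<Sum>c<?r. component \<kappa> v c x * (\<Sum>b<?r. inv_gram \<kappa> c b * anchor \<kappa> F y (component \<kappa> w b) x))"
    using cw[OF x] by (simp add: sum.distrib)
  also have "(\<Sum>c<?r. component \<kappa> v c x * (\<Sum>b<?r. inv_gram \<kappa> c b * anchor \<kappa> F y (component \<kappa> w b) x)) =
      (\<Sum>b<?r. anchor \<kappa> F y (component \<kappa> w b) x * (\<Sum>c<?r. inv_gram \<kappa> c b * component \<kappa> v c x))"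
    unfolding sum_distrib_left by (subst sum.swap) (simp add: mult_ac)
  also have "\<dots> = (\<Sum>b<?r. anchor \<kappa> F y (component \<kappa> w b) x * frame_coeff \<kappa> (v x) b x)"
    using cv[OF x] by simp
  finally show ?thesis .
qed

lemma cubic_swap:
  "cubic \<kappa> F v u w x = - cubic \<kappa> F u v w x" "cubic \<kappa> F u w v x = - cubic \<kappa> F u v w x"
proof -
  show "cubic \<kappa> F u w v x = - cubic \<kappa> F u v w x"
    unfolding cubic_def
    by (subst contract3_swap[symmetric], subst contract3_minus[symmetric]) (subst d_tau_swap(2), rule refl)
  have 1: "contract3 r v' u' w' C = contract3 r u' v' w' (\<lambda>a b c. C b a c)" for r v' u' w' C
    unfolding contract3_def by (subst sum.swap) (simp add: mult_ac)
  have 2: "(\<lambda>a b c. d_tau_right a (d_tau_left b F) {#} {c} x) =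
      (\<lambda>a b c. - d_tau_right b (d_tau_left a F) {#} {c} x)"
    by (intro ext) (rule d_tau_swap(1))
  show "cubic \<kappa> F v u w x = - cubic \<kappa> F u v w x"
    unfolding cubic_def by (subst 1) (simp only: 2 contract3_minus)
qed

lemma dorfman_form_sym:
  assumes "\<kappa> \<in> adapted_charts B" "x \<in> ac_dom \<kappa>" "smsec (ac_dom \<kappa>) u" "smsec (ac_dom \<kappa>) v"
  shows "dorfman_form \<kappa> F u v w x + dorfman_form \<kappa> F v u w x = anchor \<kappa> F w (\<lambda>z. form B z (u z) (v z)) x"
  unfolding anchor_form[OF assms] dorfman_form_def cubic_swap(1)[of \<kappa> F "v x"] by simp

lemma dorfman_form_metric:
  assumes "\<kappa> \<in> adapted_charts B" "x \<in> ac_dom \<kappa>" "smsec (ac_dom \<kappa>) v" "smsec (ac_dom \<kappa>) w"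
  shows "dorfman_form \<kappa> F u v (w x) x + dorfman_form \<kappa> F u w (v x) x =
    anchor \<kappa> F (u x) (\<lambda>z. form B z (v z) (w z)) x"
  unfolding anchor_form[OF assms] dorfman_form_def cubic_swap(2)[of \<kappa> F "u x" "w x"] by simp

end

subsection \<open>Independence of the adapted chart\<close>

context metric_bundle_space
begin

lemma frame_coeff_change:
  assumes \<kappa>: "\<kappa> \<in> adapted_charts B" and \<kappa>': "\<kappa>' \<in> adapted_charts B"
    and x: "x \<in> ac_dom \<kappa>" "x \<in> ac_dom \<kappa>'" and w: "w \<in> fibre B x"
  shows "(\<Sum>a<ac_rank \<kappa>. frame_coeff \<kappa> w a x * frame_coeff \<kappa>' (ac_frame \<kappa> a x) d x) = frame_coeff \<kappa>' w d x"
proof -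
  note e = adapted_chart(4)[OF \<kappa> x(1)]
  have "frame_coeff \<kappa>' w d x = frame_coeff \<kappa>' (\<Sum>a<ac_rank \<kappa>. frame_coeff \<kappa> w a x *\<^sub>R ac_frame \<kappa> a x) d x"
    using basis_expand[OF e w] by simp
  also have "\<dots> = (\<Sum>a<ac_rank \<kappa>. frame_coeff \<kappa> w a x * frame_coeff \<kappa>' (ac_frame \<kappa> a x) d x)"
    using basis_in_fibre[OF e] by (intro frame_coeff_sum[OF adapted_chart(4)[OF \<kappa>' x(2)]]) auto
  finally show ?thesis by simp
qed

context
  fixes \<kappa> \<kappa>' and x :: 'm
  assumes \<kappa>: "\<kappa> \<in> adapted_charts B" and \<kappa>': "\<kappa>' \<in> adapted_charts B"
    and x: "x \<in> ac_dom \<kappa>" and x': "x \<in> ac_dom \<kappa>'"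
begin

text \<open>The coefficients of the frame of \<open>\<kappa>'\<close> with respect to that of \<open>\<kappa>\<close>.\<close>

definition transition :: "nat \<Rightarrow> nat \<Rightarrow> 'm \<Rightarrow> real" where
  "transition k c z = frame_coeff \<kappa> (ac_frame \<kappa>' c z) k z"

text \<open>The difference of the flat connections of \<open>\<kappa>\<close> and \<open>\<kappa>'\<close> in direction of the \<open>j\<close>-th coordinate of
  \<open>\<kappa>'\<close>, applied to \<open>w\<close> and paired with \<open>v\<close>.\<close>

definition connection_diff :: "nat \<Rightarrow> 'v \<Rightarrow> 'v \<Rightarrow> real" where
  "connection_diff j v w = (\<Sum>k<ac_rank \<kappa>. form B x v (ac_frame \<kappa> k x) *
    (\<Sum>c<ac_rank \<kappa>'. chart_deriv (ac_chart \<kappa>') j (transition k c) x * frame_coeff \<kappa>' w c x))"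

lemma overlap: "open (ac_dom \<kappa> \<inter> ac_dom \<kappa>')" "x \<in> ac_dom \<kappa> \<inter> ac_dom \<kappa>'"
  using adapted_chart(1)[OF \<kappa>] adapted_chart(1)[OF \<kappa>'] x x' by auto

lemma smooth_transition:
  assumes "k < ac_rank \<kappa>" "c < ac_rank \<kappa>'"
  shows "smooth (ac_dom \<kappa> \<inter> ac_dom \<kappa>') (transition k c)"
proof -
  let ?W = "ac_dom \<kappa> \<inter> ac_dom \<kappa>'"
  have W: "open ?W" by (rule overlap)
  have e': "smsec ?W (ac_frame \<kappa>' c)"
    using adapted_chart(5)[OF \<kappa>' assms(2)] by (rule smsec_subset) simp
  have "smooth ?W (\<lambda>z. \<Sum>b<ac_rank \<kappa>. inv_gram \<kappa> k b * component \<kappa> (ac_frame \<kappa>' c) b z)"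
    using smooth_component[OF \<kappa> W _ e'] by (intro smooth_sum smooth_mult smooth_const W) auto
  moreover have "transition k c z = (\<Sum>b<ac_rank \<kappa>. inv_gram \<kappa> k b * component \<kappa> (ac_frame \<kappa>' c) b z)"
    if "z \<in> ?W" for z
    using coeff_inv_gram[OF \<kappa> _ assms(1) smsec_fibre[OF e' that]] that by (simp add: transition_def)
  ultimately show ?thesis by (subst smooth_cong[OF W]) auto
qed

text \<open>Both frames have constant Gram matrices, so that both flat connections are metric.\<close>

lemma connection_diff_skew:
  assumes v: "v \<in> fibre B x" and w: "w \<in> fibre B x" and j: "j < mdim B"
  shows "connection_diff j w v = - connection_diff j v w"
proof -
  let ?W = "ac_dom \<kappa> \<inter> ac_dom \<kappa>'"
  let ?r = "ac_rank \<kappa>" and ?r' = "ac_rank \<kappa>'"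
  obtain U q where q: "ac_chart \<kappa>' = (U, q)" "(U, q) \<in> atlas B" "ac_dom \<kappa>' \<subseteq> U"
    using adapted_chart_pair[OF \<kappa>'] .
  have xU: "x \<in> U" using q(3) x' by blast
  note W = overlap
  define P where "P k c = chart_deriv (ac_chart \<kappa>') j (transition k c) x" for k c
  define M where "M d c = (\<Sum>k<?r. form B x (ac_frame \<kappa>' d x) (ac_frame \<kappa> k x) * P k c)" for d c
  have e'_in: "ac_frame \<kappa>' c z \<in> fibre B z" if "z \<in> ac_dom \<kappa>'" "c < ?r'" for z c
    using basis_in_fibre[OF adapted_chart(4)[OF \<kappa>' that(1)] that(2)] .
  have gram: "form B z (ac_frame \<kappa>' d z) (ac_frame \<kappa> k z) = (\<Sum>l<?r. ac_gram \<kappa> l k * transition l d z)"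
    if z: "z \<in> ?W" and k: "k < ?r" and d: "d < ?r'" for z k d
  proof -
    have z': "z \<in> ac_dom \<kappa>" "z \<in> ac_dom \<kappa>'" using z by auto
    have k_in: "ac_frame \<kappa> k z \<in> fibre B z" using basis_in_fibre[OF adapted_chart(4)[OF \<kappa> z'(1)] k] .
    have "form B z (ac_frame \<kappa> k z) (ac_frame \<kappa>' d z) =
        (\<Sum>l<?r. form B z (ac_frame \<kappa> k z) (ac_frame \<kappa> l z) * transition l d z)"
      using form_components[OF \<kappa> z'(1) k_in e'_in[OF z'(2) d]] by (simp add: transition_def)
    also have "\<dots> = (\<Sum>l<?r. ac_gram \<kappa> l k * transition l d z)"
    proof (rule sum.cong[OF refl])
      fix l assume "l \<in> {..<?r}"
      then have l: "l < ?r" by simp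
      show "form B z (ac_frame \<kappa> k z) (ac_frame \<kappa> l z) * transition l d z = ac_gram \<kappa> l k * transition l d z"
        using adapted_chart(6)[OF \<kappa> z'(1) l k] form_sym[OF k_in basis_in_fibre[OF adapted_chart(4)[OF \<kappa> z'(1)] l]]
        by simp
    qed
    finally show ?thesis using form_sym[OF k_in e'_in[OF z'(2) d]] by simp
  qed
  have M: "M d c + M c d = 0" if c: "c < ?r'" and d: "d < ?r'" for c d
  proof -
    let ?f = "\<lambda>z. \<Sum>k<?r. (\<Sum>l<?r. ac_gram \<kappa> l k * transition l d z) * transition k c z"
    have st: "smooth ?W (transition k c)" "smooth ?W (transition k d)" if "k < ?r" for k
      using smooth_transition c d that by auto
    have sg: "smooth ?W (\<lambda>z. \<Sum>l<?r. ac_gram \<kappa> l k * transition l d z)" for k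
      using st by (intro smooth_sum smooth_mult smooth_const W) auto
    have dg: "chart_deriv (U, q) j (\<lambda>z. \<Sum>l<?r. ac_gram \<kappa> l k * transition l d z) x =
        (\<Sum>l<?r. ac_gram \<kappa> l k * P l d)" for k
    proof -
      have "chart_deriv (U, q) j (\<lambda>z. \<Sum>l<?r. ac_gram \<kappa> l k * transition l d z) x =
          (\<Sum>l<?r. chart_deriv (U, q) j (\<lambda>z. ac_gram \<kappa> l k * transition l d z) x)"
        using st by (intro chart_deriv_sum[OF q(2) W(1) _ xU W(2) j] smooth_mult smooth_const W) auto
      also have "\<dots> = (\<Sum>l<?r. ac_gram \<kappa> l k * P l d)"
        unfolding P_def q(1) using st
        by (intro sum.cong refl chart_deriv_cmult[OF q(2) W(1) _ xU W(2) j]) auto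
      finally show ?thesis .
    qed
    have const: "?f z = ac_gram \<kappa>' d c" if z: "z \<in> ?W" for z
    proof -
      have z': "z \<in> ac_dom \<kappa>" "z \<in> ac_dom \<kappa>'" using z by auto
      show ?thesis
        using form_components[OF \<kappa> z'(1) e'_in[OF z'(2) d] e'_in[OF z'(2) c]] gram[OF z _ d]
          adapted_chart(6)[OF \<kappa>' z'(2) d c]
        by (simp add: transition_def)
    qed
    have "chart_deriv (U, q) j ?f x = chart_deriv (U, q) j (\<lambda>z. ac_gram \<kappa>' d c) x"
      by (rule chart_deriv_cong[OF q(2) W(1) xU W(2) j]) (rule const)
    then have "0 = chart_deriv (U, q) j ?f x" by (simp only: chart_deriv_const)
    also have "\<dots> = (\<Sum>k<?r. chart_deriv (U, q) j (\<lambda>z. (\<Sum>l<?r. ac_gram \<kappa> l k * transition l d z) * transition k c z) x)"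
      using st sg by (intro chart_deriv_sum[OF q(2) W(1) _ xU W(2) j] smooth_mult W) auto
    also have "\<dots> = (\<Sum>k<?r. (\<Sum>l<?r. ac_gram \<kappa> l k * P l d) * transition k c x +
        (\<Sum>l<?r. ac_gram \<kappa> l k * transition l d x) * P k c)"
    proof (rule sum.cong[OF refl])
      fix k assume "k \<in> {..<?r}"
      then show "chart_deriv (U, q) j (\<lambda>z. (\<Sum>l<?r. ac_gram \<kappa> l k * transition l d z) * transition k c z) x =
        (\<Sum>l<?r. ac_gram \<kappa> l k * P l d) * transition k c x + (\<Sum>l<?r. ac_gram \<kappa> l k * transition l d x) * P k c"
        using chart_deriv_mult[OF q(2) W(1) sg st(1) xU W(2) j, of k k] dg[of k]
        by (simp add: P_def q(1) del: chart_deriv.simps)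
    qed
    also have "\<dots> = (\<Sum>k<?r. (\<Sum>l<?r. ac_gram \<kappa> l k * P l d) * transition k c x) + M d c"
      unfolding M_def sum.distrib using gram[OF W(2) _ d] by simp
    also have "(\<Sum>k<?r. (\<Sum>l<?r. ac_gram \<kappa> l k * P l d) * transition k c x) = M c d"
    proof -
      have gs: "ac_gram \<kappa> l k = ac_gram \<kappa> k l" if "l < ?r" "k < ?r" for l k
        using adapted_chart(6)[OF \<kappa> x that] adapted_chart(6)[OF \<kappa> x that(2,1)]
          form_sym[OF basis_in_fibre[OF adapted_chart(4)[OF \<kappa> x] that(1)]
            basis_in_fibre[OF adapted_chart(4)[OF \<kappa> x] that(2)]] by simp
      have "(\<Sum>k<?r. (\<Sum>l<?r. ac_gram \<kappa> l k * P l d) * transition k c x) =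
          (\<Sum>l<?r. \<Sum>k<?r. ac_gram \<kappa> l k * P l d * transition k c x)"
        by (subst sum.swap) (simp add: sum_distrib_right)
      also have "\<dots> = (\<Sum>l<?r. (\<Sum>k<?r. ac_gram \<kappa> k l * transition k c x) * P l d)"
      proof (rule sum.cong[OF refl])
        fix l assume "l \<in> {..<?r}"
        then have "(\<Sum>k<?r. ac_gram \<kappa> l k * P l d * transition k c x) = (\<Sum>k<?r. ac_gram \<kappa> k l * transition k c x * P l d)"
          by (intro sum.cong refl) (simp add: gs[of l])
        then show "(\<Sum>k<?r. ac_gram \<kappa> l k * P l d * transition k c x) = (\<Sum>k<?r. ac_gram \<kappa> k l * transition k c x) * P l d"
          by (simp add: sum_distrib_right)
      qed
      also have "\<dots> = M c d" unfolding M_def using gram[OF W(2) _ c] by simp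
      finally show ?thesis .
    qed
    finally show ?thesis by simp
  qed
  have cd: "connection_diff j v w = (\<Sum>d<?r'. \<Sum>c<?r'. frame_coeff \<kappa>' v d x * frame_coeff \<kappa>' w c x * M d c)"
    if v: "v \<in> fibre B x" for v w
  proof -
    have fv: "form B x v (ac_frame \<kappa> k x) = (\<Sum>d<?r'. frame_coeff \<kappa>' v d x * form B x (ac_frame \<kappa>' d x) (ac_frame \<kappa> k x))"
      if k: "k < ?r" for k
    proof -
      note e' = adapted_chart(4)[OF \<kappa>' x']
      have "ac_frame \<kappa> k x \<in> fibre B x" using basis_in_fibre[OF adapted_chart(4)[OF \<kappa> x] k] .
      then show ?thesis
        using form_sum_left[of "{..<?r'}" "\<lambda>d. ac_frame \<kappa>' d x" x "ac_frame \<kappa> k x" "\<lambda>d. frame_coeff \<kappa>' v d x"]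
          basis_in_fibre[OF e'] basis_expand[OF e' v] by simp
    qed
    have "connection_diff j v w = (\<Sum>k<?r. \<Sum>d<?r'. \<Sum>c<?r'. frame_coeff \<kappa>' v d x * frame_coeff \<kappa>' w c x *
        (form B x (ac_frame \<kappa>' d x) (ac_frame \<kappa> k x) * P k c))"
      unfolding connection_diff_def P_def[symmetric]
    proof (rule sum.cong[OF refl])
      fix k assume "k \<in> {..<?r}"
      then have k: "k < ?r" by simp
      show "form B x v (ac_frame \<kappa> k x) * (\<Sum>c<?r'. P k c * frame_coeff \<kappa>' w c x) =
        (\<Sum>d<?r'. \<Sum>c<?r'. frame_coeff \<kappa>' v d x * frame_coeff \<kappa>' w c x *
          (form B x (ac_frame \<kappa>' d x) (ac_frame \<kappa> k x) * P k c))"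
        unfolding fv[OF k] sum_product by (simp add: mult_ac)
    qed
    also have "\<dots> = (\<Sum>d<?r'. \<Sum>k<?r. \<Sum>c<?r'. frame_coeff \<kappa>' v d x * frame_coeff \<kappa>' w c x *
        (form B x (ac_frame \<kappa>' d x) (ac_frame \<kappa> k x) * P k c))"
      by (rule sum.swap)
    also have "\<dots> = (\<Sum>d<?r'. \<Sum>c<?r'. \<Sum>k<?r. frame_coeff \<kappa>' v d x * frame_coeff \<kappa>' w c x *
        (form B x (ac_frame \<kappa>' d x) (ac_frame \<kappa> k x) * P k c))"
      by (rule sum.cong[OF refl]) (rule sum.swap)
    finally show ?thesis by (simp add: M_def sum_distrib_left)
  qed
  have "connection_diff j w v = (\<Sum>c<?r'. \<Sum>d<?r'. frame_coeff \<kappa>' w c x * frame_coeff \<kappa>' v d x * M c d)"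
    using cd[OF w] .
  also have "\<dots> = (\<Sum>d<?r'. \<Sum>c<?r'. frame_coeff \<kappa>' w c x * frame_coeff \<kappa>' v d x * M c d)"
    by (rule sum.swap)
  also have "\<dots> = (\<Sum>d<?r'. \<Sum>c<?r'. - (frame_coeff \<kappa>' v d x * frame_coeff \<kappa>' w c x * M d c))"
  proof (intro sum.cong refl)
    fix c d assume "d \<in> {..<?r'}" "c \<in> {..<?r'}"
    then have "M c d = - M d c" using M[of c d] by simp
    then show "frame_coeff \<kappa>' w c x * frame_coeff \<kappa>' v d x * M c d =
      - (frame_coeff \<kappa>' v d x * frame_coeff \<kappa>' w c x * M d c)" by simp
  qed
  also have "\<dots> = - connection_diff j v w" using cd[OF v] by (simp add: sum_negf)
  finally show ?thesis .
qed

context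
  fixes F F' :: "'m lfun"
  assumes tr: "\<And>m S. F m S x = substitute (mdim B) 3 \<kappa> \<kappa>' F' m S x"
begin

lemma anchor_coord_change:
  assumes i: "i < mdim B" and w: "w \<in> fibre B x"
  shows "anchor_coord \<kappa> F i w x = (\<Sum>j<mdim B. anchor_coord \<kappa>' F' j w x *
    chart_deriv (ac_chart \<kappa>') j (\<lambda>z. snd (ac_chart \<kappa>) z i) x)"
proof -
  let ?r = "ac_rank \<kappa>" and ?r' = "ac_rank \<kappa>'" and ?n = "mdim B"
  define J where "J j = chart_deriv (ac_chart \<kappa>') j (\<lambda>z. snd (ac_chart \<kappa>) z i) x" for j
  have "(\<Sum>a<?r. frame_coeff \<kappa> w a x * F {#i#} {a} x) =
      (\<Sum>a<?r. \<Sum>(j, d)\<in>{..<?n} \<times> {..<?r'}. F' {#j#} {d} x * J j * (frame_coeff \<kappa> w a x * frame_coeff \<kappa>' (ac_frame \<kappa> a x) d x))"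
    by (intro sum.cong refl)
      (simp add: substitute_mixed[OF i] tr J_def sum_distrib_left case_prod_beta mult_ac)
  also have "\<dots> = (\<Sum>(j, d)\<in>{..<?n} \<times> {..<?r'}. F' {#j#} {d} x * J j *
      (\<Sum>a<?r. frame_coeff \<kappa> w a x * frame_coeff \<kappa>' (ac_frame \<kappa> a x) d x))"
    by (subst sum.swap) (simp add: sum_distrib_left case_prod_beta)
  also have "\<dots> = (\<Sum>(j, d)\<in>{..<?n} \<times> {..<?r'}. F' {#j#} {d} x * J j * frame_coeff \<kappa>' w d x)"
    by (simp add: frame_coeff_change[OF \<kappa> \<kappa>' x x' w])
  also have "\<dots> = (\<Sum>j<?n. (\<Sum>d<?r'. frame_coeff \<kappa>' w d x * F' {#j#} {d} x) * J j)"
    by (simp add: sum.cartesian_product[symmetric] sum_distrib_left mult_ac)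
  finally show ?thesis
    by (simp add: anchor_coord_def J_def sum_negf)
qed

lemma anchor_change:
  assumes W: "open W" "x \<in> W" "smooth W f" and w: "w \<in> fibre B x"
  shows "anchor \<kappa>' F' w f x = anchor \<kappa> F w f x"
proof -
  let ?n = "mdim B"
  obtain U q where q: "ac_chart \<kappa> = (U, q)" "(U, q) \<in> atlas B" "ac_dom \<kappa> \<subseteq> U"
    using adapted_chart_pair[OF \<kappa>] .
  obtain U' q' where q': "ac_chart \<kappa>' = (U', q')" "(U', q') \<in> atlas B" "ac_dom \<kappa>' \<subseteq> U'"
    using adapted_chart_pair[OF \<kappa>'] .
  have "anchor \<kappa> F w f x = (\<Sum>i<?n. \<Sum>j<?n. anchor_coord \<kappa>' F' j w x *
      (chart_deriv (U, q) i f x * chart_deriv (U', q') j (\<lambda>z. q z i) x))"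
    unfolding anchor_def by (simp add: anchor_coord_change[OF _ w] q q' sum_distrib_left mult_ac del: chart_deriv.simps)
  also have "\<dots> = (\<Sum>j<?n. anchor_coord \<kappa>' F' j w x *
      (\<Sum>i<?n. chart_deriv (U, q) i f x * chart_deriv (U', q') j (\<lambda>z. q z i) x))"
    by (subst sum.swap) (simp add: sum_distrib_left del: chart_deriv.simps)
  also have "\<dots> = (\<Sum>j<?n. anchor_coord \<kappa>' F' j w x * chart_deriv (U', q') j f x)"
  proof (rule sum.cong[OF refl])
    fix j assume "j \<in> {..<?n}"
    then have j: "j < ?n" by simp
    have U: "x \<in> U" "x \<in> U'" using x x' q(3) q'(3) by auto
    show "anchor_coord \<kappa>' F' j w x * (\<Sum>i<?n. chart_deriv (U, q) i f x * chart_deriv (U', q') j (\<lambda>z. q z i) x) =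
        anchor_coord \<kappa>' F' j w x * chart_deriv (U', q') j f x"
      unfolding chart_deriv_chain[OF q(2) q'(2) W(1,3) U W(2) j] ..
  qed
  finally show ?thesis by (simp add: anchor_def q' del: chart_deriv.simps)
qed

text \<open>A derivative term of \<open>dorfman_form\<close>, in both charts.\<close>

lemma derivative_term_change:
  assumes v: "v \<in> sections B" and w: "w \<in> fibre B x" and y: "y \<in> fibre B x"
  shows "(\<Sum>d<ac_rank \<kappa>'. anchor \<kappa>' F' y (component \<kappa>' v d) x * frame_coeff \<kappa>' w d x) =
    (\<Sum>k<ac_rank \<kappa>. anchor \<kappa> F y (component \<kappa> v k) x * frame_coeff \<kappa> w k x) +
    (\<Sum>j<mdim B. anchor_coord \<kappa>' F' j y x * connection_diff j (v x) w)"
proof -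
  let ?W = "ac_dom \<kappa> \<inter> ac_dom \<kappa>'"
  let ?r = "ac_rank \<kappa>" and ?r' = "ac_rank \<kappa>'" and ?n = "mdim B"
  note W = overlap
  have st: "smooth ?W (transition k d)" if "k < ?r" "d < ?r'" for k d
    using smooth_transition that .
  have sv: "smooth ?W (component \<kappa> v k)" if "k < ?r" for k
    using smooth_component[OF \<kappa> W(1) _ sections_smsec[OF v] that] by simp
  have 1: "anchor \<kappa>' F' y (component \<kappa>' v d) x =
      (\<Sum>k<?r. anchor \<kappa> F y (component \<kappa> v k) x * transition k d x +
        component \<kappa> v k x * anchor \<kappa>' F' y (transition k d) x)" if d: "d < ?r'" for d
  proof -
    have "anchor \<kappa>' F' y (component \<kappa>' v d) x = anchor \<kappa>' F' y (\<lambda>z. \<Sum>k<?r. component \<kappa> v k z * transition k d z) x"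
    proof (rule anchor_cong[OF \<kappa>' x' W(2,1)])
      fix z assume z: "z \<in> ?W"
      have "ac_frame \<kappa>' d z \<in> fibre B z"
        using basis_in_fibre[OF adapted_chart(4)[OF \<kappa>'] d] z by auto
      then show "component \<kappa>' v d z = (\<Sum>k<?r. component \<kappa> v k z * transition k d z)"
        using form_components[OF \<kappa> _ sections_fibre[OF v]] z by (simp add: transition_def)
    qed
    also have "\<dots> = (\<Sum>k<?r. anchor \<kappa>' F' y (\<lambda>z. component \<kappa> v k z * transition k d z) x)"
      using sv st d by (intro anchor_sum[OF \<kappa>' x' W(2,1)] smooth_mult W) auto
    also have "\<dots> = (\<Sum>k<?r. anchor \<kappa>' F' y (component \<kappa> v k) x * transition k d x +
        component \<kappa> v k x * anchor \<kappa>' F' y (transition k d) x)"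
      using sv st d by (intro sum.cong refl anchor_mult[OF \<kappa>' x' W(2,1)]) auto
    finally show ?thesis using anchor_change[OF W sv y] by simp
  qed
  have "(\<Sum>d<?r'. anchor \<kappa>' F' y (component \<kappa>' v d) x * frame_coeff \<kappa>' w d x) =
      (\<Sum>d<?r'. (\<Sum>k<?r. anchor \<kappa> F y (component \<kappa> v k) x * transition k d x) * frame_coeff \<kappa>' w d x) +
      (\<Sum>d<?r'. (\<Sum>k<?r. component \<kappa> v k x * anchor \<kappa>' F' y (transition k d) x) * frame_coeff \<kappa>' w d x)"
    by (simp add: 1 sum.distrib distrib_right)
  also have "(\<Sum>d<?r'. (\<Sum>k<?r. anchor \<kappa> F y (component \<kappa> v k) x * transition k d x) * frame_coeff \<kappa>' w d x) =
      (\<Sum>k<?r. anchor \<kappa> F y (component \<kappa> v k) x * (\<Sum>d<?r'. frame_coeff \<kappa>' w d x * transition k d x))"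
    unfolding sum_distrib_left sum_distrib_right by (subst sum.swap) (simp add: mult_ac)
  also have "\<dots> = (\<Sum>k<?r. anchor \<kappa> F y (component \<kappa> v k) x * frame_coeff \<kappa> w k x)"
    unfolding transition_def frame_coeff_change[OF \<kappa>' \<kappa> x' x w] ..
  also have "(\<Sum>d<?r'. (\<Sum>k<?r. component \<kappa> v k x * anchor \<kappa>' F' y (transition k d) x) * frame_coeff \<kappa>' w d x) =
      (\<Sum>j<?n. anchor_coord \<kappa>' F' j y x * connection_diff j (v x) w)"
  proof -
    let ?t = "\<lambda>d k j. anchor_coord \<kappa>' F' j y x * (component \<kappa> v k x *
        (chart_deriv (ac_chart \<kappa>') j (transition k d) x * frame_coeff \<kappa>' w d x))"
    have "(\<Sum>d<?r'. (\<Sum>k<?r. component \<kappa> v k x * anchor \<kappa>' F' y (transition k d) x) * frame_coeff \<kappa>' w d x) =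
        (\<Sum>d<?r'. \<Sum>k<?r. \<Sum>j<?n. ?t d k j)"
      by (simp add: anchor_def sum_distrib_left sum_distrib_right mult_ac)
    also have "\<dots> = (\<Sum>d<?r'. \<Sum>j<?n. \<Sum>k<?r. ?t d k j)"
      by (rule sum.cong[OF refl]) (rule sum.swap)
    also have "\<dots> = (\<Sum>j<?n. \<Sum>d<?r'. \<Sum>k<?r. ?t d k j)"
      by (rule sum.swap)
    also have "\<dots> = (\<Sum>j<?n. \<Sum>k<?r. \<Sum>d<?r'. ?t d k j)"
      by (rule sum.cong[OF refl]) (rule sum.swap)
    finally show ?thesis by (simp add: connection_diff_def sum_distrib_left)
  qed
  finally show ?thesis .
qed

text \<open>The correction is the skew-symmetrization of the connection difference, with a factor \<open>1/2\<close> from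
  \<open>\<theta>\<^sub>a = 1/2 \<Sum>\<^sub>b g\<^sub>a\<^sub>b \<tau>\<^sup>b\<close> that cancels because the difference is itself skew-symmetric.\<close>

lemma cubic_change:
  assumes u: "u \<in> fibre B x" and v: "v \<in> fibre B x" and w: "w \<in> fibre B x"
  shows "cubic \<kappa> F u v w x = cubic \<kappa>' F' u v w x +
    (\<Sum>j<mdim B. connection_diff j u v * anchor_coord \<kappa>' F' j w x -
       connection_diff j u w * anchor_coord \<kappa>' F' j v x +
       connection_diff j v w * anchor_coord \<kappa>' F' j u x)"
proof -
  let ?r = "ac_rank \<kappa>" and ?r' = "ac_rank \<kappa>'" and ?n = "mdim B"
  let ?K = "contract3 ?r (\<lambda>a. frame_coeff \<kappa> u a x) (\<lambda>a. frame_coeff \<kappa> v a x) (\<lambda>a. frame_coeff \<kappa> w a x)"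
  let ?T = "{S. S \<subseteq> {..<?r'} \<and> card S = 3}"
  define t where "t d a = new_tau \<kappa> \<kappa>' d {#} {a} x" for d a
  define P where "P j a b = d_tau_left a (new_p ?n \<kappa> \<kappa>' j) {#} {b} x" for j a b
  have t: "(\<Sum>a<?r. frame_coeff \<kappa> y a x * t d a) = frame_coeff \<kappa>' y d x" if "y \<in> fibre B x" for y d
    using frame_coeff_change[OF \<kappa> \<kappa>' x x' that, of d] by (simp add: t_def new_tau_single)
  have P: "(\<Sum>a<?r. \<Sum>b<?r. frame_coeff \<kappa> y a x * frame_coeff \<kappa> z b x * P j a b) = connection_diff j y z"
    if y: "y \<in> fibre B x" and z: "z \<in> fibre B x" and j: "j < ?n" for y z j
  proof -
    have th: "(\<Sum>a<?r. frame_coeff \<kappa> y a x * theta \<kappa> k {#} {a} x) = 1/2 * form B x y (ac_frame \<kappa> k x)"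
      if k: "k < ?r" and y: "y \<in> fibre B x" for k y
    proof -
      have k_in: "ac_frame \<kappa> k x \<in> fibre B x" using basis_in_fibre[OF adapted_chart(4)[OF \<kappa> x] k] .
      have "form B x (ac_frame \<kappa> k x) y = (\<Sum>a<?r. ac_gram \<kappa> k a * frame_coeff \<kappa> y a x)"
        using form_components[OF \<kappa> x k_in y] adapted_chart(6)[OF \<kappa> x k] by simp
      then show ?thesis
        using form_sym[OF k_in y] by (simp add: theta_single sum_divide_distrib mult_ac)
    qed
    have ot: "(\<Sum>a<?r. frame_coeff \<kappa> y a x * d_old_tau \<kappa> \<kappa>' j k {#} {a} x) =
        (\<Sum>c<?r'. chart_deriv (ac_chart \<kappa>') j (transition k c) x * frame_coeff \<kappa>' y c x)"
      if y: "y \<in> fibre B x" for k y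
    proof -
      have "(\<Sum>a<?r. frame_coeff \<kappa> y a x * d_old_tau \<kappa> \<kappa>' j k {#} {a} x) =
          (\<Sum>a<?r. \<Sum>c<?r'. chart_deriv (ac_chart \<kappa>') j (transition k c) x * (frame_coeff \<kappa> y a x * t c a))"
        by (simp add: d_old_tau_def transition_def[abs_def] t_def sum_distrib_left mult_ac)
      also have "\<dots> = (\<Sum>c<?r'. chart_deriv (ac_chart \<kappa>') j (transition k c) x * (\<Sum>a<?r. frame_coeff \<kappa> y a x * t c a))"
        by (subst sum.swap) (simp add: sum_distrib_left)
      finally show ?thesis using t[OF y] by simp
    qed
    have "(\<Sum>a<?r. \<Sum>b<?r. frame_coeff \<kappa> y a x * frame_coeff \<kappa> z b x * P j a b) =
        (\<Sum>a<?r. \<Sum>b<?r. \<Sum>k<?r.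
          (frame_coeff \<kappa> y a x * theta \<kappa> k {#} {a} x) * (frame_coeff \<kappa> z b x * d_old_tau \<kappa> \<kappa>' j k {#} {b} x) -
          (frame_coeff \<kappa> y a x * d_old_tau \<kappa> \<kappa>' j k {#} {a} x) * (frame_coeff \<kappa> z b x * theta \<kappa> k {#} {b} x))"
      by (simp add: P_def d_tau_left_new_p sum_distrib_left algebra_simps)
    also have "\<dots> = (\<Sum>a<?r. \<Sum>k<?r. \<Sum>b<?r.
          (frame_coeff \<kappa> y a x * theta \<kappa> k {#} {a} x) * (frame_coeff \<kappa> z b x * d_old_tau \<kappa> \<kappa>' j k {#} {b} x) -
          (frame_coeff \<kappa> y a x * d_old_tau \<kappa> \<kappa>' j k {#} {a} x) * (frame_coeff \<kappa> z b x * theta \<kappa> k {#} {b} x))"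
      by (rule sum.cong[OF refl]) (rule sum.swap)
    also have "\<dots> = (\<Sum>k<?r. \<Sum>a<?r. \<Sum>b<?r.
          (frame_coeff \<kappa> y a x * theta \<kappa> k {#} {a} x) * (frame_coeff \<kappa> z b x * d_old_tau \<kappa> \<kappa>' j k {#} {b} x) -
          (frame_coeff \<kappa> y a x * d_old_tau \<kappa> \<kappa>' j k {#} {a} x) * (frame_coeff \<kappa> z b x * theta \<kappa> k {#} {b} x))"
      by (rule sum.swap)
    also have "\<dots> = (\<Sum>k<?r.
          (\<Sum>a<?r. frame_coeff \<kappa> y a x * theta \<kappa> k {#} {a} x) * (\<Sum>b<?r. frame_coeff \<kappa> z b x * d_old_tau \<kappa> \<kappa>' j k {#} {b} x) -
          (\<Sum>a<?r. frame_coeff \<kappa> y a x * d_old_tau \<kappa> \<kappa>' j k {#} {a} x) * (\<Sum>b<?r. frame_coeff \<kappa> z b x * theta \<kappa> k {#} {b} x))"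
      by (simp add: sum_subtractf sum_product)
    also have "\<dots> = (\<Sum>k<?r.
          (1/2 * form B x y (ac_frame \<kappa> k x)) * (\<Sum>c<?r'. chart_deriv (ac_chart \<kappa>') j (transition k c) x * frame_coeff \<kappa>' z c x) -
          (\<Sum>c<?r'. chart_deriv (ac_chart \<kappa>') j (transition k c) x * frame_coeff \<kappa>' y c x) * (1/2 * form B x z (ac_frame \<kappa> k x)))"
    proof (rule sum.cong[OF refl])
      fix k assume "k \<in> {..<?r}"
      then have k: "k < ?r" by simp
      show "(\<Sum>a<?r. frame_coeff \<kappa> y a x * theta \<kappa> k {#} {a} x) * (\<Sum>b<?r. frame_coeff \<kappa> z b x * d_old_tau \<kappa> \<kappa>' j k {#} {b} x) -
          (\<Sum>a<?r. frame_coeff \<kappa> y a x * d_old_tau \<kappa> \<kappa>' j k {#} {a} x) * (\<Sum>b<?r. frame_coeff \<kappa> z b x * theta \<kappa> k {#} {b} x) =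
          (1/2 * form B x y (ac_frame \<kappa> k x)) * (\<Sum>c<?r'. chart_deriv (ac_chart \<kappa>') j (transition k c) x * frame_coeff \<kappa>' z c x) -
          (\<Sum>c<?r'. chart_deriv (ac_chart \<kappa>') j (transition k c) x * frame_coeff \<kappa>' y c x) * (1/2 * form B x z (ac_frame \<kappa> k x))"
        unfolding th[OF k y] th[OF k z] ot[OF y] ot[OF z] ..
    qed
    also have "\<dots> = 1/2 * connection_diff j y z - 1/2 * connection_diff j z y"
      by (simp add: connection_diff_def sum_subtractf sum_distrib_left mult_ac)
    also have "\<dots> = connection_diff j y z" using connection_diff_skew[OF y z j] by simp
    finally show ?thesis .
  qed
  have X: "(\<Sum>d<?r'. F' {#j#} {d} x * frame_coeff \<kappa>' y d x) = - anchor_coord \<kappa>' F' j y x" for j y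
    by (simp add: anchor_coord_def mult.commute)
  have "cubic \<kappa> F u v w x = ?K (\<lambda>a b c.
      (\<Sum>p\<in>{..<?n} \<times> {..<?r'}. F' {#fst p#} {snd p} x *
        - (P (fst p) a b * t (snd p) c - P (fst p) a c * t (snd p) b + P (fst p) b c * t (snd p) a)) -
      (\<Sum>S\<in>?T. F' {#} S x * (case sorted_list_of_set S of [d, e, f] \<Rightarrow> det3 (t d) (t e) (t f) a b c)))"
    unfolding cubic_def P_def t_def
      substitute_cubic[where F = F and F' = F' and \<kappa> = \<kappa> and \<kappa>' = \<kappa>' and x = x and n = "mdim B", OF tr]
    by (simp add: case_prod_beta)
  also have "\<dots> = (\<Sum>p\<in>{..<?n} \<times> {..<?r'}. F' {#fst p#} {snd p} x *
        - ?K (\<lambda>a b c. P (fst p) a b * t (snd p) c - P (fst p) a c * t (snd p) b + P (fst p) b c * t (snd p) a)) -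
      (\<Sum>S\<in>?T. F' {#} S x * ?K (\<lambda>a b c. case sorted_list_of_set S of [d, e, f] \<Rightarrow> det3 (t d) (t e) (t f) a b c))"
    by (simp only: contract3_diff contract3_sum contract3_scale contract3_minus)
  also have "(\<Sum>S\<in>?T. F' {#} S x * ?K (\<lambda>a b c. case sorted_list_of_set S of [d, e, f] \<Rightarrow> det3 (t d) (t e) (t f) a b c)) =
      - cubic \<kappa>' F' u v w x"
  proof -
    have "?K (\<lambda>a b c. case sorted_list_of_set S of [d, e, f] \<Rightarrow> det3 (t d) (t e) (t f) a b c) =
      (case sorted_list_of_set S of [d, e, f] \<Rightarrow>
        det3 (\<lambda>d. frame_coeff \<kappa>' u d x) (\<lambda>d. frame_coeff \<kappa>' v d x) (\<lambda>d. frame_coeff \<kappa>' w d x) d e f)"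
      if card: "card S = 3" for S
    proof -
      obtain d e f where "d < e" "e < f" "S = {d, e, f}" using card_3_sorted[OF card] .
      then have l: "sorted_list_of_set S = [d, e, f]" using sorted_list_of_set_3 by simp
      show ?thesis unfolding l by (simp add: contract3_det3 t u v w)
    qed
    then show ?thesis by (simp add: cubic_def contract3_def cubic_contraction)
  qed
  also have "(\<Sum>p\<in>{..<?n} \<times> {..<?r'}. F' {#fst p#} {snd p} x *
        - ?K (\<lambda>a b c. P (fst p) a b * t (snd p) c - P (fst p) a c * t (snd p) b + P (fst p) b c * t (snd p) a)) =
      (\<Sum>p\<in>{..<?n} \<times> {..<?r'}. F' {#fst p#} {snd p} x *
        - (connection_diff (fst p) u v * frame_coeff \<kappa>' w (snd p) x -
           connection_diff (fst p) u w * frame_coeff \<kappa>' v (snd p) x +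
           connection_diff (fst p) v w * frame_coeff \<kappa>' u (snd p) x))"
  proof (rule sum.cong[OF refl])
    fix p assume "p \<in> {..<?n} \<times> {..<?r'}"
    then have j: "fst p < ?n" by auto
    show "F' {#fst p#} {snd p} x *
        - ?K (\<lambda>a b c. P (fst p) a b * t (snd p) c - P (fst p) a c * t (snd p) b + P (fst p) b c * t (snd p) a) =
      F' {#fst p#} {snd p} x *
        - (connection_diff (fst p) u v * frame_coeff \<kappa>' w (snd p) x -
           connection_diff (fst p) u w * frame_coeff \<kappa>' v (snd p) x +
           connection_diff (fst p) v w * frame_coeff \<kappa>' u (snd p) x)"
      by (simp only: contract3_add contract3_diff contract3_12 contract3_13 contract3_23
          P[OF u v j] P[OF u w j] P[OF v w j] t[OF u] t[OF v] t[OF w])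
  qed
  also have "\<dots> = (\<Sum>j<?n. \<Sum>d<?r'. F' {#j#} {d} x *
        - (connection_diff j u v * frame_coeff \<kappa>' w d x -
           connection_diff j u w * frame_coeff \<kappa>' v d x +
           connection_diff j v w * frame_coeff \<kappa>' u d x))"
    by (simp add: sum.cartesian_product case_prod_beta)
  also have "\<dots> = (\<Sum>j<?n. connection_diff j u v * anchor_coord \<kappa>' F' j w x -
       connection_diff j u w * anchor_coord \<kappa>' F' j v x +
       connection_diff j v w * anchor_coord \<kappa>' F' j u x)"
  proof (rule sum.cong[OF refl])
    fix j
    have "(\<Sum>d<?r'. F' {#j#} {d} x *
        - (connection_diff j u v * frame_coeff \<kappa>' w d x -
           connection_diff j u w * frame_coeff \<kappa>' v d x +
           connection_diff j v w * frame_coeff \<kappa>' u d x)) =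
      - (connection_diff j u v * (\<Sum>d<?r'. F' {#j#} {d} x * frame_coeff \<kappa>' w d x) -
         connection_diff j u w * (\<Sum>d<?r'. F' {#j#} {d} x * frame_coeff \<kappa>' v d x) +
         connection_diff j v w * (\<Sum>d<?r'. F' {#j#} {d} x * frame_coeff \<kappa>' u d x))"
      by (simp add: sum_distrib_left sum_negf[symmetric] sum.distrib[symmetric] sum_subtractf[symmetric] algebra_simps)
    then show "(\<Sum>d<?r'. F' {#j#} {d} x *
        - (connection_diff j u v * frame_coeff \<kappa>' w d x -
           connection_diff j u w * frame_coeff \<kappa>' v d x +
           connection_diff j v w * frame_coeff \<kappa>' u d x)) =
       connection_diff j u v * anchor_coord \<kappa>' F' j w x -
       connection_diff j u w * anchor_coord \<kappa>' F' j v x +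
       connection_diff j v w * anchor_coord \<kappa>' F' j u x"
      by (simp add: X)
  qed
  finally show ?thesis by simp
qed

text \<open>The corrections of the derivative terms and of the cubic part cancel.\<close>

lemma dorfman_form_change:
  assumes u: "u \<in> sections B" and v: "v \<in> sections B" and w: "w \<in> fibre B x"
  shows "dorfman_form \<kappa> F u v w x = dorfman_form \<kappa>' F' u v w x"
proof -
  note u_in = sections_fibre[OF u, of x] and v_in = sections_fibre[OF v, of x]
  have "(\<Sum>j<mdim B. connection_diff j (u x) (v x) * anchor_coord \<kappa>' F' j w x -
       connection_diff j (u x) w * anchor_coord \<kappa>' F' j (v x) x +
       connection_diff j (v x) w * anchor_coord \<kappa>' F' j (u x) x) =
     (\<Sum>j<mdim B. anchor_coord \<kappa>' F' j w x * connection_diff j (u x) (v x)) -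
     (\<Sum>j<mdim B. anchor_coord \<kappa>' F' j (v x) x * connection_diff j (u x) w) +
     (\<Sum>j<mdim B. anchor_coord \<kappa>' F' j (u x) x * connection_diff j (v x) w)"
    by (simp add: sum.distrib sum_subtractf mult.commute)
  then show ?thesis
    unfolding dorfman_form_def cubic_change[OF u_in v_in w]
      derivative_term_change[OF v w u_in] derivative_term_change[OF u w v_in]
      derivative_term_change[OF u v_in w]
    by simp
qed

end

end

end

section \<open>The Dorfman bracket of sections\<close>

text \<open>A metric bundle with a function \<open>\<Theta>\<close> of degree 3, whose derived bracket is the Dorfman bracket.\<close>

locale courant_space = metric_bundle_space B
  for B :: "('m::{t2_space,second_countable_topology}, 'v::real_vector) metric_bundle" +
  fixes \<Theta> :: "('m, 'v) gfun"
  assumes degree_3: "\<Theta> \<in> functions_of_degree B 3"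
begin

lemma structure_smooth: "\<kappa> \<in> adapted_charts B \<Longrightarrow> smooth (ac_dom \<kappa>) (\<Theta> \<kappa> m S)"
  using degree_3 unfolding functions_of_degree_def by blast

lemma structure_homogeneous:
  assumes "\<kappa> \<in> adapted_charts B" "x \<in> ac_dom \<kappa>"
  shows "homogeneous (mdim B) (ac_rank \<kappa>) 3 (\<Theta> \<kappa>) x"
  using degree_3 assms unfolding functions_of_degree_def homogeneous_def by blast

lemma structure_transition:
  assumes "\<kappa> \<in> adapted_charts B" "\<kappa>' \<in> adapted_charts B" "x \<in> ac_dom \<kappa>" "x \<in> ac_dom \<kappa>'"
  shows "\<Theta> \<kappa> m S x = substitute (mdim B) 3 \<kappa> \<kappa>' (\<Theta> \<kappa>') m S x"
  using degree_3 assms unfolding functions_of_degree_def by blast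

abbreviation derived_bracket :: "('m \<Rightarrow> 'v) \<Rightarrow> ('m \<Rightarrow> 'v) \<Rightarrow> ('m, 'v) gfun" where
  "derived_bracket u v \<equiv> gbracket B (gbracket B (section_fun B u) \<Theta>) (section_fun B v)"

lemma derived_bracket_homogeneous:
  assumes "\<kappa> \<in> adapted_charts B" "x \<in> ac_dom \<kappa>"
  shows "homogeneous (mdim B) (ac_rank \<kappa>) 1 (derived_bracket u v \<kappa>) x"
proof -
  have "homogeneous (mdim B) (ac_rank \<kappa>) 2 (poisson (mdim B) \<kappa> (section_fun B u \<kappa>) (\<Theta> \<kappa>)) x"
    using homogeneous_bracket_section[of "mdim B" \<kappa> 1 "\<Theta> \<kappa>" x B u] structure_homogeneous[OF assms]
    by (simp add: numeral_eq_Suc)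
  then show ?thesis
    using homogeneous_section_bracket[of "mdim B" \<kappa> 0 _ x B v] by (simp add: gbracket_def numeral_2_eq_2)
qed

lemma derived_bracket_dorfman_form:
  assumes "\<kappa> \<in> adapted_charts B" "x \<in> ac_dom \<kappa>" "u \<in> sections B" "v \<in> sections B"
  shows "(\<Sum>c<ac_rank \<kappa>. frame_coeff \<kappa> w c x * derived_bracket u v \<kappa> {#} {c} x) = dorfman_form \<kappa> (\<Theta> \<kappa>) u v w x"
  unfolding gbracket_def
  by (rule bracket_dorfman_form[OF assms(1,2) structure_homogeneous[OF assms(1,2)]])
    (use assms sections_fibre in auto)

lemma smooth_derived_bracket:
  assumes \<kappa>: "\<kappa> \<in> adapted_charts B" and u: "u \<in> sections B" and v: "v \<in> sections B" and c: "c < ac_rank \<kappa>"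
  shows "smooth (ac_dom \<kappa>) (derived_bracket u v \<kappa> {#} {c})"
proof -
  let ?W = "ac_dom \<kappa>" and ?r = "ac_rank \<kappa>" and ?n = "mdim B" and ?F = "\<Theta> \<kappa>"
  have W: "open ?W" using adapted_chart(1)[OF \<kappa>] .
  obtain U q where q: "ac_chart \<kappa> = (U, q)" "(U, q) \<in> atlas B" "?W \<subseteq> U"
    using adapted_chart_pair[OF \<kappa>] .
  have su: "smooth ?W (component \<kappa> u a)" if "a < ?r" for a
    using smooth_component[OF \<kappa> W _ sections_smsec[OF u] that] by simp
  have sv: "smooth ?W (component \<kappa> v a)" if "a < ?r" for a
    using smooth_component[OF \<kappa> W _ sections_smsec[OF v] that] by simp
  have du: "smooth ?W (\<lambda>x. chart_deriv (ac_chart \<kappa>) i (component \<kappa> u a) x)" if "a < ?r" "i < ?n" for a i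
    unfolding q(1) using smooth_chart_deriv[OF q(2) W q(3) su that(2)] that(1) .
  have dv: "smooth ?W (\<lambda>x. chart_deriv (ac_chart \<kappa>) i (component \<kappa> v a) x)" if "a < ?r" "i < ?n" for a i
    unfolding q(1) using smooth_chart_deriv[OF q(2) W q(3) sv that(2)] that(1) .
  have sC: "smooth ?W (\<lambda>x. d_tau_right a (d_tau_left b ?F) {#} {c} x)" for a b
    unfolding cubic_coeff
    by (cases "a = c \<or> b = a \<or> b = c")
      (simp_all only: if_True if_False smooth_const[OF W] smooth_mult[OF W smooth_const[OF W] structure_smooth[OF \<kappa>]])
  define f where "f = (\<lambda>x. - (\<Sum>i<?n. (\<Sum>b<?r. (\<Sum>a<?r. inv_gram \<kappa> a b * component \<kappa> u a x) * ?F {#i#} {b} x) *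
        chart_deriv (ac_chart \<kappa>) i (component \<kappa> v c) x) +
    (\<Sum>a<?r. (\<Sum>b<?r. inv_gram \<kappa> a b * component \<kappa> v b x) *
      ((\<Sum>i<?n. chart_deriv (ac_chart \<kappa>) i (component \<kappa> u c) x * ?F {#i#} {a} x -
          chart_deriv (ac_chart \<kappa>) i (component \<kappa> u a) x * ?F {#i#} {c} x) +
      (\<Sum>b<?r. (\<Sum>a<?r. inv_gram \<kappa> a b * component \<kappa> u a x) * d_tau_right a (d_tau_left b ?F) {#} {c} x))))"
  have "smooth ?W f"
    unfolding f_def using su sv du dv sC c structure_smooth[OF \<kappa>]
    by (intro smooth_add smooth_uminus smooth_sum smooth_mult smooth_diff smooth_const W) auto
  moreover have "derived_bracket u v \<kappa> {#} {c} x = f x" if "x \<in> ?W" for x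
    unfolding gbracket_def f_def
    by (rule derived_bracket_coeff[OF structure_homogeneous[OF \<kappa> that] c])
  ultimately show ?thesis by (subst smooth_cong[OF W]) auto
qed

text \<open>The local sections read off from the derived bracket in each adapted chart agree on overlaps by
  \<open>dorfman_form_change\<close>, and so define a global one.\<close>

lemma dorfman_ex1:
  assumes u: "u \<in> sections B" and v: "v \<in> sections B"
  shows "\<exists>!s. s \<in> sections B \<and> gfun_eq B (section_fun B s) (derived_bracket u v)"
proof -
  define s\<kappa> where "s\<kappa> \<kappa> z = (\<Sum>a<ac_rank \<kappa>. (\<Sum>b<ac_rank \<kappa>. inv_gram \<kappa> a b * derived_bracket u v \<kappa> {#} {b} z) *\<^sub>R ac_frame \<kappa> a z)"
    for \<kappa> :: "('m, 'v) adapted_chart" and z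
  have in_fibre: "s\<kappa> \<kappa> x \<in> fibre B x" if "\<kappa> \<in> adapted_charts B" "x \<in> ac_dom \<kappa>" for \<kappa> x
    unfolding s\<kappa>_def using basis_in_fibre[OF adapted_chart(4)[OF that]] by (intro fibre_sum fibre_scale) auto
  have form_s\<kappa>: "form B x (s\<kappa> \<kappa> x) w = dorfman_form \<kappa> (\<Theta> \<kappa>) u v w x"
    if \<kappa>: "\<kappa> \<in> adapted_charts B" and x: "x \<in> ac_dom \<kappa>" and w: "w \<in> fibre B x" for \<kappa> x w
  proof -
    let ?D = "\<lambda>b. derived_bracket u v \<kappa> {#} {b} x"
    note e_in = basis_in_fibre[OF adapted_chart(4)[OF \<kappa> x]]
    have "form B x (s\<kappa> \<kappa> x) w =
        (\<Sum>a<ac_rank \<kappa>. (\<Sum>b<ac_rank \<kappa>. inv_gram \<kappa> a b * ?D b) * form B x (ac_frame \<kappa> a x) w)"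
      unfolding s\<kappa>_def using e_in w by (intro form_sum_left) auto
    also have "\<dots> = (\<Sum>b<ac_rank \<kappa>. ?D b * (\<Sum>a<ac_rank \<kappa>. inv_gram \<kappa> a b * form B x (ac_frame \<kappa> a x) w))"
      unfolding sum_distrib_left sum_distrib_right by (subst sum.swap) (simp add: mult_ac)
    also have "\<dots> = (\<Sum>b<ac_rank \<kappa>. frame_coeff \<kappa> w b x * ?D b)"
    proof (rule sum.cong[OF refl])
      fix b assume "b \<in> {..<ac_rank \<kappa>}"
      then have "frame_coeff \<kappa> w b x = (\<Sum>a<ac_rank \<kappa>. inv_gram \<kappa> b a * form B x w (ac_frame \<kappa> a x))"
        using coeff_inv_gram[OF \<kappa> x _ w] by simp
      also have "\<dots> = (\<Sum>a<ac_rank \<kappa>. inv_gram \<kappa> a b * form B x (ac_frame \<kappa> a x) w)"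
        using e_in w by (intro sum.cong refl) (simp add: inv_gram_sym[OF \<kappa> x, of b] form_sym[of w])
      finally show "?D b * (\<Sum>a<ac_rank \<kappa>. inv_gram \<kappa> a b * form B x (ac_frame \<kappa> a x) w) = frame_coeff \<kappa> w b x * ?D b"
        by simp
    qed
    finally show ?thesis using derived_bracket_dorfman_form[OF \<kappa> x u v] by simp
  qed
  have indep: "s\<kappa> \<kappa> x = s\<kappa> \<kappa>' x"
    if "\<kappa> \<in> adapted_charts B" "\<kappa>' \<in> adapted_charts B" "x \<in> ac_dom \<kappa>" "x \<in> ac_dom \<kappa>'" for \<kappa> \<kappa>' x
  proof (rule form_ext)
    fix w assume w: "w \<in> fibre B x"
    show "form B x (s\<kappa> \<kappa> x) w = form B x (s\<kappa> \<kappa>' x) w"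
      using form_s\<kappa>[OF that(1,3) w] form_s\<kappa>[OF that(2,4) w]
        dorfman_form_change[where F = "\<Theta> \<kappa>" and F' = "\<Theta> \<kappa>'", OF that structure_transition[OF that] u v w] by simp
  qed (use in_fibre that in auto)
  define \<kappa>x where "\<kappa>x x = (SOME \<kappa>. \<kappa> \<in> adapted_charts B \<and> x \<in> ac_dom \<kappa>)" for x
  have \<kappa>x: "\<kappa>x x \<in> adapted_charts B" "x \<in> ac_dom (\<kappa>x x)" for x
    using someI_ex[of "\<lambda>\<kappa>. \<kappa> \<in> adapted_charts B \<and> x \<in> ac_dom \<kappa>"] adapted_chart_exists[of x]
    unfolding \<kappa>x_def by auto
  define s where "s x = s\<kappa> (\<kappa>x x) x" for x
  have s: "s x = s\<kappa> \<kappa> x" if "\<kappa> \<in> adapted_charts B" "x \<in> ac_dom \<kappa>" for \<kappa> x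
    unfolding s_def using indep[OF \<kappa>x(1) that(1) \<kappa>x(2) that(2)] .
  have "smsec UNIV s"
  proof (rule smsec_local)
    fix x
    let ?\<kappa> = "\<kappa>x x"
    have W: "open (ac_dom ?\<kappa>)" using adapted_chart(1)[OF \<kappa>x(1)] .
    have "smsec (ac_dom ?\<kappa>) (s\<kappa> ?\<kappa>)"
      unfolding s\<kappa>_def[abs_def] using adapted_chart(5)[OF \<kappa>x(1)] smooth_derived_bracket[OF \<kappa>x(1) u v]
      by (intro smsec_sum smsec_scale smooth_sum smooth_mult smooth_const W) auto
    then have "smsec (ac_dom ?\<kappa>) s"
      by (rule smsec_cong[OF W, rotated]) (simp add: s[OF \<kappa>x(1)])
    then show "\<exists>W. open W \<and> x \<in> W \<and> W \<subseteq> UNIV \<and> smsec W s" using W \<kappa>x(2) by blast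
  qed
  then have s_in: "s \<in> sections B" by (simp add: sections_iff)
  have comp: "form B x (s x) (ac_frame \<kappa> c x) = derived_bracket u v \<kappa> {#} {c} x"
    if \<kappa>: "\<kappa> \<in> adapted_charts B" and x: "x \<in> ac_dom \<kappa>" and c: "c < ac_rank \<kappa>" for \<kappa> x c
  proof -
    note e = adapted_chart(4)[OF \<kappa> x]
    have "form B x (s x) (ac_frame \<kappa> c x) = (\<Sum>b<ac_rank \<kappa>. frame_coeff \<kappa> (ac_frame \<kappa> c x) b x * derived_bracket u v \<kappa> {#} {b} x)"
      using form_s\<kappa>[OF \<kappa> x basis_in_fibre[OF e c]] derived_bracket_dorfman_form[OF \<kappa> x u v] s[OF \<kappa> x] by simp
    also have "\<dots> = (\<Sum>b<ac_rank \<kappa>. if b = c then derived_bracket u v \<kappa> {#} {c} x else 0)"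
      using frame_coeff_basis[OF e _ c] by (intro sum.cong) auto
    finally show ?thesis using c by simp
  qed
  have "gfun_eq B (section_fun B s) (derived_bracket u v)"
    unfolding gfun_eq_def
  proof (intro ballI allI)
    fix \<kappa> x m S assume \<kappa>: "\<kappa> \<in> adapted_charts B" and x: "x \<in> ac_dom \<kappa>"
    show "section_fun B s \<kappa> m S x = derived_bracket u v \<kappa> m S x"
    proof (cases "(m, S) \<in> monomials (mdim B) (ac_rank \<kappa>) 1")
      case True
      then obtain c where "c < ac_rank \<kappa>" "m = {#}" "S = {c}" by (auto simp: monomials_1 simp del: One_nat_def)
      then show ?thesis using comp[OF \<kappa> x] by (simp add: section_fun_single)
    next
      case False
      then show ?thesis
        using homogeneousD[OF derived_bracket_homogeneous[OF \<kappa> x] False] section_fun_zero[OF False, of B s] by simp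
    qed
  qed
  moreover have "s' = s" if s': "s' \<in> sections B" "gfun_eq B (section_fun B s') (derived_bracket u v)" for s'
  proof
    fix x
    show "s' x = s x"
    proof (rule form_basis_ext[OF adapted_chart(4)[OF \<kappa>x] sections_fibre[OF s'(1)] sections_fibre[OF s_in]])
      fix a assume a: "a < ac_rank (\<kappa>x x)"
      have "section_fun B s' (\<kappa>x x) {#} {a} x = derived_bracket u v (\<kappa>x x) {#} {a} x"
        using s'(2) \<kappa>x unfolding gfun_eq_def by blast
      then show "form B x (s' x) (ac_frame (\<kappa>x x) a x) = form B x (s x) (ac_frame (\<kappa>x x) a x)"
        using comp[OF \<kappa>x a] a by (simp add: section_fun_single)
    qed
  qed
  ultimately show ?thesis using s_in by blast
qed

abbreviation dorf :: "('m \<Rightarrow> 'v) \<Rightarrow> ('m \<Rightarrow> 'v) \<Rightarrow> 'm \<Rightarrow> 'v" where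
  "dorf \<equiv> dorfman B \<Theta>"

lemma dorfman_in_sections: "u \<in> sections B \<Longrightarrow> v \<in> sections B \<Longrightarrow> dorf u v \<in> sections B"
  using theI'[OF dorfman_ex1] unfolding dorfman_def by blast

lemma form_dorfman:
  assumes u: "u \<in> sections B" and v: "v \<in> sections B"
    and \<kappa>: "\<kappa> \<in> adapted_charts B" and x: "x \<in> ac_dom \<kappa>" and w: "w \<in> fibre B x"
  shows "form B x (dorf u v x) w = dorfman_form \<kappa> (\<Theta> \<kappa>) u v w x"
proof -
  have "gfun_eq B (section_fun B (dorf u v)) (derived_bracket u v)"
    using theI'[OF dorfman_ex1[OF u v]] unfolding dorfman_def by blast
  then have comp: "form B x (dorf u v x) (ac_frame \<kappa> c x) = derived_bracket u v \<kappa> {#} {c} x" if "c < ac_rank \<kappa>" for c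
    using \<kappa> x that section_fun_single[OF that, of B "dorf u v"] unfolding gfun_eq_def by metis
  have "form B x (dorf u v x) w = (\<Sum>c<ac_rank \<kappa>. frame_coeff \<kappa> w c x * derived_bracket u v \<kappa> {#} {c} x)"
    using form_components[OF \<kappa> x sections_fibre[OF dorfman_in_sections[OF u v]] w] comp by (simp add: mult.commute)
  then show ?thesis using derived_bracket_dorfman_form[OF \<kappa> x u v] by simp
qed

text \<open>The action of a vector on functions through the anchor, in an arbitrary adapted chart.\<close>

definition rho :: "'m \<Rightarrow> 'v \<Rightarrow> ('m \<Rightarrow> real) \<Rightarrow> real" where
  "rho x w f = (let \<kappa> = (SOME \<kappa>. \<kappa> \<in> adapted_charts B \<and> x \<in> ac_dom \<kappa>) in anchor \<kappa> (\<Theta> \<kappa>) w f x)"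

lemma rho_anchor:
  obtains \<kappa> where "\<kappa> \<in> adapted_charts B" "x \<in> ac_dom \<kappa>" "\<And>w f. rho x w f = anchor \<kappa> (\<Theta> \<kappa>) w f x"
proof -
  define \<kappa> where "\<kappa> = (SOME \<kappa>. \<kappa> \<in> adapted_charts B \<and> x \<in> ac_dom \<kappa>)"
  have "\<kappa> \<in> adapted_charts B \<and> x \<in> ac_dom \<kappa>"
    unfolding \<kappa>_def by (rule someI_ex) (use adapted_chart_exists in blast)
  then show thesis using that[of \<kappa>] by (simp add: rho_def \<kappa>_def[symmetric])
qed

lemma dorfman_sym:
  assumes u: "u \<in> sections B" and v: "v \<in> sections B" and w: "w \<in> fibre B x"
  shows "form B x (dorf u v x) w + form B x (dorf v u x) w = rho x w (\<lambda>z. form B z (u z) (v z))"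
proof -
  obtain \<kappa> where \<kappa>: "\<kappa> \<in> adapted_charts B" "x \<in> ac_dom \<kappa>" "\<And>w f. rho x w f = anchor \<kappa> (\<Theta> \<kappa>) w f x"
    using rho_anchor[of x] by metis
  show ?thesis
    unfolding form_dorfman[OF u v \<kappa>(1,2) w] form_dorfman[OF v u \<kappa>(1,2) w] \<kappa>(3)
    using u v by (intro dorfman_form_sym \<kappa> sections_smsec)
qed

lemma dorfman_metric:
  assumes u: "u \<in> sections B" and v: "v \<in> sections B" and w: "w \<in> sections B"
  shows "form B x (dorf u v x) (w x) + form B x (dorf u w x) (v x) = rho x (u x) (\<lambda>z. form B z (v z) (w z))"
proof -
  obtain \<kappa> where \<kappa>: "\<kappa> \<in> adapted_charts B" "x \<in> ac_dom \<kappa>" "\<And>w f. rho x w f = anchor \<kappa> (\<Theta> \<kappa>) w f x"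
    using rho_anchor[of x] by metis
  show ?thesis
    unfolding form_dorfman[OF u v \<kappa>(1,2) sections_fibre[OF w]] form_dorfman[OF u w \<kappa>(1,2) sections_fibre[OF v]] \<kappa>(3)
    using v w by (intro dorfman_form_metric \<kappa> sections_smsec)
qed

lemma rho_scale_function:
  assumes "smooth UNIV f"
  shows "rho x w (\<lambda>z. c * f z) = c * rho x w f"
proof -
  obtain \<kappa> where \<kappa>: "\<kappa> \<in> adapted_charts B" "x \<in> ac_dom \<kappa>" "\<And>w f. rho x w f = anchor \<kappa> (\<Theta> \<kappa>) w f x"
    using rho_anchor[of x] by metis
  show ?thesis unfolding \<kappa>(3) by (rule anchor_cmult[OF \<kappa>(1,2) UNIV_I open_UNIV assms])
qed

lemma rho_scale_vector:
  assumes "w \<in> fibre B x"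
  shows "rho x (c *\<^sub>R w) f = c * rho x w f"
proof -
  obtain \<kappa> where \<kappa>: "\<kappa> \<in> adapted_charts B" "x \<in> ac_dom \<kappa>" "\<And>w f. rho x w f = anchor \<kappa> (\<Theta> \<kappa>) w f x"
    using rho_anchor[of x] by metis
  have "frame_coeff \<kappa> (c *\<^sub>R w) b x = c * frame_coeff \<kappa> w b x" for b
    by (rule frame_coeff_scale[OF adapted_chart(4)[OF \<kappa>(1,2)] assms])
  then show ?thesis
    unfolding \<kappa>(3) anchor_def anchor_coord_def by (simp add: sum_distrib_left sum_negf mult_ac)
qed

lemma sections_cscale: "v \<in> sections B \<Longrightarrow> (\<lambda>z. c *\<^sub>R v z) \<in> sections B"
  using smsec_cscale[of UNIV v c] by (simp add: sections_iff)

lemma smooth_form_sections: "u \<in> sections B \<Longrightarrow> v \<in> sections B \<Longrightarrow> smooth UNIV (\<lambda>z. form B z (u z) (v z))"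
  by (intro smooth_form) (simp_all add: sections_iff)

lemma dorfman_cscale:
  assumes u: "u \<in> sections B" and v: "v \<in> sections B"
  shows "dorf u (\<lambda>z. c *\<^sub>R v z) x = c *\<^sub>R dorf u v x"
proof -
  note cv = sections_cscale[OF v, of c]
  note d_in = sections_fibre[OF dorfman_in_sections]
  show ?thesis
  proof (rule form_ext)
    fix w0 assume "w0 \<in> fibre B x"
    then obtain w where w: "w \<in> sections B" "w x = w0" using section_through by metis
    have "(\<lambda>z. form B z (c *\<^sub>R v z) (w z)) = (\<lambda>z. c * form B z (v z) (w z))"
      using sections_fibre[OF v] sections_fibre[OF w(1)] by (simp add: form_scale_left)
    then have "form B x (dorf u (\<lambda>z. c *\<^sub>R v z) x) (w x) + form B x (dorf u w x) (c *\<^sub>R v x) =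
        c * (form B x (dorf u v x) (w x) + form B x (dorf u w x) (v x))"
      using dorfman_metric[OF u cv w(1), of x] dorfman_metric[OF u v w(1), of x]
        rho_scale_function[OF smooth_form_sections[OF v w(1)]] by simp
    then show "form B x (dorf u (\<lambda>z. c *\<^sub>R v z) x) w0 = form B x (c *\<^sub>R dorf u v x) w0"
      using sections_fibre[OF v, of x] sections_fibre[OF w(1), of x] d_in[OF u w(1)] d_in[OF u v]
      by (simp add: form_scale_left form_scale_right w(2) algebra_simps)
  qed (use u v cv d_in in auto)
qed

section \<open>The torsion of a skew-symmetric endomorphism\<close>

context
  fixes N :: "'m \<Rightarrow> 'v \<Rightarrow> 'v"
  assumes skew: "skew_endo B N"
begin

abbreviation app :: "('m \<Rightarrow> 'v) \<Rightarrow> 'm \<Rightarrow> 'v" where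
  "app \<equiv> apply_endo N"

lemma endo: "bundle_endo B N"
  using skew by (simp add: skew_endo_def)

lemma bundle_endoD:
  assumes "bundle_endo B M"
  shows "u \<in> fibre B x \<Longrightarrow> M x u \<in> fibre B x"
    "u \<in> fibre B x \<Longrightarrow> v \<in> fibre B x \<Longrightarrow> M x (u + v) = M x u + M x v"
    "u \<in> fibre B x \<Longrightarrow> M x (c *\<^sub>R u) = c *\<^sub>R M x u"
  using assms by (simp_all add: bundle_endo_def)

lemma endo_in [simp]: "u \<in> fibre B x \<Longrightarrow> N x u \<in> fibre B x"
  by (rule bundle_endoD[OF endo])

lemma endo_add: "u \<in> fibre B x \<Longrightarrow> v \<in> fibre B x \<Longrightarrow> N x (u + v) = N x u + N x v"
  by (rule bundle_endoD[OF endo])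

lemma endo_scale: "u \<in> fibre B x \<Longrightarrow> N x (c *\<^sub>R u) = c *\<^sub>R N x u"
  by (rule bundle_endoD[OF endo])

lemma form_endo: "u \<in> fibre B x \<Longrightarrow> v \<in> fibre B x \<Longrightarrow> form B x (N x u) v = - form B x u (N x v)"
  using skew by (simp add: skew_endo_def eq_neg_iff_add_eq_0)

lemma app_sections: "u \<in> sections B \<Longrightarrow> app u \<in> sections B"
  using smsec_endo[OF endo open_UNIV, of u] by (simp add: sections_iff apply_endo_def[abs_def])

text \<open>The torsion, paired with a third argument, which enters pointwise.\<close>

lemma form_torsion:
  assumes u: "u \<in> sections B" and v: "v \<in> sections B" and w: "w \<in> fibre B x"
  shows "form B x (torsion B \<Theta> N u v x) w =
    form B x (dorf (app u) (app v) x) w + form B x (dorf (app u) v x) (N x w) +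
    form B x (dorf u (app v) x) (N x w) + form B x (dorf u v x) (N x (N x w))"
proof -
  note u' = app_sections[OF u] and v' = app_sections[OF v]
  define a where "a = dorf (app u) (app v) x"
  define b where "b = dorf (app u) v x"
  define c where "c = dorf u (app v) x"
  define d where "d = dorf u v x"
  have [simp]: "a \<in> fibre B x" "b \<in> fibre B x" "c \<in> fibre B x" "d \<in> fibre B x"
    using u v u' v' by (auto simp: a_def b_def c_def d_def intro: sections_fibre dorfman_in_sections)
  have "form B x (torsion B \<Theta> N u v x) w = form B x a w - form B x (N x (b + c - N x d)) w"
    using w by (simp add: torsion_def a_def[symmetric] b_def[symmetric] c_def[symmetric] d_def[symmetric] form_diff_left)
  also have "form B x (N x (b + c - N x d)) w = - (form B x b (N x w) + form B x c (N x w) + form B x d (N x (N x w)))"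
    using w by (simp add: form_endo form_diff_left form_add_left)
  finally show ?thesis by (simp add: a_def b_def c_def d_def)
qed

lemma torsion_in_sections:
  assumes u: "u \<in> sections B" and v: "v \<in> sections B"
  shows "torsion B \<Theta> N u v \<in> sections B"
proof -
  note u' = app_sections[OF u] and v' = app_sections[OF v]
  have d: "smsec UNIV (dorf u v)" if "u \<in> sections B" "v \<in> sections B" for u v
    using dorfman_in_sections[OF that] by (simp add: sections_iff)
  have "smsec UNIV (\<lambda>x. dorf (app u) (app v) x - N x (dorf (app u) v x + dorf u (app v) x - N x (dorf u v x)))"
    using u v u' v' by (intro smsec_diff smsec_add smsec_endo[OF endo] d open_UNIV)
  then show ?thesis by (simp add: sections_iff torsion_def[abs_def])
qed

text \<open>The defect of skew-symmetry in the last two arguments.\<close>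

lemma torsion_skew_23:
  assumes u: "u \<in> sections B" and v: "v \<in> sections B" and w: "w \<in> sections B"
  shows "form B x (torsion B \<Theta> N u v x) (w x) + form B x (torsion B \<Theta> N u w x) (v x) =
    form B x (N x (N x (dorf u w x)) - dorf u (app (app w)) x) (v x)"
proof -
  note u' = app_sections[OF u] and v' = app_sections[OF v] and w' = app_sections[OF w]
  note w'' = app_sections[OF w']
  note f = sections_fibre[OF v, of x] sections_fibre[OF w, of x]
  note d = sections_fibre[OF dorfman_in_sections]
  have neg: "rho x y (\<lambda>z. form B z (a z) (app b z)) = - rho x y (\<lambda>z. form B z (app a z) (b z))"
    if "a \<in> sections B" "b \<in> sections B" for a b y
  proof -
    have "(\<lambda>z. form B z (a z) (app b z)) = (\<lambda>z. -1 * form B z (app a z) (b z))"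
      using sections_fibre[OF that(1)] sections_fibre[OF that(2)] by (simp add: apply_endo_def form_endo)
    then show ?thesis
      using rho_scale_function[OF smooth_form_sections[OF app_sections[OF that(1)] that(2)], of x y "-1"] by simp
  qed
  have 1: "form B x (dorf (app u) (app v) x) (w x) + form B x (dorf (app u) w x) (N x (v x)) +
      (form B x (dorf (app u) v x) (N x (w x)) + form B x (dorf (app u) (app w) x) (v x)) = 0"
    using dorfman_metric[OF u' v' w, of x] dorfman_metric[OF u' v w', of x] neg[OF v w, of "app u x"]
    by (simp add: apply_endo_def)
  have 2: "form B x (dorf u (app v) x) (N x (w x)) + form B x (dorf u (app w) x) (N x (v x)) +
      (form B x (dorf u v x) (N x (N x (w x))) + form B x (dorf u (app (app w)) x) (v x)) = 0"
    using dorfman_metric[OF u v' w', of x] dorfman_metric[OF u v w'', of x] neg[OF v w', of "u x"]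
    by (simp add: apply_endo_def)
  have "form B x (N x (N x (dorf u w x)) - dorf u (app (app w)) x) (v x) =
      form B x (dorf u w x) (N x (N x (v x))) - form B x (dorf u (app (app w)) x) (v x)"
    using f d[OF u w] d[OF u w''] by (simp add: form_diff_left form_endo)
  with 1 2 show ?thesis
    unfolding form_torsion[OF u v f(2)] form_torsion[OF u w f(1)] by simp
qed

text \<open>The defect of skew-symmetry in the first two arguments.\<close>

lemma torsion_skew_12:
  assumes u: "u \<in> sections B" and v: "v \<in> sections B" and w: "w \<in> fibre B x"
  shows "form B x (torsion B \<Theta> N u v x) w + form B x (torsion B \<Theta> N v u x) w =
    rho x w (\<lambda>z. form B z (app u z) (app v z)) + rho x (N x (N x w)) (\<lambda>z. form B z (u z) (v z))"
proof -
  note u' = app_sections[OF u] and v' = app_sections[OF v]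
  have "(\<lambda>z. form B z (u z) (app v z)) = (\<lambda>z. -1 * form B z (app u z) (v z))"
    using sections_fibre[OF u] sections_fibre[OF v] by (simp add: apply_endo_def form_endo)
  then have "rho x (N x w) (\<lambda>z. form B z (u z) (app v z)) = - rho x (N x w) (\<lambda>z. form B z (app u z) (v z))"
    using rho_scale_function[OF smooth_form_sections[OF u' v], of x "N x w" "-1"] by simp
  then show ?thesis
    unfolding form_torsion[OF u v w] form_torsion[OF v u w]
    using dorfman_sym[OF u' v' w] dorfman_sym[OF u' v endo_in[OF w]] dorfman_sym[OF u v' endo_in[OF w]]
      dorfman_sym[OF u v endo_in[OF endo_in[OF w]]] by simp
qed

text \<open>Skew-symmetry in the last two arguments lets \<open>N\<^sup>2\<close> commute with the bracket in the second
  argument; skew-symmetry in the first two then transfers this to the first argument.\<close>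

lemma torsion_tensor_imp_square:
  assumes irr: "irreducible_courant B \<Theta>"
    and tensor: "is_skew_3_tensor B (\<lambda>u v w x. form B x (torsion B \<Theta> N u v x) (w x))"
  shows "\<exists>c. \<forall>x. \<forall>u\<in>fibre B x. N x (N x u) = c *\<^sub>R u"
proof -
  obtain t where t: "skew_3_tensor B t"
    "\<And>u v w x. u \<in> sections B \<Longrightarrow> v \<in> sections B \<Longrightarrow> w \<in> sections B \<Longrightarrow>
      form B x (torsion B \<Theta> N u v x) (w x) = t x (u x) (v x) (w x)"
    using tensor unfolding is_skew_3_tensor_def by blast
  have t_skew: "t x v u w = - t x u v w" "t x u w v = - t x u v w"
    if "u \<in> fibre B x" "v \<in> fibre B x" "w \<in> fibre B x" for x u v w
    using t(1) that unfolding skew_3_tensor_def by blast+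
  define \<phi> where "\<phi> x v = N x (N x v)" for x v
  have app_\<phi>: "apply_endo \<phi> u = app (app u)" for u
    by (simp add: apply_endo_def \<phi>_def fun_eq_iff)
  have sym: "sym_endo B \<phi>"
    unfolding sym_endo_def bundle_endo_def
  proof (intro conjI allI ballI)
    fix t assume t: "t \<in> frames B"
    obtain U r e where Ure: "t = (U, r, e)" by (cases t)
    show "case t of (U, r, e) \<Rightarrow> \<forall>a<r. smsec U (\<lambda>x. \<phi> x (e a x))"
      using frame(1,3)[OF t[unfolded Ure]] smsec_endo[OF endo] unfolding Ure \<phi>_def by auto
  qed (auto simp: \<phi>_def endo_add endo_scale form_endo)
  have 1: "dorf u (app (app v)) = app (app (dorf u v))" if u: "u \<in> sections B" and v: "v \<in> sections B" for u v
  proof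
    fix x
    note v'' = app_sections[OF app_sections[OF v]]
    note in' = sections_fibre[OF dorfman_in_sections[OF u v], of x] sections_fibre[OF dorfman_in_sections[OF u v''], of x]
    have "N x (N x (dorf u v x)) - dorf u (app (app v)) x = 0"
    proof (rule form_nondegenerate)
      fix w0 assume "w0 \<in> fibre B x"
      then obtain w where w: "w \<in> sections B" "w x = w0" using section_through by metis
      have "form B x (torsion B \<Theta> N u w x) (v x) + form B x (torsion B \<Theta> N u v x) (w x) = 0"
        using t(2)[OF u w(1) v] t(2)[OF u v w(1)] t_skew(2)[of "u x" x "w x" "v x"]
          sections_fibre[OF u] sections_fibre[OF v] sections_fibre[OF w(1)] by simp
      then show "form B x (N x (N x (dorf u v x)) - dorf u (app (app v)) x) w0 = 0"
        using torsion_skew_23[OF u w(1) v, of x] w(2) by simp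
    qed (use in' in auto)
    then show "dorf u (app (app v)) x = app (app (dorf u v)) x" by (simp add: apply_endo_def)
  qed
  have 2: "dorf (app (app u)) v = app (app (dorf u v))" if u: "u \<in> sections B" and v: "v \<in> sections B" for u v
  proof
    fix x
    note u' = app_sections[OF u] and v' = app_sections[OF v]
    note u'' = app_sections[OF u']
    note d = sections_fibre[OF dorfman_in_sections]
    show "dorf (app (app u)) v x = app (app (dorf u v)) x"
    proof (rule form_ext)
      fix w0 assume w0: "w0 \<in> fibre B x"
      then obtain w where w: "w \<in> sections B" "w x = w0" using section_through by metis
      have "form B x (torsion B \<Theta> N u v x) w0 + form B x (torsion B \<Theta> N v u x) w0 = 0"
        using t(2)[OF u v w(1), of x] t(2)[OF v u w(1), of x] t_skew(1)[of "u x" x "v x" "w x"]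
          sections_fibre[OF u] sections_fibre[OF v] sections_fibre[OF w(1)] w(2) w0 by simp
      then have r: "rho x w0 (\<lambda>z. form B z (app u z) (app v z)) = - rho x (N x (N x w0)) (\<lambda>z. form B z (u z) (v z))"
        using torsion_skew_12[OF u v w0] by simp
      have "(\<lambda>z. form B z (app u z) (app v z)) = (\<lambda>z. -1 * form B z (app (app u) z) (v z))"
        using sections_fibre[OF u] sections_fibre[OF v] by (simp add: apply_endo_def form_endo)
      then have "rho x w0 (\<lambda>z. form B z (app u z) (app v z)) = - rho x w0 (\<lambda>z. form B z (app (app u) z) (v z))"
        using rho_scale_function[OF smooth_form_sections[OF u'' v], of x w0 "-1"] by simp
      with r have "rho x w0 (\<lambda>z. form B z (app (app u) z) (v z)) = rho x (N x (N x w0)) (\<lambda>z. form B z (u z) (v z))"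
        by simp
      moreover have "form B x (dorf v (app (app u)) x) w0 = form B x (dorf v u x) (N x (N x w0))"
        using fun_cong[OF 1[OF v u], of x] w0 d[OF v u, of x] by (simp add: apply_endo_def form_endo)
      ultimately have "form B x (dorf (app (app u)) v x) w0 = form B x (dorf u v x) (N x (N x w0))"
        using dorfman_sym[OF u'' v w0] dorfman_sym[OF u v, of "N x (N x w0)" x] w0 by simp
      then show "form B x (dorf (app (app u)) v x) w0 = form B x (app (app (dorf u v)) x) w0"
        using w0 d[OF u v, of x] by (simp add: apply_endo_def form_endo)
    qed (use d[OF u'' v] d[OF u v] in \<open>auto simp: apply_endo_def\<close>)
  qed
  have "proportional B \<phi> (\<lambda>x v. v)"
    using irr sym 1 2 unfolding irreducible_courant_def app_\<phi>[symmetric] by blast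
  then show ?thesis by (auto simp: proportional_def \<phi>_def)
qed

text \<open>The torsion is skew-symmetric on sections and pointwise in the last argument, hence pointwise in all
  three; the tensor is obtained by extending vectors to global sections.\<close>

lemma square_imp_torsion_tensor:
  assumes sq: "\<And>x u. u \<in> fibre B x \<Longrightarrow> N x (N x u) = c *\<^sub>R u"
  shows "is_skew_3_tensor B (\<lambda>u v w x. form B x (torsion B \<Theta> N u v x) (w x))"
proof -
  define T where "T u v w x = form B x (torsion B \<Theta> N u v x) w" for u v w x
  have T23: "T u w (v x) x = - T u v (w x) x" if u: "u \<in> sections B" and v: "v \<in> sections B" and w: "w \<in> sections B" for u v w x
  proof -
    have "app (app w) = (\<lambda>z. c *\<^sub>R w z)"
      using sq sections_fibre[OF w] by (simp add: apply_endo_def fun_eq_iff)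
    then have "N x (N x (dorf u w x)) = dorf u (app (app w)) x"
      using dorfman_cscale[OF u w] sq[OF sections_fibre[OF dorfman_in_sections[OF u w]]] by simp
    then show ?thesis
      using torsion_skew_23[OF u v w, of x] sections_fibre[OF v, of x] by (simp add: T_def)
  qed
  have T12: "T v u w x = - T u v w x" if u: "u \<in> sections B" and v: "v \<in> sections B" and w: "w \<in> fibre B x" for u v w x
  proof -
    have "(\<lambda>z. form B z (app u z) (app v z)) = (\<lambda>z. - c * form B z (u z) (v z))"
      using sq sections_fibre[OF u] sections_fibre[OF v]
      by (simp add: apply_endo_def form_endo form_scale_right fun_eq_iff)
    then have "rho x w (\<lambda>z. form B z (app u z) (app v z)) = - c * rho x w (\<lambda>z. form B z (u z) (v z))"
      using rho_scale_function[OF smooth_form_sections[OF u v]] by metis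
    then show ?thesis
      using torsion_skew_12[OF u v w] rho_scale_vector[OF w] sq[OF w] by (simp add: T_def)
  qed
  define ext where "ext x a = (SOME s. s \<in> sections B \<and> s x = a)" for x and a :: 'v
  have ext: "ext x a \<in> sections B" "ext x a x = a" if "a \<in> fibre B x" for x a
  proof -
    have "\<exists>s. s \<in> sections B \<and> s x = a" using section_through[OF that] by blast
    from someI_ex[OF this] show "ext x a \<in> sections B" "ext x a x = a" by (auto simp: ext_def)
  qed
  define t where "t x a b d = T (ext x a) (ext x b) d x" for x a b d
  have Tt: "T u v (w x) x = t x (u x) (v x) (w x)"
    if u: "u \<in> sections B" and v: "v \<in> sections B" and w: "w \<in> sections B" for u v w x
  proof -
    \<comment> \<open>replace one argument at a time, moving it to the last place, where the torsion is pointwise\<close>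
    note uf = sections_fibre[OF u, of x] and vf = sections_fibre[OF v, of x] and wf = sections_fibre[OF w, of x]
    define u2 where "u2 = ext x (u x)"
    define v2 where "v2 = ext x (v x)"
    have u2: "u2 \<in> sections B" "u2 x = u x" using ext[OF uf] by (auto simp: u2_def)
    have v2: "v2 \<in> sections B" "v2 x = v x" using ext[OF vf] by (auto simp: v2_def)
    have "T u v (w x) x = - T u w (v2 x) x" using T23[OF u w v] v2(2) by simp
    also have "\<dots> = T u v2 (w x) x" using T23[OF u w v2(1)] by simp
    also have "\<dots> = - T v2 u (w x) x" using T12[OF v2(1) u wf] by simp
    also have "\<dots> = T v2 w (u2 x) x" using T23[OF v2(1) u w] u2(2) by simp
    also have "\<dots> = - T v2 u2 (w x) x" using T23[OF v2(1) u2(1) w] by simp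
    also have "\<dots> = T u2 v2 (w x) x" using T12[OF v2(1) u2(1) wf] by simp
    finally show ?thesis by (simp add: t_def u2_def v2_def)
  qed
  have t12: "t x b a d = - t x a b d" if "a \<in> fibre B x" "b \<in> fibre B x" "d \<in> fibre B x" for x a b d
    unfolding t_def using T12 ext that by blast
  have t23: "t x a d b = - t x a b d" if "a \<in> fibre B x" "b \<in> fibre B x" "d \<in> fibre B x" for x a b d
    using T23[OF ext(1)[OF that(1)] ext(1)[OF that(2)] ext(1)[OF that(3)], of x]
      ext(2)[OF that(2)] ext(2)[OF that(3)] by (simp add: t_def)
  have tcyc: "t x a b d = t x b d a" if "a \<in> fibre B x" "b \<in> fibre B x" "d \<in> fibre B x" for x a b d
    using t12[OF that(2,1,3)] t23[OF that(2,1,3)] by simp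
  have tors_in: "torsion B \<Theta> N u v x \<in> fibre B x" if "u \<in> sections B" "v \<in> sections B" for u v x
    using sections_fibre[OF torsion_in_sections[OF that]] .
  have t_add: "t x (a + a') b d = t x a b d + t x a' b d"
    if "a \<in> fibre B x" "a' \<in> fibre B x" "b \<in> fibre B x" "d \<in> fibre B x" for x a a' b d
    using tcyc[of a x b d] tcyc[of a' x b d] tcyc[of "a + a'" x b d] that tors_in[OF ext(1) ext(1), of b x d x x]
    by (simp add: t_def T_def form_add_right)
  have t_scale: "t x (k *\<^sub>R a) b d = k * t x a b d"
    if "a \<in> fibre B x" "b \<in> fibre B x" "d \<in> fibre B x" for x a b d k
    using tcyc[of a x b d] tcyc[of "k *\<^sub>R a" x b d] that tors_in[OF ext(1) ext(1), of b x d x x]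
    by (simp add: t_def T_def form_scale_right)
  have t_scale3: "t x (k *\<^sub>R a) (l *\<^sub>R b) (m *\<^sub>R d) = k * l * m * t x a b d"
    if f: "a \<in> fibre B x" "b \<in> fibre B x" "d \<in> fibre B x" for x a b d k l m
    using f by (simp add: t_scale tcyc[of a x "l *\<^sub>R b"] tcyc[of b x "m *\<^sub>R d" a] tcyc[of d x a b, symmetric]
        tcyc[of b x d a] mult_ac)
  have "skew_3_tensor B t"
    unfolding skew_3_tensor_def
  proof (intro conjI allI ballI)
    fix p assume p: "p \<in> frames B"
    obtain U r e where Ure: "p = (U, r, e)" by (cases p)
    note fr = frame[OF p[unfolded Ure]]
    have "smooth U (\<lambda>x. t x (e a x) (e b x) (e d x))" if abd: "a < r" "b < r" "d < r" for a b d
    proof (rule smooth_local)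
      fix x0 assume x0: "x0 \<in> U"
      \<comment> \<open>global sections that are positive multiples of the frame sections near \<open>x0\<close>\<close>
      obtain s1 f1 W1 where 1: "s1 \<in> sections B" "open W1" "x0 \<in> W1" "W1 \<subseteq> U" "smooth W1 f1"
        "\<And>x. x \<in> W1 \<Longrightarrow> f1 x > 0" "\<And>x. x \<in> W1 \<Longrightarrow> s1 x = f1 x *\<^sub>R e a x"
        using extend_section[OF fr(1) x0 fr(3)[OF abd(1)]] by metis
      obtain s2 f2 W2 where 2: "s2 \<in> sections B" "open W2" "x0 \<in> W2" "W2 \<subseteq> U" "smooth W2 f2"
        "\<And>x. x \<in> W2 \<Longrightarrow> f2 x > 0" "\<And>x. x \<in> W2 \<Longrightarrow> s2 x = f2 x *\<^sub>R e b x"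
        using extend_section[OF fr(1) x0 fr(3)[OF abd(2)]] by metis
      obtain s3 f3 W3 where 3: "s3 \<in> sections B" "open W3" "x0 \<in> W3" "W3 \<subseteq> U" "smooth W3 f3"
        "\<And>x. x \<in> W3 \<Longrightarrow> f3 x > 0" "\<And>x. x \<in> W3 \<Longrightarrow> s3 x = f3 x *\<^sub>R e d x"
        using extend_section[OF fr(1) x0 fr(3)[OF abd(3)]] by metis
      define W where "W = W1 \<inter> W2 \<inter> W3"
      have W: "open W" "x0 \<in> W" "W \<subseteq> U" using 1 2 3 by (auto simp: W_def)
      have f: "smooth W (\<lambda>x. f1 x * f2 x * f3 x)"
        using smooth_subset[OF 1(5), of W] smooth_subset[OF 2(5), of W] smooth_subset[OF 3(5), of W]
        by (intro smooth_mult W) (auto simp: W_def)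
      have pos: "f1 x * f2 x * f3 x > 0" if "x \<in> W" for x
        using 1(6) 2(6) 3(6) that by (simp add: W_def)
      have inv: "b = a * k powr (-1)" if "a = k * b" "k > 0" for a b k :: real
        using that by (simp add: powr_minus_divide)
      have "smooth UNIV (\<lambda>x. form B x (torsion B \<Theta> N s1 s2 x) (s3 x))"
        using smooth_form_sections[OF torsion_in_sections[OF 1(1) 2(1)] 3(1)] .
      then have "smooth W (\<lambda>x. form B x (torsion B \<Theta> N s1 s2 x) (s3 x) * (f1 x * f2 x * f3 x) powr (-1))"
        using pos by (intro smooth_mult smooth_powr W f) (auto intro: smooth_subset)
      moreover have "t x (e a x) (e b x) (e d x) =
          form B x (torsion B \<Theta> N s1 s2 x) (s3 x) * (f1 x * f2 x * f3 x) powr (-1)" if x: "x \<in> W" for x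
      proof -
        have "x \<in> U" using x W by auto
        note e_in = basis_in_fibre[OF fr(2)[OF this]]
        have "form B x (torsion B \<Theta> N s1 s2 x) (s3 x) = t x (s1 x) (s2 x) (s3 x)"
          using Tt[OF 1(1) 2(1) 3(1), of x] by (simp add: T_def)
        also have "\<dots> = f1 x * f2 x * f3 x * t x (e a x) (e b x) (e d x)"
          using x 1(7) 2(7) 3(7) t_scale3[OF e_in[OF abd(1)] e_in[OF abd(2)] e_in[OF abd(3)]] by (simp add: W_def)
        finally show ?thesis using inv[OF _ pos[OF x]] by blast
      qed
      ultimately have "smooth W (\<lambda>x. t x (e a x) (e b x) (e d x))"
        by (subst smooth_cong[OF W(1)]) auto
      then show "\<exists>W. open W \<and> x0 \<in> W \<and> W \<subseteq> U \<and> smooth W (\<lambda>x. t x (e a x) (e b x) (e d x))"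
        using W by blast
    qed
    then show "case p of (U, r, e) \<Rightarrow> \<forall>a<r. \<forall>b<r. \<forall>c<r. smooth U (\<lambda>x. t x (e a x) (e b x) (e c x))"
      by (simp add: Ure)
  qed (rule t12 t23 t_add t_scale; assumption)+
  then show ?thesis
    unfolding is_skew_3_tensor_def using Tt by (intro exI[of _ t]) (auto simp: T_def)
qed

lemma square_imp_proportional_cps:
  assumes sq: "\<And>x u. u \<in> fibre B x \<Longrightarrow> N x (N x u) = c *\<^sub>R u"
  shows "\<exists>J. gen_almost_cps B J \<and> proportional B N J"
proof (cases "c = 0")
  case True
  then have "gen_almost_cps B N" using skew sq by (simp add: gen_almost_cps_def)
  moreover have "proportional B N N" by (auto simp: proportional_def intro: exI[of _ 1])
  ultimately show ?thesis by blast
next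
  case False
  define k where "k = sqrt \<bar>c\<bar>"
  have k: "k > 0" "k * k = \<bar>c\<bar>" using False by (auto simp: k_def)
  define J where "J x v = (1 / k) *\<^sub>R N x v" for x v
  have J2: "J x (J x u) = (c / \<bar>c\<bar>) *\<^sub>R u" if "u \<in> fibre B x" for x u
    using that sq[OF that] by (simp add: J_def endo_scale k(2)[symmetric])
  have "skew_endo B J"
    unfolding skew_endo_def bundle_endo_def
  proof (intro conjI allI ballI)
    fix p assume p: "p \<in> frames B"
    obtain U r e where Ure: "p = (U, r, e)" by (cases p)
    show "case p of (U, r, e) \<Rightarrow> \<forall>a<r. smsec U (\<lambda>x. J x (e a x))"
      using frame(1,3)[OF p[unfolded Ure]] smsec_endo[OF endo] smsec_cscale unfolding Ure J_def by auto
  qed (auto simp: J_def endo_add endo_scale form_endo form_scale_left form_scale_right scaleR_add_right)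
  moreover have "(\<forall>x. \<forall>u\<in>fibre B x. J x (J x u) = - u) \<or> (\<forall>x. \<forall>u\<in>fibre B x. J x (J x u) = u)"
  proof (cases "c > 0")
    case True
    then show ?thesis using J2 by simp
  next
    case False
    then have "c / \<bar>c\<bar> = -1" using \<open>c \<noteq> 0\<close> by (simp add: abs_if)
    then show ?thesis using J2 by simp
  qed
  ultimately have "gen_almost_cps B J" by (auto simp: gen_almost_cps_def)
  moreover have "proportional B N J"
    unfolding proportional_def J_def using k(1) by (intro exI[of _ k]) simp
  ultimately show ?thesis by blast
qed

lemma proportional_cps_imp_square:
  assumes J: "gen_almost_cps B J" and NJ: "proportional B N J"
  shows "\<exists>c. \<forall>x. \<forall>u\<in>fibre B x. N x (N x u) = c *\<^sub>R u"
proof -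
  obtain k where k: "\<And>x u. u \<in> fibre B x \<Longrightarrow> N x u = k *\<^sub>R J x u"
    using NJ unfolding proportional_def by blast
  have J_endo: "bundle_endo B J" using J by (simp add: gen_almost_cps_def skew_endo_def)
  have J_in: "J x u \<in> fibre B x" if "u \<in> fibre B x" for x u
    by (rule bundle_endoD[OF J_endo that])
  have J_scale: "J x (c *\<^sub>R u) = c *\<^sub>R J x u" if "u \<in> fibre B x" for x u c
    by (rule bundle_endoD[OF J_endo that])
  have "\<exists>s. \<forall>x. \<forall>u\<in>fibre B x. J x (J x u) = s *\<^sub>R u"
    using J unfolding gen_almost_cps_def
    by (metis scaleR_minus1_left scaleR_one scaleR_zero_left)
  then obtain s where s: "\<And>x u. u \<in> fibre B x \<Longrightarrow> J x (J x u) = s *\<^sub>R u" by blast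
  have "N x (N x u) = (k * k * s) *\<^sub>R u" if "u \<in> fibre B x" for x u
    using that by (simp add: k J_in J_scale s)
  then show ?thesis by blast
qed

end

end

theorem mainTheorem3:
  fixes B :: "('m::{t2_space,second_countable_topology}, 'v::real_vector) metric_bundle"
    and \<Theta> :: "('m, 'v) gfun"
    and N :: "'m \<Rightarrow> 'v \<Rightarrow> 'v"
  assumes "metric_vector_bundle B"
    and "courant_structure B \<Theta>"
    and "irreducible_courant B \<Theta>"
    and "skew_endo B N"
  shows "is_skew_3_tensor B (\<lambda>u v w x. form B x (torsion B \<Theta> N u v x) (w x)) \<longleftrightarrow>
    (\<exists>J. gen_almost_cps B J \<and> proportional B N J)"
proof -
  interpret courant_space B \<Theta>
    using assms(1,2) by unfold_locales (auto simp: courant_structure_def)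
  show ?thesis
  proof
    assume "is_skew_3_tensor B (\<lambda>u v w x. form B x (torsion B \<Theta> N u v x) (w x))"
    then obtain c where "\<forall>x. \<forall>u\<in>fibre B x. N x (N x u) = c *\<^sub>R u"
      using torsion_tensor_imp_square[OF assms(4,3)] by blast
    then show "\<exists>J. gen_almost_cps B J \<and> proportional B N J"
      using square_imp_proportional_cps[OF assms(4)] by blast
  next
    assume "\<exists>J. gen_almost_cps B J \<and> proportional B N J"
    then obtain c where "\<forall>x. \<forall>u\<in>fibre B x. N x (N x u) = c *\<^sub>R u"
      using proportional_cps_imp_square[OF assms(4)] by blast
    then show "is_skew_3_tensor B (\<lambda>u v w x. form B x (torsion B \<Theta> N u v x) (w x))"
      using square_imp_torsion_tensor[OF assms(4)] by blast
  qed
qed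

end
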